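(* Let $Q=(q_{ij})_{i,j\in\mathcal{S}}$ be a quasi-stochastic matrix with positive left and right eigenvectors $\mathsf{u},\mathsf{v}$, and let $F=(F_{ij})_{i,j\in\mathcal{S}}$ be a matrix of proper distribution functions on $\mathbb{R}$. Suppose that $\sum_{n\ge 1}q_{ii}^{(n)}=\infty$ for some $i\in\mathcal{S}$, that $\mu:=\sum_{i,j\in\mathcal{S}}\mathsf{u}_i q_{ij}\mathsf{v}_j\int x\,F_{ij}(dx)>0$, and that $Q\otimes F$ is nonarithmetic. Then the matrix renewal measure $\mathbb{V}=(\mathbb{V}_{ij})_{i,j\in\mathcal{S}}$ associated with $Q\otimes F$ satisfies $$\lim_{t\to\infty}\mathbb{V}_{ij}((t,t+h])=\frac{\mathsf{v}_i\,\mathsf{u}_j\,h}{\mu}\quad\text{and}\quad \lim_{t\to-\infty}\mathbb{V}_{ij}((t,t+h])=0$$ for all $h>0$ and $i,j\in\mathcal{S}$.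
   Context: $\mathcal{S}=\{1,\dots,m\}$ for some $m\in\mathbb{N}$, or $\mathcal{S}=\mathbb{N}$. A matrix $Q=(q_{ij})_{i,j\in\mathcal{S}}$ is called quasi-stochastic if it is an irreducible nonnegative matrix with maximal eigenvalue $1$ for which there exist positive left and right eigenvectors $\mathsf{u}=(\mathsf{u}_i)_{i\in\mathcal{S}}$, $\mathsf{v}=(\mathsf{v}_i)_{i\in\mathcal{S}}$ (all entries strictly positive), unique up to scaling, i.e. $\mathsf{u}^\top Q=\mathsf{u}^\top$ and $Q\mathsf{v}=\mathsf{v}$. (For infinite $\mathcal{S}$, "maximal eigenvalue $1$" is understood to mean only that such positive eigenvectors for the eigenvalue $1$ exist and are unique up to scaling, so that e.g. every irreducible recurrent stochastic matrix is included.) Fix such $\mathsf{u},\mathsf{v}$ (if $\sum_i\mathsf{u}_i<\infty$ and $\sum_i \mathsf{u}_i\mathsf{v}_i<\infty$ they may be normalized by $\sum_i\mathsf{u}_i=\sum_i\mathsf{u}_i\mathsf{v}_i=1$). Write $Q^n=(q_{ij}^{(n)})$; all entries are finite. Distribution functions are identified with their probability measures. $Q\otimes F(t):=(q_{ij}F_{ij}(t))_{i,j}$. The convolution powers are $(Q\otimes F)^{*0}(t)=$ identity matrix for $t\ge0$ and zero matrix for $t<0$, and $(Q\otimes F)^{*n}_{ij}(t)=\sum_{k\in\mathcal{S}}\int_{\mathbb{R}}(Q\otimes F)^{*(n-1)}_{kj}(t-x)\,q_{ik}F_{ik}(dx)$ for $n\ge1$. The matrix renewal measure associated with $Q\otimes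 F$ is $\mathbb{V}=(\mathbb{V}_{ij})_{i,j}$, the matrix of measures on $\mathbb{R}$ determined by $\mathbb{V}((t,t+h])=\sum_{n\ge0}\big((Q\otimes F)^{*n}(t+h)-(Q\otimes F)^{*n}(t)\big)$, $t\in\mathbb{R}$, $h>0$. In the definition of $\mu$ it is understood that the double sum/integral is well-defined (possibly $+\infty$), i.e. $\sum_{i,j}\mathsf{u}_iq_{ij}\mathsf{v}_j\int x^{-}F_{ij}(dx)<\infty$ or the same with $x^+$; if $\mu=\infty$, then $1/\mu:=0$. $Q\otimes F$ is called $d$-arithmetic if $d$ is the maximal positive number such that, for some function $\gamma:\mathcal{S}\to[0,d)$, $F_{ij}(\gamma(j)-\gamma(i)+d\mathbb{Z})=1$ for all $i,j\in\mathcal{S}$ with $\mathsf{u}_iq_{ij}\mathsf{v}_j>0$. If no such $d$ exists, $Q\otimes F$ is called nonarithmetic. *)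

theory Defs
  imports "HOL-Probability.Probability"
begin

text \<open>
  Vectors and matrices indexed by \<open>S\<close> are functions on \<^typ>\<open>nat\<close> whose values outside \<open>S\<close> are
  never looked at.  Possibly infinite sums of nonnegative terms are formed in \<^typ>\<open>ennreal\<close>,
  where they always exist.
\<close>

definition index_set :: "nat set \<Rightarrow> bool" where
  "index_set S \<longleftrightarrow> (\<exists>m\<ge>1. S = {1..m}) \<or> S = {1..}"

primrec mat_power :: "nat set \<Rightarrow> (nat \<Rightarrow> nat \<Rightarrow> real) \<Rightarrow> nat \<Rightarrow> nat \<Rightarrow> nat \<Rightarrow> ennreal" where
  "mat_power S Q 0 i j = (if i = j then 1 else 0)"
| "mat_power S Q (Suc n) i j = (\<Sum>\<^sub>\<infinity>k\<in>S. ennreal (Q i k) * mat_power S Q n k j)"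

definition irreducible_mat :: "nat set \<Rightarrow> (nat \<Rightarrow> nat \<Rightarrow> real) \<Rightarrow> bool" where
  "irreducible_mat S Q \<longleftrightarrow> (\<forall>i\<in>S. \<forall>j\<in>S. \<exists>n\<ge>1. mat_power S Q n i j > 0)"

definition eigenvalue_on :: "nat set \<Rightarrow> (nat \<Rightarrow> nat \<Rightarrow> real) \<Rightarrow> complex \<Rightarrow> bool" where
  "eigenvalue_on S Q c \<longleftrightarrow>
     (\<exists>x. (\<exists>i\<in>S. x i \<noteq> 0) \<and> (\<forall>i\<in>S. (\<Sum>j\<in>S. complex_of_real (Q i j) * x j) = c * x i))"

definition maximal_eigenvalue :: "nat set \<Rightarrow> (nat \<Rightarrow> nat \<Rightarrow> real) \<Rightarrow> real \<Rightarrow> bool" where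
  "maximal_eigenvalue S Q r \<longleftrightarrow>
     eigenvalue_on S Q (complex_of_real r) \<and> (\<forall>c. eigenvalue_on S Q c \<longrightarrow> cmod c \<le> r)"

definition pos_left_eigenvector :: "nat set \<Rightarrow> (nat \<Rightarrow> nat \<Rightarrow> real) \<Rightarrow> (nat \<Rightarrow> real) \<Rightarrow> bool" where
  "pos_left_eigenvector S Q u \<longleftrightarrow>
     (\<forall>i\<in>S. u i > 0) \<and> (\<forall>j\<in>S. ((\<lambda>i. u i * Q i j) has_sum u j) S)"

definition pos_right_eigenvector :: "nat set \<Rightarrow> (nat \<Rightarrow> nat \<Rightarrow> real) \<Rightarrow> (nat \<Rightarrow> real) \<Rightarrow> bool" where
  "pos_right_eigenvector S Q v \<longleftrightarrow>
     (\<forall>i\<in>S. v i > 0) \<and> (\<forall>i\<in>S. ((\<lambda>j. Q i j * v j) has_sum v i) S)"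

definition proportional_on :: "nat set \<Rightarrow> (nat \<Rightarrow> real) \<Rightarrow> (nat \<Rightarrow> real) \<Rightarrow> bool" where
  "proportional_on S x y \<longleftrightarrow> (\<exists>c. \<forall>i\<in>S. y i = c * x i)"

text \<open>
  For infinite \<open>S\<close>, having maximal eigenvalue 1 means no more than that the positive
  eigenvectors exist and are unique up to scaling; the spectral condition is therefore imposed
  for finite \<open>S\<close> only.
\<close>

definition quasi_stochastic :: "nat set \<Rightarrow> (nat \<Rightarrow> nat \<Rightarrow> real) \<Rightarrow> bool" where
  "quasi_stochastic S Q \<longleftrightarrow>
     (\<forall>i\<in>S. \<forall>j\<in>S. Q i j \<ge> 0) \<and>
     irreducible_mat S Q \<and>
     (finite S \<longrightarrow> maximal_eigenvalue S Q 1) \<and>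
     (\<exists>u. pos_left_eigenvector S Q u) \<and>
     (\<exists>v. pos_right_eigenvector S Q v) \<and>
     (\<forall>u u'. pos_left_eigenvector S Q u \<longrightarrow> pos_left_eigenvector S Q u' \<longrightarrow> proportional_on S u u') \<and>
     (\<forall>v v'. pos_right_eigenvector S Q v \<longrightarrow> pos_right_eigenvector S Q v' \<longrightarrow> proportional_on S v v')"

text \<open>
  Distribution functions on the real line are represented by their probability measures
  \<open>F i j\<close> (locale \<^locale>\<open>real_distribution\<close>).  \<open>conv_power S Q F n i j t\<close> is the
  \<open>(i, j)\<close> entry of the \<open>n\<close>-th convolution power of \<open>Q \<otimes> F\<close> at \<open>t\<close>.
\<close>

primrec conv_power ::
  "nat set \<Rightarrow> (nat \<Rightarrow> nat \<Rightarrow> real) \<Rightarrow> (nat \<Rightarrow> nat \<Rightarrow> real measure) \<Rightarrow>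
   nat \<Rightarrow> nat \<Rightarrow> nat \<Rightarrow> real \<Rightarrow> ennreal" where
  "conv_power S Q F 0 i j t = (if i = j \<and> t \<ge> 0 then 1 else 0)"
| "conv_power S Q F (Suc n) i j t =
     (\<Sum>\<^sub>\<infinity>k\<in>S. ennreal (Q i k) * (\<integral>\<^sup>+x. conv_power S Q F n k j (t - x) \<partial>F i k))"

text \<open>
  For quasi-stochastic \<open>Q\<close> the convolution powers are bounded by the finite entries of the
  powers of \<open>Q\<close> and nondecreasing in \<open>t\<close>, so the differences below are not truncated.
\<close>

definition matrix_renewal_measure ::
  "nat set \<Rightarrow> (nat \<Rightarrow> nat \<Rightarrow> real) \<Rightarrow> (nat \<Rightarrow> nat \<Rightarrow> real measure) \<Rightarrow>
   (nat \<Rightarrow> nat \<Rightarrow> real measure) \<Rightarrow> bool" where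
  "matrix_renewal_measure S Q F V \<longleftrightarrow>
     (\<forall>i\<in>S. \<forall>j\<in>S. sets (V i j) = sets borel \<and>
        (\<forall>t. \<forall>h>0. emeasure (V i j) {t<..t+h} =
           (\<Sum>n. conv_power S Q F n i j (t + h) - conv_power S Q F n i j t)))"

definition drift_pos ::
  "nat set \<Rightarrow> (nat \<Rightarrow> nat \<Rightarrow> real) \<Rightarrow> (nat \<Rightarrow> nat \<Rightarrow> real measure) \<Rightarrow>
   (nat \<Rightarrow> real) \<Rightarrow> (nat \<Rightarrow> real) \<Rightarrow> ennreal" where
  "drift_pos S Q F u v =
     (\<Sum>\<^sub>\<infinity>(i, j)\<in>S \<times> S. ennreal (u i * Q i j * v j) * (\<integral>\<^sup>+x. ennreal (max x 0) \<partial>F i j))"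

definition drift_neg ::
  "nat set \<Rightarrow> (nat \<Rightarrow> nat \<Rightarrow> real) \<Rightarrow> (nat \<Rightarrow> nat \<Rightarrow> real measure) \<Rightarrow>
   (nat \<Rightarrow> real) \<Rightarrow> (nat \<Rightarrow> real) \<Rightarrow> ennreal" where
  "drift_neg S Q F u v =
     (\<Sum>\<^sub>\<infinity>(i, j)\<in>S \<times> S. ennreal (u i * Q i j * v j) * (\<integral>\<^sup>+x. ennreal (max (- x) 0) \<partial>F i j))"

definition drift_well_defined ::
  "nat set \<Rightarrow> (nat \<Rightarrow> nat \<Rightarrow> real) \<Rightarrow> (nat \<Rightarrow> nat \<Rightarrow> real measure) \<Rightarrow>
   (nat \<Rightarrow> real) \<Rightarrow> (nat \<Rightarrow> real) \<Rightarrow> bool" where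
  "drift_well_defined S Q F u v \<longleftrightarrow> drift_pos S Q F u v < \<infinity> \<or> drift_neg S Q F u v < \<infinity>"

text \<open>
  Meaningful only under \<^const>\<open>drift_well_defined\<close>, since \<open>\<infinity> - \<infinity> = \<infinity>\<close> in \<^typ>\<open>ereal\<close>.
\<close>

definition drift ::
  "nat set \<Rightarrow> (nat \<Rightarrow> nat \<Rightarrow> real) \<Rightarrow> (nat \<Rightarrow> nat \<Rightarrow> real measure) \<Rightarrow>
   (nat \<Rightarrow> real) \<Rightarrow> (nat \<Rightarrow> real) \<Rightarrow> ereal" where
  "drift S Q F u v = enn2ereal (drift_pos S Q F u v) - enn2ereal (drift_neg S Q F u v)"

definition lattice_span ::
  "nat set \<Rightarrow> (nat \<Rightarrow> nat \<Rightarrow> real) \<Rightarrow> (nat \<Rightarrow> nat \<Rightarrow> real measure) \<Rightarrow>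
   (nat \<Rightarrow> real) \<Rightarrow> (nat \<Rightarrow> real) \<Rightarrow> real \<Rightarrow> bool" where
  "lattice_span S Q F u v d \<longleftrightarrow> d > 0 \<and>
     (\<exists>\<gamma>. (\<forall>i\<in>S. 0 \<le> \<gamma> i \<and> \<gamma> i < d) \<and>
       (\<forall>i\<in>S. \<forall>j\<in>S. u i * Q i j * v j > 0 \<longrightarrow>
          measure (F i j) (range (\<lambda>k::int. \<gamma> j - \<gamma> i + d * of_int k)) = 1))"

definition arithmetic ::
  "nat set \<Rightarrow> (nat \<Rightarrow> nat \<Rightarrow> real) \<Rightarrow> (nat \<Rightarrow> nat \<Rightarrow> real measure) \<Rightarrow>
   (nat \<Rightarrow> real) \<Rightarrow> (nat \<Rightarrow> real) \<Rightarrow> real \<Rightarrow> bool" where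
  "arithmetic S Q F u v d \<longleftrightarrow>
     lattice_span S Q F u v d \<and> (\<forall>d'. lattice_span S Q F u v d' \<longrightarrow> d' \<le> d)"

definition nonarithmetic ::
  "nat set \<Rightarrow> (nat \<Rightarrow> nat \<Rightarrow> real) \<Rightarrow> (nat \<Rightarrow> nat \<Rightarrow> real measure) \<Rightarrow>
   (nat \<Rightarrow> real) \<Rightarrow> (nat \<Rightarrow> real) \<Rightarrow> bool" where
  "nonarithmetic S Q F u v \<longleftrightarrow> (\<nexists>d. arithmetic S Q F u v d)"

end

theory Submission
  imports Defs
begin

text \<open>
  Fix a state \<open>s\<close>.  Recurrence makes the additive process return to \<open>s\<close> almost surely (after the
  transform by the right eigenvector), and its positions at the successive returns form an ordinary
  random walk.  Hence \<open>V\<^sub>s\<^sub>s\<close> is the renewal measure of that walk, and \<open>V\<^sub>i\<^sub>s\<close> is its convolution with the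
  law of the position at the first entrance into \<open>s\<close> from \<open>i\<close>, a measure of mass \<open>v\<^sub>i / v\<^sub>s\<close>.  The
  occupation measure of an excursion from \<open>s\<close> is \<open>u / u\<^sub>s\<close>, which by Wald's identity gives the return
  walk the mean \<open>\<mu> / (u\<^sub>s v\<^sub>s)\<close>, and it is nonlattice because a lattice for the return walk spreads to a
  lattice with shifts \<open>\<gamma>\<close> for the whole kernel.

  It remains to prove Blackwell's theorem for two-sided walks with \<open>E X\<^sup>- < \<infinity>\<close> and mean in
  \<open>(0, \<infinity>]\<close>.  A bounded superharmonic function tending to 0 at \<open>+\<infinity>\<close> shows that the renewal measure of
  an interval is bounded uniformly in its position and vanishes far on the side away from the drift.
  For a Lipschitz function \<open>g\<close> of compact support let \<open>Z\<close> be its potential, so that \<open>Z = g + P Z\<close>.  A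
  variance argument in the style of Choquet and Deny shows that \<open>Z (x + c) - Z x\<close> tends to 0 on the
  drift side for every \<open>c\<close>, and the integrated renewal equation then identifies the limit of \<open>Z\<close>.
\<close>

section \<open>The transition operator of a random walk\<close>

text \<open>No process is constructed. Paths are replaced by iterates of the positive operators
  \<open>step\<close> and \<open>mstep\<close>, and statements about entrance times by series in
  \<open>ennreal\<close>; minimality of such a series among supersolutions does the work of
  stopping-time arguments. Nor is the matrix made stochastic: the first entrance law keeps the mass
  \<open>v i / v s\<close>, which is 1 for \<open>i = s\<close>, so that the return law is a
  probability without any transform. Two obstacles shape the rest. The sum of the u_i v_i and the
  drift may be infinite, so there is no stationary law to start from and no free subtraction;
  identities are therefore kept additive between nonnegative quantities as long as possible. And the
  nonarithmetic hypothesis only denies a largest span, so lattices of unbounded or unattained span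
  must be excluded as well. Orientation: potentials are functions of the starting position x, with
  the window (0, h] fixed. The mass that V gives to (t, t + h] is the potential at -t, so the drift
  side is \<open>at_bot\<close> until the final substitution t = -x.\<close>

definition bounded_borel :: "(real \<Rightarrow> real) \<Rightarrow> bool" where
  "bounded_borel f \<longleftrightarrow> f \<in> borel_measurable borel \<and> (\<exists>B. \<forall>x. \<bar>f x\<bar> \<le> B)"

lemma bounded_borelI:
  assumes "f \<in> borel_measurable borel" "\<And>x. \<bar>f x\<bar> \<le> B"
  shows "bounded_borel f"
  using assms unfolding bounded_borel_def by blast

lemma bounded_borelE:
  assumes "bounded_borel f"
  obtains B where "B \<ge> 0" "\<And>x. \<bar>f x\<bar> \<le> B"
  using assms unfolding bounded_borel_def by (metis abs_ge_zero order_trans)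

lemma bounded_borel_measurable [measurable_dest]: "bounded_borel f \<Longrightarrow> f \<in> borel_measurable borel"
  by (simp add: bounded_borel_def)

lemma bounded_borel_const [simp]: "bounded_borel (\<lambda>x. c)"
  by (rule bounded_borelI[where B="\<bar>c\<bar>"]) auto

lemma bounded_borel_add:
  assumes "bounded_borel f" "bounded_borel g"
  shows "bounded_borel (\<lambda>x. f x + g x)"
proof -
  obtain A B where "\<And>x. \<bar>f x\<bar> \<le> A" "\<And>x. \<bar>g x\<bar> \<le> B"
    using assms by (metis bounded_borelE)
  then show ?thesis
    using assms by (intro bounded_borelI[where B="A + B"]) (auto simp: bounded_borel_def intro: abs_triangle_ineq[THEN order_trans] add_mono)
qed

lemma bounded_borel_mult:
  assumes "bounded_borel f" "bounded_borel g"
  shows "bounded_borel (\<lambda>x. f x * g x)"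
proof -
  obtain A B where "A \<ge> 0" "\<And>x. \<bar>f x\<bar> \<le> A" "\<And>x. \<bar>g x\<bar> \<le> B"
    using assms by (metis bounded_borelE)
  then show ?thesis
    using assms by (intro bounded_borelI[where B="A * B"]) (auto simp: bounded_borel_def abs_mult intro: mult_mono)
qed

lemma bounded_borel_cmult: "bounded_borel f \<Longrightarrow> bounded_borel (\<lambda>x. c * f x)"
  by (intro bounded_borel_mult bounded_borel_const)

lemma bounded_borel_diff:
  assumes "bounded_borel f" "bounded_borel g"
  shows "bounded_borel (\<lambda>x. f x - g x)"
  using bounded_borel_add[OF assms(1) bounded_borel_cmult[OF assms(2), of "-1"]] by simp

lemma bounded_borel_sum:
  "(\<And>i. i \<in> I \<Longrightarrow> bounded_borel (f i)) \<Longrightarrow> bounded_borel (\<lambda>x. \<Sum>i\<in>I. f i x)"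
  by (induction I rule: infinite_finite_induct) (auto intro: bounded_borel_add)

lemma bounded_borel_power: "bounded_borel f \<Longrightarrow> bounded_borel (\<lambda>x. f x ^ n)"
  by (induction n) (auto intro: bounded_borel_mult)

lemma bounded_borel_shift:
  assumes "bounded_borel f" shows "bounded_borel (\<lambda>x. f (x + a))"
  using assms unfolding bounded_borel_def by auto

lemma bounded_borel_indicator: "A \<in> sets borel \<Longrightarrow> bounded_borel (indicator A)"
  by (rule bounded_borelI[where B=1]) (auto simp: indicator_def)

lemma filterlim_at_bot_add_const:
  fixes X :: "'a \<Rightarrow> real"
  assumes "filterlim X at_bot F" shows "filterlim (\<lambda>n. X n + c) at_bot F"
  unfolding filterlim_at_bot
proof
  fix Z
  have "eventually (\<lambda>n. X n \<le> Z - c) F" using assms by (simp add: filterlim_at_bot)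
  then show "eventually (\<lambda>n. X n + c \<le> Z) F" by eventually_elim simp
qed

lemma tendsto_shift_at_bot:
  fixes f :: "real \<Rightarrow> 'b :: topological_space"
  assumes "(f \<longlongrightarrow> l) at_bot" shows "((\<lambda>x. f (x + c)) \<longlongrightarrow> l) at_bot"
  using filterlim_compose[OF assms filterlim_at_bot_add_const[OF filterlim_ident]] .

lemma tendsto_shift_at_top:
  fixes f :: "real \<Rightarrow> 'b :: topological_space"
  assumes "(f \<longlongrightarrow> l) at_top" shows "((\<lambda>x. f (x + c)) \<longlongrightarrow> l) at_top"
  using filterlim_compose[OF assms filterlim_tendsto_add_at_top[OF tendsto_const[of c] filterlim_ident]]
  by (simp add: add.commute)

locale random_walk = real_distribution M for M :: "real measure"
begin

lemma prob_UNIV [simp]: "prob UNIV = 1"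
  using prob_space by simp

definition P :: "(real \<Rightarrow> real) \<Rightarrow> real \<Rightarrow> real" where
  "P f x = (\<integral>y. f (x + y) \<partial>M)"

lemma integrable_shift:
  assumes "bounded_borel f" shows "integrable M (\<lambda>y. f (x + y))"
proof -
  obtain B where "\<And>x. \<bar>f x\<bar> \<le> B" using assms by (metis bounded_borelE)
  moreover have "f \<in> borel_measurable borel" using assms by (simp add: bounded_borel_def)
  ultimately show ?thesis
    by (intro integrable_const_bound[where B=B]) auto
qed

lemma integrable_bounded_borel: "bounded_borel f \<Longrightarrow> integrable M f"
  using integrable_shift[of f 0] by simp

lemma P_bound:
  assumes "bounded_borel f" "\<And>x. \<bar>f x\<bar> \<le> B" shows "\<bar>P f x\<bar> \<le> B"
proof -
  have "\<bar>P f x\<bar> \<le> (\<integral>y. \<bar>f (x + y)\<bar> \<partial>M)"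
    unfolding P_def by (rule integral_abs_bound)
  also have "\<dots> \<le> (\<integral>y. B \<partial>M)"
    using assms by (intro integral_mono integrable_abs integrable_shift) auto
  finally show ?thesis by (simp add: prob_space)
qed

lemma bounded_borel_P:
  assumes "bounded_borel f" shows "bounded_borel (P f)"
proof -
  obtain B where B: "\<And>x. \<bar>f x\<bar> \<le> B" using assms by (metis bounded_borelE)
  have [measurable]: "f \<in> borel_measurable borel" using assms by (simp add: bounded_borel_def)
  have "P f \<in> borel_measurable borel"
    unfolding P_def by (rule borel_measurable_lebesgue_integral) measurable
  from bounded_borelI[OF this P_bound[OF assms B]] show ?thesis .
qed

lemma bounded_borel_P_pow: "bounded_borel f \<Longrightarrow> bounded_borel ((P ^^ n) f)"
  by (induction n) (auto intro: bounded_borel_P)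

lemma P_add: "bounded_borel f \<Longrightarrow> bounded_borel g \<Longrightarrow> P (\<lambda>x. f x + g x) x = P f x + P g x"
  unfolding P_def by (intro Bochner_Integration.integral_add integrable_shift)

lemma P_diff: "bounded_borel f \<Longrightarrow> bounded_borel g \<Longrightarrow> P (\<lambda>x. f x - g x) x = P f x - P g x"
  unfolding P_def by (intro Bochner_Integration.integral_diff integrable_shift)

lemma P_cmult: "P (\<lambda>x. c * f x) x = c * P f x"
  unfolding P_def by simp

lemma P_const [simp]: "P (\<lambda>x. c) x = c"
  unfolding P_def by (simp add: prob_space)

lemma P_sum:
  "(\<And>i. i \<in> I \<Longrightarrow> bounded_borel (f i)) \<Longrightarrow> P (\<lambda>x. \<Sum>i\<in>I. f i x) x = (\<Sum>i\<in>I. P (f i) x)"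
  unfolding P_def by (intro Bochner_Integration.integral_sum integrable_shift)

lemma P_mono:
  "bounded_borel f \<Longrightarrow> bounded_borel g \<Longrightarrow> (\<And>x. f x \<le> g x) \<Longrightarrow> P f x \<le> P g x"
  unfolding P_def by (intro integral_mono integrable_shift)

lemma P_shift: "P (\<lambda>x. f (x + a)) x = P f (x + a)"
  unfolding P_def by (simp add: ac_simps)

lemma P_pow_add:
  "bounded_borel f \<Longrightarrow> bounded_borel g \<Longrightarrow> (P ^^ n) (\<lambda>x. f x + g x) = (\<lambda>x. (P ^^ n) f x + (P ^^ n) g x)"
  by (induction n) (auto intro!: ext simp: P_add bounded_borel_P_pow)

lemma P_pow_diff:
  "bounded_borel f \<Longrightarrow> bounded_borel g \<Longrightarrow> (P ^^ n) (\<lambda>x. f x - g x) = (\<lambda>x. (P ^^ n) f x - (P ^^ n) g x)"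
  by (induction n) (auto intro!: ext simp: P_diff bounded_borel_P_pow)

lemma P_pow_cmult: "(P ^^ n) (\<lambda>x. c * f x) = (\<lambda>x. c * (P ^^ n) f x)"
  by (induction n) (auto intro!: ext simp: P_cmult)

lemma P_pow_mono:
  "bounded_borel f \<Longrightarrow> bounded_borel g \<Longrightarrow> (\<And>x. f x \<le> g x) \<Longrightarrow> (P ^^ n) f x \<le> (P ^^ n) g x"
  by (induction n arbitrary: x) (auto intro: P_mono bounded_borel_P_pow)

lemma P_pow_const [simp]: "(P ^^ n) (\<lambda>x. c) = (\<lambda>x. c)"
  by (induction n) (auto intro!: ext)

lemma P_pow_nonneg: "bounded_borel f \<Longrightarrow> (\<And>x. 0 \<le> f x) \<Longrightarrow> 0 \<le> (P ^^ n) f x"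
  using P_pow_mono[of "\<lambda>_. 0" f n x] by simp

lemma P_pow_shift: "(P ^^ n) (\<lambda>x. f (x + a)) = (\<lambda>x. (P ^^ n) f (x + a))"
  by (induction n) (auto intro!: ext simp: P_shift)

lemma P_tendsto_at_bot:
  assumes f: "bounded_borel f" and lim: "(f \<longlongrightarrow> 0) at_bot"
  shows "(P f \<longlongrightarrow> 0) at_bot"
proof (rule tendsto_at_botI_sequentially)
  fix X :: "nat \<Rightarrow> real" assume X: "filterlim X at_bot sequentially"
  obtain B where B: "\<And>x. \<bar>f x\<bar> \<le> B" using f by (metis bounded_borelE)
  have [measurable]: "f \<in> borel_measurable borel" using f by (simp add: bounded_borel_def)
  have "(\<lambda>n. \<integral>y. f (X n + y) \<partial>M) \<longlonglongrightarrow> (\<integral>y. 0 \<partial>M)"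
  proof (rule integral_dominated_convergence[where w="\<lambda>_. B"])
    show "AE y in M. (\<lambda>n. f (X n + y)) \<longlonglongrightarrow> 0"
    proof (rule AE_I2)
      fix y
      have "filterlim (\<lambda>n. X n + y) at_bot sequentially"
        using X by (rule filterlim_at_bot_add_const)
      then show "(\<lambda>n. f (X n + y)) \<longlonglongrightarrow> 0"
        using filterlim_compose[OF lim] by blast
    qed
  qed (use B in auto)
  then show "(\<lambda>n. P f (X n)) \<longlonglongrightarrow> 0" by (simp add: P_def)
qed

lemma P_pow_tendsto_at_bot:
  assumes "bounded_borel f" "(f \<longlongrightarrow> 0) at_bot"
  shows "((P ^^ n) f \<longlongrightarrow> 0) at_bot"
  using assms by (induction n) (auto intro: P_tendsto_at_bot bounded_borel_P_pow)

end

section \<open>A Lyapunov function for positive drift\<close>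

text \<open>Given that the negative part is integrable, the truncation condition says by monotone
  convergence that the mean lies in (0, infinity]. In this form finite and infinite mean need no
  separate treatment, and the truncated drift is what the Lyapunov estimate uses.\<close>

locale positive_drift_walk = random_walk M for M :: "real measure" +
  assumes neg_integrable: "integrable M (\<lambda>y. max (- y) 0)"
    and ex_trunc: "\<exists>K>0. (\<integral>y. min y K \<partial>M) > 0"
begin

text \<open>
  The Lyapunov function: with \<open>Y = 1 + X\<^sup>-\<close> put \<open>w0 x = E (Y\<^sup>2 / (Y + x))\<close>, which needs only
  \<open>E X\<^sup>- < \<infinity>\<close>, and \<open>h0 = - w0'\<close>.  The point of the choice is that \<open>h0\<close> varies slowly while still
  dominating the left tail \<open>P (X < - x / 2)\<close>, so that a step decreases \<open>w0\<close> by about the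
  (truncated) mean times \<open>h0\<close>.  Freezing \<open>w0\<close> to the left of a large \<open>x0\<close> yields a bounded
  superharmonic function.
\<close>

definition Y :: "real \<Rightarrow> real" where "Y y = 1 + max (- y) 0"

definition w0 :: "real \<Rightarrow> real" where "w0 x = (\<integral>y. (Y y)\<^sup>2 / (Y y + x) \<partial>M)"

definition h0 :: "real \<Rightarrow> real" where "h0 x = (\<integral>y. (Y y)\<^sup>2 / (Y y + x)\<^sup>2 \<partial>M)"

lemma Y_ge_1: "1 \<le> Y y"
  by (simp add: Y_def)

lemma Y_measurable [measurable]: "Y \<in> borel_measurable borel"
  unfolding Y_def by measurable

lemma integrable_Y: "integrable M Y"
  unfolding Y_def using neg_integrable by simp

lemma integrable_w0:
  assumes "x \<ge> 0" shows "integrable M (\<lambda>y. (Y y)\<^sup>2 / (Y y + x))"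
proof (rule Bochner_Integration.integrable_bound[OF integrable_Y])
  show "AE y in M. norm ((Y y)\<^sup>2 / (Y y + x)) \<le> norm (Y y)"
  proof (rule AE_I2)
    fix y
    have "(Y y)\<^sup>2 \<le> Y y * (Y y + x)"
      using Y_ge_1[of y] assms by (simp add: power2_eq_square distrib_left)
    then show "norm ((Y y)\<^sup>2 / (Y y + x)) \<le> norm (Y y)"
      using Y_ge_1[of y] assms by (simp add: divide_le_eq)
  qed
qed simp

lemma Y_quotient_le_1:
  assumes "x \<ge> 0" shows "(Y y)\<^sup>2 / (Y y + x)\<^sup>2 \<le> 1"
proof -
  have "(Y y)\<^sup>2 \<le> (Y y + x)\<^sup>2" using Y_ge_1[of y] assms by (intro power_mono) auto
  then show ?thesis by (simp add: divide_le_eq)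
qed

lemma integrable_h0:
  assumes "x \<ge> 0" shows "integrable M (\<lambda>y. (Y y)\<^sup>2 / (Y y + x)\<^sup>2)"
  using Y_quotient_le_1[OF assms] by (intro integrable_const_bound[where B=1]) auto

lemma w0_antimono:
  assumes "0 \<le> x" "x \<le> x'" shows "w0 x' \<le> w0 x"
  unfolding w0_def
proof (rule integral_mono)
  fix y
  show "(Y y)\<^sup>2 / (Y y + x') \<le> (Y y)\<^sup>2 / (Y y + x)"
    using Y_ge_1[of y] assms by (intro divide_left_mono) auto
qed (use assms integrable_w0 in auto)

lemma h0_antimono:
  assumes "0 \<le> x" "x \<le> x'" shows "h0 x' \<le> h0 x"
  unfolding h0_def
proof (rule integral_mono)
  fix y
  show "(Y y)\<^sup>2 / (Y y + x')\<^sup>2 \<le> (Y y)\<^sup>2 / (Y y + x)\<^sup>2"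
    using Y_ge_1[of y] assms by (intro divide_left_mono power_mono) auto
qed (use assms integrable_h0 in auto)

lemma h0_pos:
  assumes "0 \<le> x" shows "0 < h0 x"
proof -
  have "(\<integral>y. (1 / (1 + x))\<^sup>2 \<partial>M) \<le> h0 x"
    unfolding h0_def
  proof (rule integral_mono)
    fix y
    have "1 / (1 + x) \<le> Y y / (Y y + x)"
      using Y_ge_1[of y] assms by (simp add: field_simps mult_left_mono[of 1 "Y y" x, simplified])
    then have "(1 / (1 + x))\<^sup>2 \<le> (Y y / (Y y + x))\<^sup>2"
      using assms by (intro power_mono) auto
    then show "(1 / (1 + x))\<^sup>2 \<le> (Y y)\<^sup>2 / (Y y + x)\<^sup>2" by (simp add: power_divide)
  qed (use assms integrable_h0 in auto)
  then have le: "(1 / (1 + x))\<^sup>2 \<le> h0 x" by simp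
  have "0 < (1 / (1 + x))\<^sup>2" using assms by simp
  from this le show ?thesis by (rule less_le_trans)
qed

lemma w0_pos:
  assumes "0 \<le> x" shows "0 < w0 x"
proof -
  have "h0 x \<le> w0 x"
    unfolding h0_def w0_def
  proof (rule integral_mono)
    fix y
    show "(Y y)\<^sup>2 / (Y y + x)\<^sup>2 \<le> (Y y)\<^sup>2 / (Y y + x)"
      using Y_ge_1[of y] assms by (intro divide_left_mono self_le_power) auto
  qed (use assms integrable_h0 integrable_w0 in auto)
  with h0_pos[OF assms] show ?thesis by simp
qed

lemma w0_tendsto: "(w0 \<longlongrightarrow> 0) at_top"
proof -
  have "((\<lambda>x. \<integral>y. (Y y)\<^sup>2 / (Y y + x) \<partial>M) \<longlongrightarrow> (\<integral>y. 0 \<partial>M)) at_top"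
  proof (rule integral_dominated_convergence_at_top[where w=Y])
    show "AE y in M. ((\<lambda>x. (Y y)\<^sup>2 / (Y y + x)) \<longlongrightarrow> 0) at_top"
      by (rule AE_I2, rule real_tendsto_divide_at_top[OF tendsto_const], rule filterlim_tendsto_add_at_top[OF tendsto_const filterlim_ident])
    show "\<forall>\<^sub>F x in at_top. AE y in M. norm ((Y y)\<^sup>2 / (Y y + x)) \<le> Y y"
      using eventually_ge_at_top[of 0]
    proof eventually_elim
      case (elim x)
      show ?case
      proof (rule AE_I2)
        fix y
        have "(Y y)\<^sup>2 \<le> Y y * (Y y + x)"
          using Y_ge_1[of y] elim by (simp add: power2_eq_square distrib_left)
        then show "norm ((Y y)\<^sup>2 / (Y y + x)) \<le> Y y"
          using Y_ge_1[of y] elim by (simp add: divide_le_eq)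
      qed
    qed
  qed (auto intro: integrable_Y)
  then show ?thesis unfolding w0_def by simp
qed

text \<open>On the event y < -x/2 one has x < 2 Y, hence Y + x <= 3 Y, and the integrand of
  \<open>h0\<close> is at least 1/9.\<close>

lemma left_tail_le_h0:
  assumes "0 < x" shows "prob {y. y < - x / 2} \<le> 9 * h0 x"
proof -
  have int: "integrable M (\<lambda>y. 9 * ((Y y)\<^sup>2 / (Y y + x)\<^sup>2))"
    using assms by (intro integrable_mult_right integrable_h0) simp
  have "prob {y. y < - x / 2} = (\<integral>y. indicator {y. y < - x / 2} y \<partial>M)" by simp
  also have "\<dots> \<le> (\<integral>y. 9 * ((Y y)\<^sup>2 / (Y y + x)\<^sup>2) \<partial>M)"
  proof (rule integral_mono)
    fix y
    show "indicator {y. y < - x / 2} y \<le> 9 * ((Y y)\<^sup>2 / (Y y + x)\<^sup>2)"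
    proof (cases "y < - x / 2")
      case True
      then have "Y y + x \<le> 3 * Y y" using assms by (simp add: Y_def)
      then have "(Y y + x)\<^sup>2 \<le> (3 * Y y)\<^sup>2"
        using Y_ge_1[of y] assms by (intro power_mono) auto
      then show ?thesis using True Y_ge_1[of y] assms by (simp add: power_mult_distrib le_divide_eq)
    qed auto
  qed (rule integrable_real_indicator, simp_all only: int, simp_all add: less_top[symmetric])
  also have "\<dots> = 9 * h0 x" by (simp only: h0_def integral_mult_right_zero)
  finally show ?thesis .
qed

text \<open>The exact difference is - z Y^2 / ((Y + x) (Y + x + z)). Replacing the ratio (Y + x) /
  (Y + x + z) by x / (x + z) errs in the direction that the sign of z requires, and frees the factor
  from Y so that it can leave the integral.\<close>

lemma Y_quotient_diff_le:
  assumes "0 < x" "0 < x + z"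
  shows "(Y y)\<^sup>2 / (Y y + (x + z)) - (Y y)\<^sup>2 / (Y y + x) \<le> - (z * (x / (x + z))) * ((Y y)\<^sup>2 / (Y y + x)\<^sup>2)"
proof -
  have pos: "0 < Y y + x" "0 < Y y + (x + z)" "0 < Y y"
    using Y_ge_1[of y] assms by linarith+
  have "- (z * (x / (x + z))) * ((Y y)\<^sup>2 / (Y y + x)\<^sup>2) - ((Y y)\<^sup>2 / (Y y + (x + z)) - (Y y)\<^sup>2 / (Y y + x))
     = (Y y)\<^sup>2 * (z\<^sup>2 * Y y) / ((x + z) * (Y y + x)\<^sup>2 * (Y y + (x + z)))"
    using pos assms by (simp add: divide_simps power2_eq_square) algebra
  also have "\<dots> \<ge> 0" using pos assms by simp
  finally show ?thesis by simp
qed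

lemma w0_diff_le:
  assumes "0 < x" "0 < x + z"
  shows "w0 (x + z) - w0 x \<le> - (z * (x / (x + z))) * h0 x"
proof -
  have "w0 (x + z) - w0 x = (\<integral>y. (Y y)\<^sup>2 / (Y y + (x + z)) - (Y y)\<^sup>2 / (Y y + x) \<partial>M)"
    unfolding w0_def using assms by (intro Bochner_Integration.integral_diff[symmetric] integrable_w0) auto
  also have "\<dots> \<le> (\<integral>y. - (z * (x / (x + z))) * ((Y y)\<^sup>2 / (Y y + x)\<^sup>2) \<partial>M)"
    using assms Y_quotient_diff_le by (intro integral_mono Bochner_Integration.integrable_diff integrable_w0 integrable_mult_right integrable_h0) auto
  also have "\<dots> = - (z * (x / (x + z))) * h0 x" by (simp only: h0_def integral_mult_right_zero)
  finally show ?thesis .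
qed

lemma integrable_min: "0 \<le> K \<Longrightarrow> integrable M (\<lambda>y. min y K)"
proof (rule Bochner_Integration.integrable_bound[where f="\<lambda>y. K + max (- y) 0"])
  assume "0 \<le> K"
  show "integrable M (\<lambda>y. K + max (- y) 0)" using neg_integrable by simp
qed (auto simp: min_def max_def)

lemma lyapunov:
  obtains w x0 where "bounded_borel w" "\<And>x. 0 \<le> w x" "0 < w x0" "antimono w"
    "\<And>x. x \<le> x0 \<Longrightarrow> w x = w x0" "(w \<longlongrightarrow> 0) at_top" "\<And>x. P w x \<le> w x"
    "\<And>r. \<exists>c>0. \<forall>x\<in>{x0..x0 + r}. c \<le> w x - P w x"
proof -
  obtain K where K: "0 < K" "0 < (\<integral>y. min y K \<partial>M)" using ex_trunc by auto
  define m where "m = (\<integral>y. min y K \<partial>M)"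
  \<comment> \<open>For steps z >= -x/2 this is the factor of \<open>w0_diff_le\<close> at the step
    cut off at K. The maximum with x/2 changes it only for longer left jumps and gives the
    integrable majorant 2 |min z K|, so that its mean tends to m.\<close>
  define \<psi> where "\<psi> x z = min z K * (x / max (x / 2) (x + min z K))" for x z :: real
  have \<psi>_bound: "\<bar>\<psi> x z\<bar> \<le> 2 * \<bar>min z K\<bar>" if "0 < x" for x z
  proof -
    have "0 \<le> x / max (x / 2) (x + min z K)" using that by (auto simp: max_def)
    moreover have "x / max (x / 2) (x + min z K) \<le> 2" using that by (simp add: divide_le_eq max_def)
    ultimately have "\<bar>x / max (x / 2) (x + min z K)\<bar> \<le> 2" by (simp only: abs_of_nonneg)
    from mult_left_mono[OF this, of "\<bar>min z K\<bar>"] show ?thesis by (simp only: \<psi>_def abs_mult) simp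
  qed
  have \<psi>_int: "integrable M (\<psi> x)" if "0 < x" for x
  proof (rule Bochner_Integration.integrable_bound)
    show "integrable M (\<lambda>z. 2 * \<bar>min z K\<bar>)"
      using integrable_min[of K] K by auto
    show "\<psi> x \<in> borel_measurable M" unfolding \<psi>_def by measurable
  qed (use that \<psi>_bound in auto)
  have "((\<lambda>x. \<integral>z. \<psi> x z \<partial>M) \<longlongrightarrow> (\<integral>z. min z K \<partial>M)) at_top"
  proof (rule integral_dominated_convergence_at_top[where w="\<lambda>z. 2 * \<bar>min z K\<bar>"])
    show "\<forall>\<^sub>F x in at_top. AE z in M. norm (\<psi> x z) \<le> 2 * \<bar>min z K\<bar>"
      using eventually_gt_at_top[of 0] by eventually_elim (use \<psi>_bound in auto)
    show "AE z in M. ((\<lambda>x. \<psi> x z) \<longlongrightarrow> min z K) at_top"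
    proof (rule AE_I2)
      fix z
      have "((\<lambda>x. min z K * (1 - min z K / (min z K + x))) \<longlongrightarrow> min z K * (1 - 0)) at_top"
        by (intro tendsto_intros real_tendsto_divide_at_top[OF tendsto_const]
            filterlim_tendsto_add_at_top[OF tendsto_const filterlim_ident])
      then have "((\<lambda>x. min z K * (1 - min z K / (min z K + x))) \<longlongrightarrow> min z K) at_top" by simp
      moreover have "\<forall>\<^sub>F x in at_top. min z K * (1 - min z K / (min z K + x)) = \<psi> x z"
        using eventually_gt_at_top[of "2 * \<bar>min z K\<bar>"]
      proof eventually_elim
        case (elim x)
        then have "max (x / 2) (x + min z K) = x + min z K" "min z K + x \<noteq> 0" by linarith+
        then show ?case by (simp add: \<psi>_def field_simps)
      qed
      ultimately show "((\<lambda>x. \<psi> x z) \<longlongrightarrow> min z K) at_top"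
        by (rule Lim_transform_eventually)
    qed
    show "integrable M (\<lambda>z. 2 * \<bar>min z K\<bar>)"
      using integrable_min[of K] K by auto
    show "\<psi> t \<in> borel_measurable M" for t unfolding \<psi>_def by measurable
  qed measurable
  then have "\<forall>\<^sub>F x in at_top. m / 2 < (\<integral>z. \<psi> x z \<partial>M)"
    by (rule order_tendstoD) (use K in \<open>simp add: m_def\<close>)
  \<comment> \<open>With this bound long left jumps cost at most (m/36) * 9 * h0 x = (m/4) * h0 x,
    half of the gain (m/2) * h0 x.\<close>
  moreover have "\<forall>\<^sub>F x in at_top. w0 x < m / 36"
    using w0_tendsto by (rule order_tendstoD) (use K in \<open>simp add: m_def\<close>)
  ultimately have "\<forall>\<^sub>F x in at_top. m / 2 < (\<integral>z. \<psi> x z \<partial>M) \<and> w0 x < m / 36"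
    by eventually_elim simp
  then obtain x1 where x1: "\<And>x. x \<ge> x1 \<Longrightarrow> m / 2 < (\<integral>z. \<psi> x z \<partial>M) \<and> w0 x < m / 36"
    by (auto simp: eventually_at_top_linorder)
  define x0 where "x0 = max x1 1"
  have x0: "x0 > 0" and x0m: "w0 x0 < m / 36" and x0\<psi>: "\<And>x. x \<ge> x0 \<Longrightarrow> m / 2 < (\<integral>z. \<psi> x z \<partial>M)"
    using x1 by (auto simp: x0_def)
  define w where "w x = w0 (max x x0)" for x
  have w_nonneg: "0 \<le> w x" for x using w0_pos[of "max x x0"] x0 by (simp add: w_def le_max_iff_disj)
  have w_le: "w x \<le> w0 x0" for x using x0 by (auto simp: w_def intro: w0_antimono)
  have anti: "antimono w" using x0 by (auto simp: antimono_def w_def intro!: w0_antimono)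
  have "w \<in> borel_measurable borel"
    using borel_measurable_mono[of "\<lambda>x. - w x"] anti
    by (auto simp: antimono_def mono_def)
  with w_nonneg w_le have bw: "bounded_borel w"
    by (intro bounded_borelI[where B="w0 x0"]) auto
  have step: "h0 x * (m / 4) \<le> w x - P w x" if x: "x \<ge> x0" for x
  proof -
    have xpos: "x > 0" using x x0 by simp
    \<comment> \<open>A left jump longer than x/2 is charged the full height \<open>w0 x0\<close> of
      w. Any other jump may be shortened to min z K, because w decreases.\<close>
    have pw: "w (x + z) \<le> w x + (- h0 x * \<psi> x z + w0 x0 * indicator {y. y < - x / 2} z)" for z
    proof (cases "z < - x / 2")
      case True
      have "z \<le> 0" using True xpos by simp
      then have "\<psi> x z \<le> 0" using xpos K unfolding \<psi>_def
        by (intro mult_nonpos_nonneg divide_nonneg_nonneg) (auto simp: min_def max_def)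
      then have "0 \<le> - h0 x * \<psi> x z" using h0_pos[of x] xpos by (simp add: mult_nonneg_nonpos)
      then show ?thesis using True w_le[of "x + z"] w_nonneg[of x] by simp
    next
      case False
      define z' where "z' = min z K"
      have z': "z' \<ge> - x / 2" "z' \<le> z" using False K xpos by (auto simp: z'_def)
      have "w (x + z) \<le> w0 (x + z')" unfolding w_def using z' xpos by (intro w0_antimono) auto
      also have "\<dots> \<le> w0 x - z' * (x / (x + z')) * h0 x"
        using w0_diff_le[of x z'] z' xpos by simp
      also have "w0 x = w x" using x by (simp add: w_def max_def)
      also have "z' * (x / (x + z')) = \<psi> x z"
      proof -
        have "max (x / 2) (x + z') = x + z'" using z' by simp
        then show ?thesis by (simp add: \<psi>_def z'_def)
      qed
      finally show ?thesis using False by (simp add: mult.commute)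
    qed
    have "P w x \<le> (\<integral>z. w x + (- h0 x * \<psi> x z + w0 x0 * indicator {y. y < - x / 2} z) \<partial>M)"
      unfolding P_def using pw bw xpos \<psi>_int[of x]
      by (intro integral_mono integrable_shift Bochner_Integration.integrable_add integrable_mult_right)
         (auto intro!: integrable_real_indicator simp: less_top[symmetric])
    also have "\<dots> = w x + (- h0 x * (\<integral>z. \<psi> x z \<partial>M) + w0 x0 * prob {y. y < - x / 2})"
      using \<psi>_int[OF xpos]
      by (simp add: integrable_real_indicator less_top[symmetric])
    also have "\<dots> \<le> w x + (- h0 x * (m / 2) + m / 36 * (9 * h0 x))"
      using x0\<psi>[OF x] x0m left_tail_le_h0[OF xpos] h0_pos[of x] xpos w0_pos[of x0] x0
      by (intro add_left_mono add_mono mult_left_mono_neg mult_mono) auto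
    finally show ?thesis by (simp add: algebra_simps)
  qed
  show thesis
  proof (rule that[of w x0])
    show "0 < w x0" using w0_pos[of x0] x0 by (simp add: w_def)
    show "x \<le> x0 \<Longrightarrow> w x = w x0" for x by (simp add: w_def)
    have "\<forall>\<^sub>F x in at_top. w0 x = w x"
      using eventually_ge_at_top[of x0] by eventually_elim (simp add: w_def max_def)
    with w0_tendsto show "(w \<longlongrightarrow> 0) at_top" by (rule Lim_transform_eventually)
    show "P w x \<le> w x" for x
    proof (cases "x \<ge> x0")
      case True
      then show ?thesis using step[OF True] h0_pos[of x] x0 K by (simp add: m_def) (smt (verit) mult_nonneg_nonneg)
    next
      case False
      have "P w x \<le> P (\<lambda>_. w0 x0) x" using bw w_le by (intro P_mono) auto
      then show ?thesis using False by (simp add: w_def)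
    qed
    show "\<exists>c>0. \<forall>x\<in>{x0..x0 + r}. c \<le> w x - P w x" for r
    proof (intro exI conjI ballI)
      show "0 < h0 (x0 + \<bar>r\<bar>) * (m / 4)" using h0_pos[of "x0 + \<bar>r\<bar>"] x0 K by (simp add: m_def)
      fix x assume x: "x \<in> {x0..x0 + r}"
      then have "h0 (x0 + \<bar>r\<bar>) \<le> h0 x" using x0 by (intro h0_antimono) auto
      then have "h0 (x0 + \<bar>r\<bar>) * (m / 4) \<le> h0 x * (m / 4)" using K by (intro mult_right_mono) (auto simp: m_def)
      then show "h0 (x0 + \<bar>r\<bar>) * (m / 4) \<le> w x - P w x" using step[of x] x by auto
    qed
  qed (use bw w_nonneg anti in auto)
qed

text \<open>Translate the Lyapunov function so that [a, b] falls into [x0, x0 + (b - a)], where w -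
  P w >= c. Then the indicator is at most (w - P w) / c, the sum telescopes, and the bound is
  independent of N and inherits the decay of w at plus infinity.\<close>

lemma interval_potential_le:
  obtains e where "bounded_borel e" "(e \<longlongrightarrow> 0) at_top"
    "\<And>N x. (\<Sum>n<N. (P ^^ n) (indicator {a..b}) x) \<le> e x"
proof -
  obtain w x0 where bw: "bounded_borel w" and w: "\<And>x. 0 \<le> w x" "0 < w x0" "antimono w"
    "\<And>x. x \<le> x0 \<Longrightarrow> w x = w x0" "(w \<longlongrightarrow> 0) at_top" "\<And>x. P w x \<le> w x"
    and ex: "\<And>r. \<exists>c>0. \<forall>x\<in>{x0..x0 + r}. c \<le> w x - P w x"
    using lyapunov by metis
  obtain c where c: "0 < c" "\<And>x. x \<in> {x0..x0 + (b - a)} \<Longrightarrow> c \<le> w x - P w x"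
    using ex[of "b - a"] by auto
  have ind: "bounded_borel (indicator {a..b} :: real \<Rightarrow> real)" by (rule bounded_borel_indicator) simp
  have le: "indicator {a..b} x \<le> (1 / c) * (w (x + (x0 - a)) - P w (x + (x0 - a)))" for x
    using c w(6)[of "x + (x0 - a)"] c(2)[of "x + (x0 - a)"]
    by (auto simp: indicator_def field_simps)
  show thesis
  proof (rule that[of "\<lambda>x. (1 / c) * w (x + (x0 - a))"])
    show "bounded_borel (\<lambda>x. (1 / c) * w (x + (x0 - a)))"
      by (intro bounded_borel_cmult bounded_borel_shift bw)
    show "((\<lambda>x. (1 / c) * w (x + (x0 - a))) \<longlongrightarrow> 0) at_top"
      by (rule tendsto_mult_right_zero[OF tendsto_shift_at_top[OF w(5)]])
    fix N x
    have "(P ^^ n) (indicator {a..b}) x \<le> (1 / c) * ((P ^^ n) w (x + (x0 - a)) - (P ^^ Suc n) w (x + (x0 - a)))" for n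
    proof -
      have "(P ^^ n) (indicator {a..b}) x \<le> (P ^^ n) (\<lambda>x. (1 / c) * (w (x + (x0 - a)) - P w (x + (x0 - a)))) x"
        by (intro P_pow_mono ind le bounded_borel_cmult bounded_borel_diff bounded_borel_shift bw bounded_borel_P)
      also have "\<dots> = (1 / c) * ((P ^^ n) w (x + (x0 - a)) - (P ^^ n) (P w) (x + (x0 - a)))"
        by (simp only: P_pow_cmult P_pow_diff[OF bounded_borel_shift[OF bw] bounded_borel_shift[OF bounded_borel_P[OF bw]]] P_pow_shift)
      finally show ?thesis by (simp add: funpow_swap1)
    qed
    then have "(\<Sum>n<N. (P ^^ n) (indicator {a..b}) x) \<le> (\<Sum>n<N. (1 / c) * ((P ^^ n) w (x + (x0 - a)) - (P ^^ Suc n) w (x + (x0 - a))))"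
      by (rule sum_mono)
    also have "\<dots> = (1 / c) * (w (x + (x0 - a)) - (P ^^ N) w (x + (x0 - a)))"
      using sum_lessThan_telescope'[of "\<lambda>n. (P ^^ n) w (x + (x0 - a))" N]
      by (simp only: sum_distrib_left[symmetric] funpow_0)
    also have "\<dots> \<le> (1 / c) * w (x + (x0 - a))"
      using c P_pow_nonneg[OF bw w(1)] by (intro mult_left_mono) auto
    finally show "(\<Sum>n<N. (P ^^ n) (indicator {a..b}) x) \<le> (1 / c) * w (x + (x0 - a))" .
  qed
qed

lemma summable_interval_potential: "summable (\<lambda>n. (P ^^ n) (indicator {a..b}) x)"
proof -
  obtain e where "\<And>N x. (\<Sum>n<N. (P ^^ n) (indicator {a..b}) x) \<le> e x"
    using interval_potential_le by metis
  then show ?thesis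
    by (intro bounded_imp_summable[where B="e x"] P_pow_nonneg bounded_borel_indicator)
       (auto simp: lessThan_Suc_atMost[symmetric] simp del: sum.lessThan_Suc)
qed

text \<open>Superharmonicity of a translate of w controls the mass below a far level k uniformly in
  n; the mass in [k, R] tends to 0 as the terms of a convergent series.\<close>

lemma P_pow_halfline_tendsto: "(\<lambda>n. (P ^^ n) (indicator {..R}) x) \<longlonglongrightarrow> 0"
proof (rule LIMSEQ_I)
  fix r :: real assume r: "0 < r"
  obtain w x0 where bw: "bounded_borel w" and w: "\<And>x. 0 \<le> w x" "0 < w x0" "antimono w"
    "\<And>x. x \<le> x0 \<Longrightarrow> w x = w x0" "(w \<longlongrightarrow> 0) at_top" "\<And>x. P w x \<le> w x"
    using lyapunov by metis
  have Pw: "(P ^^ n) w x \<le> w x" for n x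
  proof (induction n arbitrary: x)
    case (Suc n)
    have "(P ^^ Suc n) w x \<le> P w x" by (auto intro!: P_mono bounded_borel_P_pow bw Suc)
    with w(6)[of x] show ?case by linarith
  qed simp
  have "\<forall>\<^sub>F z in at_top. w z < w x0 * (r / 2)"
    using w(5) by (rule order_tendstoD) (use w(2) r in simp)
  then obtain z where z: "\<And>y. y \<ge> z \<Longrightarrow> w y < w x0 * (r / 2)"
    by (auto simp: eventually_at_top_linorder)
  \<comment> \<open>Chosen so that x + (x0 - k) >= z, where w is below
    \<open>w x0 * (r / 2)\<close>.\<close>
  define k where "k = min R (x - z + x0)"
  have 1: "(P ^^ n) (indicator {..k}) x \<le> r / 2" for n
  proof -
    have "(P ^^ n) (indicator {..k}) x \<le> (P ^^ n) (\<lambda>y. (1 / w x0) * w (y + (x0 - k))) x"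
    proof (intro P_pow_mono bounded_borel_cmult bounded_borel_shift bw bounded_borel_indicator)
      show "indicator {..k} y \<le> (1 / w x0) * w (y + (x0 - k))" for y
        using w(1,2) w(4)[of "y + (x0 - k)"] by (auto simp: indicator_def)
    qed simp
    also have "\<dots> = (1 / w x0) * (P ^^ n) w (x + (x0 - k))" by (simp only: P_pow_cmult P_pow_shift)
    also have "\<dots> \<le> (1 / w x0) * (w x0 * (r / 2))"
    proof (rule mult_left_mono)
      have "z \<le> x + (x0 - k)" by (simp add: k_def)
      then show "(P ^^ n) w (x + (x0 - k)) \<le> w x0 * (r / 2)"
        using Pw[of n "x + (x0 - k)"] z[of "x + (x0 - k)"] by linarith
    qed (use w(2) in simp)
    finally show ?thesis using w(2) by simp
  qed
  have "(\<lambda>n. (P ^^ n) (indicator {k..R}) x) \<longlonglongrightarrow> 0"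
    by (rule summable_LIMSEQ_zero[OF summable_interval_potential])
  then obtain N where N: "\<And>n. n \<ge> N \<Longrightarrow> (P ^^ n) (indicator {k..R}) x < r / 2"
    using order_tendstoD(2)[of _ 0 sequentially "r / 2"] r by (auto simp: eventually_sequentially)
  show "\<exists>N. \<forall>n\<ge>N. norm ((P ^^ n) (indicator {..R}) x - 0) < r"
  proof (intro exI allI impI)
    fix n assume n: "n \<ge> N"
    have "(P ^^ n) (indicator {..R}) x \<le> (P ^^ n) (\<lambda>y. indicator {..k} y + indicator {k..R} y) x"
      by (intro P_pow_mono bounded_borel_add bounded_borel_indicator) (auto simp: indicator_def)
    also have "\<dots> = (P ^^ n) (indicator {..k}) x + (P ^^ n) (indicator {k..R}) x"
      by (subst P_pow_add) (auto intro: bounded_borel_indicator)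
    also have "\<dots> < r" using 1[of n] N[OF n] by simp
    finally show "norm ((P ^^ n) (indicator {..R}) x - 0) < r"
      using P_pow_nonneg[OF bounded_borel_indicator[of "{..R}"], of n x] by simp
  qed
qed

end

section \<open>Potentials of a random walk\<close>

text \<open>If there are arbitrarily small positive elements, their multiples are dense. Otherwise
  distinct elements keep a distance \<epsilon>, a least positive element exists unless the group is
  trivial, and division with remainder shows that it generates.\<close>

lemma real_subgroup_cases:
  fixes G :: "real set"
  assumes zero: "0 \<in> G" and diff: "\<And>x y. x \<in> G \<Longrightarrow> y \<in> G \<Longrightarrow> x - y \<in> G"
  obtains d where "0 < d" "G \<subseteq> range (\<lambda>k::int. d * of_int k)"
  | "\<And>x \<epsilon>. 0 < \<epsilon> \<Longrightarrow> \<exists>y\<in>G. \<bar>x - y\<bar> < \<epsilon>"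
proof -
  have uminus: "- x \<in> G" if "x \<in> G" for x using diff[OF zero that] by simp
  have add: "x + y \<in> G" if "x \<in> G" "y \<in> G" for x y
    using diff[OF that(1) uminus[OF that(2)]] by simp
  have nat_mult: "of_nat n * x \<in> G" if "x \<in> G" for n :: nat and x
    by (induction n) (auto simp: zero distrib_right intro: add that)
  have mult: "of_int k * x \<in> G" if "x \<in> G" for k :: int and x
  proof (cases k rule: int_cases2)
    case (nonneg n) then show ?thesis using nat_mult[OF that, of n] by simp
  next
    case (nonpos n) then show ?thesis using uminus[OF nat_mult[OF that, of n]] by simp
  qed
  have rem: "0 \<le> x - of_int \<lfloor>x / g\<rfloor> * g" "x - of_int \<lfloor>x / g\<rfloor> * g < g" if "0 < g" for x g :: real
    using that floor_divide_lower[of g x] floor_divide_upper[of g x] by (auto simp: algebra_simps)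
  show thesis
  proof (cases "\<forall>\<epsilon>>0. \<exists>g\<in>G. 0 < g \<and> g < \<epsilon>")
    case True
    show thesis
    proof (rule that(2))
      fix x \<epsilon> :: real assume "0 < \<epsilon>"
      then obtain g where g: "g \<in> G" "0 < g" "g < \<epsilon>" using True by blast
      show "\<exists>y\<in>G. \<bar>x - y\<bar> < \<epsilon>"
        using rem[of g x] g by (intro bexI[of _ "of_int \<lfloor>x / g\<rfloor> * g"] mult) auto
    qed
  next
    case False
    then obtain \<epsilon> where \<epsilon>: "0 < \<epsilon>" "\<And>g. g \<in> G \<Longrightarrow> 0 < g \<Longrightarrow> \<epsilon> \<le> g" by (meson not_less)
    show thesis
    proof (cases "G \<subseteq> {0}")
      case True
      \<comment> \<open>The trivial group lies in every lattice; the span 1 is an arbitrary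
        choice.\<close>
      show thesis by (rule that(1)[of 1]) (use True in auto)
    next
      case False
      then obtain p where p: "p \<in> G" "0 < p" using uminus
        by (metis insertCI linorder_neqE_linordered_idom neg_0_less_iff_less subsetI)
      \<comment> \<open>A minimum without a limit argument: with N least, g < N \<epsilon> is
        already the least positive element, since any smaller one is smaller by at least \<epsilon>
        and so lies below (N - 1) \<epsilon>.\<close>
      define N where "N = (LEAST n::nat. \<exists>g\<in>G. 0 < g \<and> g < of_nat n * \<epsilon>)"
      obtain n0 :: nat where "p / \<epsilon> < of_nat n0" using reals_Archimedean2 by blast
      then have "\<exists>g\<in>G. 0 < g \<and> g < of_nat n0 * \<epsilon>" using p \<epsilon> by (auto simp: field_simps)
      then have "\<exists>g\<in>G. 0 < g \<and> g < of_nat N * \<epsilon>" unfolding N_def by (rule LeastI)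
      then obtain g where g: "g \<in> G" "0 < g" "g < of_nat N * \<epsilon>" by blast
      have min: "g \<le> g'" if g': "g' \<in> G" "0 < g'" for g'
      proof (rule ccontr)
        assume "\<not> g \<le> g'"
        then have "\<epsilon> \<le> g - g'" using \<epsilon>(2)[OF diff[OF g(1) g'(1)]] by simp
        have "N \<noteq> 0" using g by (intro notI) simp
        moreover have "g' < of_nat (N - 1) * \<epsilon>"
          using \<open>\<epsilon> \<le> g - g'\<close> g(3) \<open>N \<noteq> 0\<close> by (simp add: of_nat_diff left_diff_distrib)
        then have "\<exists>g\<in>G. 0 < g \<and> g < of_nat (N - 1) * \<epsilon>" using g' by blast
        then have "N \<le> N - 1" unfolding N_def by (rule Least_le)
        ultimately show False by simp
      qed
      show thesis
      proof (rule that(1)[OF g(2)], rule subsetI)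
        fix x assume x: "x \<in> G"
        have "x - of_int \<lfloor>x / g\<rfloor> * g \<in> G" by (intro diff x mult g)
        then have "x - of_int \<lfloor>x / g\<rfloor> * g = 0"
          using rem[OF g(2), of x] min[of "x - of_int \<lfloor>x / g\<rfloor> * g"] by linarith
        then show "x \<in> range (\<lambda>k::int. g * of_int k)" by (intro image_eqI[of _ _ "\<lfloor>x / g\<rfloor>"]) (auto simp: mult.commute)
      qed
    qed
  qed
qed

section \<open>The energy form of the walk and its behaviour under P\<close>

context random_walk
begin

text \<open>
  \<open>\<Gamma> f\<close> is the carre-du-champ of \<open>P\<close>; it vanishes at \<open>x\<close> iff almost every step is a period of \<open>f\<close>
  at \<open>x\<close>.
\<close>

definition \<Gamma> :: "(real \<Rightarrow> real) \<Rightarrow> real \<Rightarrow> real" where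
  "\<Gamma> f x = (\<integral>y. (f (x + y) - f x)\<^sup>2 \<partial>M)"

lemma bounded_borel_increment:
  assumes "bounded_borel f" shows "bounded_borel (\<lambda>z. (f z - c)\<^sup>2)"
  using assms by (intro bounded_borel_power bounded_borel_diff bounded_borel_const)

lemma \<Gamma>_nonneg: "0 \<le> \<Gamma> f x"
  unfolding \<Gamma>_def by simp

lemma \<Gamma>_eq:
  assumes "bounded_borel f"
  shows "\<Gamma> f x = P (\<lambda>z. (f z)\<^sup>2) x - 2 * f x * P f x + (f x)\<^sup>2"
proof -
  have "\<Gamma> f x = P (\<lambda>z. ((f z)\<^sup>2 - (2 * f x) * f z) + (f x)\<^sup>2) x"
    unfolding \<Gamma>_def P_def by (simp add: power2_diff algebra_simps)
  also have "\<dots> = P (\<lambda>z. (f z)\<^sup>2 - (2 * f x) * f z) x + (f x)\<^sup>2"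
    using assms by (subst P_add) (auto intro: bounded_borel_diff bounded_borel_power bounded_borel_cmult)
  also have "P (\<lambda>z. (f z)\<^sup>2 - (2 * f x) * f z) x = P (\<lambda>z. (f z)\<^sup>2) x - 2 * f x * P f x"
    using assms by (subst P_diff) (auto intro: bounded_borel_power bounded_borel_cmult simp: P_cmult)
  finally show ?thesis .
qed

lemma bounded_borel_\<Gamma>:
  assumes "bounded_borel f" shows "bounded_borel (\<Gamma> f)"
proof -
  have "bounded_borel (\<lambda>x. P (\<lambda>z. (f z)\<^sup>2) x - 2 * (f x * P f x) + (f x)\<^sup>2)"
    using assms by (intro bounded_borel_add bounded_borel_diff bounded_borel_cmult bounded_borel_mult bounded_borel_P bounded_borel_power)
  also have "(\<lambda>x. P (\<lambda>z. (f z)\<^sup>2) x - 2 * (f x * P f x) + (f x)\<^sup>2) = \<Gamma> f"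
    by (auto simp: \<Gamma>_eq[OF assms])
  finally show ?thesis .
qed

lemma square_integral_le:
  assumes "bounded_borel f" shows "(\<integral>y. f y \<partial>M)\<^sup>2 \<le> (\<integral>y. (f y)\<^sup>2 \<partial>M)"
proof -
  define c where "c = (\<integral>y. f y \<partial>M)"
  have "(\<integral>y. (f y)\<^sup>2 - (2 * c) * f y + c\<^sup>2 \<partial>M) = (\<integral>y. (f y)\<^sup>2 \<partial>M) - (2 * c) * c + c\<^sup>2"
    using integrable_bounded_borel[OF assms] integrable_bounded_borel[OF bounded_borel_power[OF assms]] by (simp add: c_def)
  moreover have "0 \<le> (\<integral>y. (f y)\<^sup>2 - (2 * c) * f y + c\<^sup>2 \<partial>M)"
  proof (rule Bochner_Integration.integral_nonneg)
    fix y
    have "(f y)\<^sup>2 - (2 * c) * f y + c\<^sup>2 = (f y - c)\<^sup>2" by (simp add: power2_diff)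
    then show "0 \<le> (f y)\<^sup>2 - (2 * c) * f y + c\<^sup>2" by simp
  qed
  ultimately show ?thesis by (simp add: c_def power2_eq_square)
qed

text \<open>P commutes with translations, so an increment of P f by y is the mean over z of the
  increments of f by y started at x + z. Jensen bounds its square, and Fubini exchanges the two
  steps.\<close>

lemma \<Gamma>_P_le:
  assumes f: "bounded_borel f" shows "\<Gamma> (P f) x \<le> P (\<Gamma> f) x"
proof -
  interpret MM: pair_prob_space M M ..
  obtain B where B: "\<And>x. \<bar>f x\<bar> \<le> B" using f by (metis bounded_borelE)
  have [measurable]: "f \<in> borel_measurable borel" using f by (simp add: bounded_borel_def)
  have bd: "bounded_borel (\<lambda>z. f (x + y + z) - f (x + z))" for y
    using bounded_borel_diff[OF bounded_borel_shift[OF f, of "x + y"] bounded_borel_shift[OF f, of x]]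
    by (simp add: ac_simps)
  have sq_le: "(f (x + y + z) - f (x + z))\<^sup>2 \<le> (2 * B)\<^sup>2" for y z
    using B[of "x + y + z"] B[of "x + z"] by (intro power2_le_iff_abs_le[THEN iffD2]) linarith+
  have int2: "integrable (M \<Otimes>\<^sub>M M) (\<lambda>(y, z). (f (x + y + z) - f (x + z))\<^sup>2)"
    using sq_le by (intro MM.P.integrable_const_bound[where B="(2 * B)\<^sup>2"]) auto
  have "(P f (x + y) - P f x)\<^sup>2 \<le> (\<integral>z. (f (x + y + z) - f (x + z))\<^sup>2 \<partial>M)" for y
  proof -
    have "P f (x + y) - P f x = (\<integral>z. f (x + y + z) - f (x + z) \<partial>M)"
      unfolding P_def by (intro Bochner_Integration.integral_diff[symmetric] integrable_shift f)
    then show ?thesis using square_integral_le[OF bd] by simp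
  qed
  then have "\<Gamma> (P f) x \<le> (\<integral>y. (\<integral>z. (f (x + y + z) - f (x + z))\<^sup>2 \<partial>M) \<partial>M)"
    unfolding \<Gamma>_def
    using integrable_shift[OF bounded_borel_increment[OF bounded_borel_P[OF f], of "P f x"], of x]
      MM.integrable_fst'[OF int2]
    by (intro integral_mono) auto
  also have "\<dots> = (\<integral>z. (\<integral>y. (f (x + y + z) - f (x + z))\<^sup>2 \<partial>M) \<partial>M)"
    using MM.Fubini_integral[OF int2] by simp
  also have "\<dots> = P (\<Gamma> f) x"
    unfolding P_def \<Gamma>_def by (simp add: ac_simps)
  finally show ?thesis .
qed

lemma \<Gamma>_P_pow_le:
  assumes f: "bounded_borel f" shows "\<Gamma> ((P ^^ n) f) x \<le> (P ^^ n) (\<Gamma> f) x"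
proof (induction n arbitrary: x)
  case (Suc n)
  have "\<Gamma> ((P ^^ Suc n) f) x \<le> P (\<Gamma> ((P ^^ n) f)) x"
    using \<Gamma>_P_le[OF bounded_borel_P_pow[OF f]] by simp
  also have "\<dots> \<le> P ((P ^^ n) (\<Gamma> f)) x"
    by (intro P_mono bounded_borel_P_pow bounded_borel_\<Gamma> f Suc)
  finally show ?case by simp
qed simp

text \<open>Compares the energy of Z with that of \<open>(P ^^ k) Z\<close>, which differs from Z by
  e = \<open>Zn k\<close>. The constants come from using (a + b)^2 <= 2 a^2 + 2 b^2 twice.\<close>

lemma \<Gamma>_le_diff:
  assumes f: "bounded_borel f" and e: "bounded_borel e"
  shows "\<Gamma> f x \<le> 2 * \<Gamma> (\<lambda>z. f z - e z) x + 4 * (P (\<lambda>z. (e z)\<^sup>2) x + (e x)\<^sup>2)"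
proof -
  have bd: "bounded_borel (\<lambda>z. f z - e z)" by (intro bounded_borel_diff f e)
  have "\<Gamma> f x \<le> (\<integral>y. 2 * ((f (x + y) - e (x + y)) - (f x - e x))\<^sup>2 + 4 * ((e (x + y))\<^sup>2 + (e x)\<^sup>2) \<partial>M)"
    unfolding \<Gamma>_def
  proof (rule integral_mono)
    show "integrable M (\<lambda>y. (f (x + y) - f x)\<^sup>2)"
      using integrable_shift[OF bounded_borel_increment[OF f]] .
    show "integrable M (\<lambda>y. 2 * ((f (x + y) - e (x + y)) - (f x - e x))\<^sup>2 + 4 * ((e (x + y))\<^sup>2 + (e x)\<^sup>2))"
      using integrable_shift[OF bounded_borel_increment[OF bd]] integrable_shift[OF bounded_borel_power[OF e]] by auto
    fix y
    show "(f (x + y) - f x)\<^sup>2 \<le> 2 * ((f (x + y) - e (x + y)) - (f x - e x))\<^sup>2 + 4 * ((e (x + y))\<^sup>2 + (e x)\<^sup>2)"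
    proof -
      have *: "(p + q - r)\<^sup>2 \<le> 2 * p\<^sup>2 + 4 * (q\<^sup>2 + r\<^sup>2)" for p q r :: real
      proof -
        have "2 * p\<^sup>2 + 4 * (q\<^sup>2 + r\<^sup>2) - (p + q - r)\<^sup>2 = (p - q + r)\<^sup>2 + 2 * (q + r)\<^sup>2"
          by (simp add: power2_eq_square algebra_simps)
        then show ?thesis by (metis add_nonneg_nonneg diff_ge_0_iff_ge mult_nonneg_nonneg zero_le_numeral zero_le_power2)
      qed
      show ?thesis using *[of "(f (x + y) - e (x + y)) - (f x - e x)" "e (x + y)" "e x"] by simp
    qed
  qed
  also have "\<dots> = 2 * \<Gamma> (\<lambda>z. f z - e z) x + 4 * (P (\<lambda>z. (e z)\<^sup>2) x + (e x)\<^sup>2)"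
    unfolding \<Gamma>_def P_def
    using integrable_shift[OF bounded_borel_increment[OF bd]] integrable_shift[OF bounded_borel_power[OF e]] by simp
  finally show ?thesis .
qed

end

section \<open>Potentials of bounded functions with bounded support\<close>

context positive_drift_walk
begin

text \<open>Wide enough to cover both the Lipschitz test functions and the indicators of intervals
  that are finally squeezed between them.\<close>

definition dominated :: "(real \<Rightarrow> real) \<Rightarrow> bool" where
  "dominated g \<longleftrightarrow> bounded_borel g \<and> (\<forall>x. 0 \<le> g x) \<and> (\<exists>C a b. 0 \<le> C \<and> (\<forall>x. g x \<le> C * indicator {a..b} x))"

definition partial_pot :: "(real \<Rightarrow> real) \<Rightarrow> nat \<Rightarrow> real \<Rightarrow> real" where
  "partial_pot g N x = (\<Sum>n<N. (P ^^ n) g x)"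

definition pot :: "(real \<Rightarrow> real) \<Rightarrow> real \<Rightarrow> real" where
  "pot g x = (\<Sum>n. (P ^^ n) g x)"

context
  fixes g :: "real \<Rightarrow> real"
  assumes g: "dominated g"
begin

lemma dominated_bounded_borel: "bounded_borel g"
  using g by (simp add: dominated_def)

lemma P_pow_dominated_nonneg: "0 \<le> (P ^^ n) g x"
  using g by (intro P_pow_nonneg) (auto simp: dominated_def)

lemma bounded_borel_partial_pot: "bounded_borel (partial_pot g N)"
  unfolding partial_pot_def by (intro bounded_borel_sum bounded_borel_P_pow dominated_bounded_borel)

lemma partial_pot_nonneg: "0 \<le> partial_pot g N x"
  unfolding partial_pot_def by (intro sum_nonneg P_pow_dominated_nonneg)

lemma partial_pot_le:
  obtains e where "bounded_borel e" "(e \<longlongrightarrow> 0) at_top" "\<And>N x. partial_pot g N x \<le> e x"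
proof -
  obtain C a b where C: "0 \<le> C" and le: "\<And>x. g x \<le> C * indicator {a..b} x"
    using g by (auto simp: dominated_def)
  obtain e where e: "bounded_borel e" "(e \<longlongrightarrow> 0) at_top"
    "\<And>N x. (\<Sum>n<N. (P ^^ n) (indicator {a..b}) x) \<le> e x"
    using interval_potential_le by metis
  show thesis
  proof (rule that[of "\<lambda>x. C * e x"])
    fix N x
    have "(P ^^ n) g x \<le> C * (P ^^ n) (indicator {a..b}) x" for n
    proof -
      have "(P ^^ n) g x \<le> (P ^^ n) (\<lambda>x. C * indicator {a..b} x) x"
        by (intro P_pow_mono dominated_bounded_borel bounded_borel_cmult bounded_borel_indicator le) simp
      then show ?thesis by (simp only: P_pow_cmult)
    qed
    then have "partial_pot g N x \<le> (\<Sum>n<N. C * (P ^^ n) (indicator {a..b}) x)"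
      unfolding partial_pot_def by (rule sum_mono)
    also have "\<dots> \<le> C * e x"
      unfolding sum_distrib_left[symmetric] using e(3) C by (intro mult_left_mono) auto
    finally show "partial_pot g N x \<le> C * e x" .
  qed (use e in \<open>auto intro: bounded_borel_cmult tendsto_mult_right_zero\<close>)
qed

lemma summable_pot: "summable (\<lambda>n. (P ^^ n) g x)"
proof -
  obtain e where "\<And>N x. partial_pot g N x \<le> e x" using partial_pot_le by metis
  then show ?thesis
    by (intro bounded_imp_summable[where B="e x"] P_pow_dominated_nonneg)
       (auto simp: lessThan_Suc_atMost[symmetric] partial_pot_def simp del: sum.lessThan_Suc)
qed

lemma partial_pot_tendsto: "(\<lambda>N. partial_pot g N x) \<longlonglongrightarrow> pot g x"
  unfolding partial_pot_def pot_def by (rule summable_LIMSEQ[OF summable_pot])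

lemma partial_pot_le_pot: "partial_pot g N x \<le> pot g x"
  unfolding partial_pot_def pot_def
  by (rule sum_le_suminf[OF summable_pot]) (auto intro: P_pow_dominated_nonneg)

lemma pot_nonneg: "0 \<le> pot g x"
  using partial_pot_le_pot[of 0 x] by (simp add: partial_pot_def)

lemma pot_le:
  obtains e where "bounded_borel e" "(e \<longlongrightarrow> 0) at_top" "\<And>x. pot g x \<le> e x"
proof -
  obtain e where e: "bounded_borel e" "(e \<longlongrightarrow> 0) at_top" "\<And>N x. partial_pot g N x \<le> e x"
    using partial_pot_le by metis
  show thesis using e(1,2) LIMSEQ_le_const2[OF partial_pot_tendsto] e(3) by (intro that[of e]) auto
qed

lemma bounded_borel_pot: "bounded_borel (pot g)"
proof -
  obtain e where "bounded_borel e" and e: "\<And>x. pot g x \<le> e x" using pot_le by metis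
  then obtain B where B: "\<And>x. \<bar>e x\<bar> \<le> B" by (metis bounded_borelE)
  show ?thesis
  proof (rule bounded_borelI)
    show "pot g \<in> borel_measurable borel"
      unfolding pot_def using bounded_borel_P_pow[OF dominated_bounded_borel]
      by (intro borel_measurable_suminf) (auto simp: bounded_borel_def)
    show "\<bar>pot g x\<bar> \<le> B" for x using pot_nonneg[of x] e[of x] B[of x] by linarith
  qed
qed

lemma pot_tendsto_at_top: "(pot g \<longlongrightarrow> 0) at_top"
proof -
  obtain e where "(e \<longlongrightarrow> 0) at_top" "\<And>x. pot g x \<le> e x" using pot_le by metis
  then show ?thesis using pot_nonneg by (intro tendsto_sandwich[of "\<lambda>_. 0" "pot g" at_top e]) auto
qed

lemma P_partial_pot: "P (partial_pot g n) x = partial_pot g (Suc n) x - g x"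
proof -
  have "P (partial_pot g n) x = (\<Sum>k<n. (P ^^ Suc k) g x)"
    unfolding partial_pot_def by (subst P_sum) (auto intro: bounded_borel_P_pow dominated_bounded_borel)
  then show ?thesis unfolding partial_pot_def sum.lessThan_Suc_shift by simp
qed

lemma P_pot: "P (pot g) x = pot g x - g x"
proof -
  obtain B where B: "\<And>x. \<bar>pot g x\<bar> \<le> B" using bounded_borel_pot by (metis bounded_borelE)
  note [measurable] = bounded_borel_measurable[OF bounded_borel_pot] bounded_borel_measurable[OF bounded_borel_partial_pot]
  have "(\<lambda>N. P (partial_pot g N) x) \<longlonglongrightarrow> P (pot g) x"
    unfolding P_def
  proof (rule integral_dominated_convergence[where w="\<lambda>_. B"])
    show "AE y in M. norm (partial_pot g N (x + y)) \<le> B" for N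
    proof (rule AE_I2)
      fix y show "norm (partial_pot g N (x + y)) \<le> B"
        using partial_pot_le_pot[of N "x + y"] partial_pot_nonneg[of N "x + y"] B[of "x + y"] by (simp add: abs_le_iff)
    qed
  qed (auto intro: partial_pot_tendsto)
  moreover have "(\<lambda>N. partial_pot g (Suc N) x - g x) \<longlonglongrightarrow> pot g x - g x"
    by (intro tendsto_diff tendsto_const LIMSEQ_Suc partial_pot_tendsto)
  ultimately show ?thesis using LIMSEQ_unique by (simp add: P_partial_pot)
qed

end

lemma pot_mono:
  assumes "dominated g" "dominated g'" "\<And>x. g x \<le> g' x" shows "pot g x \<le> pot g' x"
  unfolding pot_def using assms
  by (intro suminf_le summable_pot P_pow_mono dominated_bounded_borel)

end

text \<open>Lipschitz continuity of g passes to its potential, uniformly over the line. This is what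
  allows approximate steps and approximate periods to be treated as exact ones; indicators return
  only in Blackwell's theorem.\<close>

locale test_function = positive_drift_walk M for M :: "real measure" +
  fixes g :: "real \<Rightarrow> real" and a b L :: real
  assumes g_nonneg: "0 \<le> g x"
    and g_supp: "x \<notin> {a..b} \<Longrightarrow> g x = 0"
    and g_lip: "\<bar>g x - g y\<bar> \<le> L * \<bar>x - y\<bar>"
begin

abbreviation Z :: "real \<Rightarrow> real" where "Z \<equiv> pot g"

abbreviation Zn :: "nat \<Rightarrow> real \<Rightarrow> real" where "Zn \<equiv> partial_pot g"

lemma L_nonneg: "0 \<le> L"
  using g_lip[of 0 1] by auto

lemma g_le: "g x \<le> (L * \<bar>b - a + 1\<bar>) * indicator {a..b} x"
proof (cases "x \<in> {a..b}")
  case True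
  \<comment> \<open>g vanishes at a - 1, so the Lipschitz constant also bounds its size.\<close>
  have "g x = \<bar>g x - g (a - 1)\<bar>" using g_supp[of "a - 1"] g_nonneg[of x] by simp
  also have "\<dots> \<le> L * \<bar>x - (a - 1)\<bar>" by (rule g_lip)
  also have "\<dots> \<le> L * \<bar>b - a + 1\<bar>" using True L_nonneg by (intro mult_left_mono) auto
  finally show ?thesis using True by simp
qed (use g_supp in auto)

lemma bounded_borel_g: "bounded_borel g"
proof (rule bounded_borelI)
  have "L-lipschitz_on UNIV g"
    using g_lip L_nonneg by (intro lipschitz_onI) (auto simp: dist_real_def)
  then show "g \<in> borel_measurable borel"
    by (intro borel_measurable_continuous_onI lipschitz_on_continuous_on)
  show "\<bar>g x\<bar> \<le> L * \<bar>b - a + 1\<bar>" for x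
    using g_le[of x] g_nonneg[of x] L_nonneg by (cases "x \<in> {a..b}") (auto simp: g_supp)
qed

lemma dominated_g: "dominated g"
  unfolding dominated_def using bounded_borel_g g_nonneg g_le L_nonneg
  by (intro conjI exI[of _ "L * \<bar>b - a + 1\<bar>"] exI[of _ a] exI[of _ b]) auto

lemmas bounded_borel_Zn = bounded_borel_partial_pot[OF dominated_g]
  and bounded_borel_Z = bounded_borel_pot[OF dominated_g]
  and P_pow_g_nonneg = P_pow_dominated_nonneg[OF dominated_g]
  and Zn_nonneg = partial_pot_nonneg[OF dominated_g]
  and Z_nonneg = pot_nonneg[OF dominated_g]
  and Zn_tendsto = partial_pot_tendsto[OF dominated_g]
  and P_Zn = P_partial_pot[OF dominated_g]
  and P_Z = P_pot[OF dominated_g]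

text \<open>A shift by at most 1 changes g by at most L |\<delta>|, and only inside the fixed
  interval [a - 1, b + 1], whose potential is bounded uniformly.\<close>

lemma Z_lipschitz:
  obtains C where "0 \<le> C" "\<And>x \<delta>. \<bar>\<delta>\<bar> \<le> 1 \<Longrightarrow> \<bar>Z (x + \<delta>) - Z x\<bar> \<le> C * \<bar>\<delta>\<bar>"
proof -
  obtain e where e: "bounded_borel e"
    "\<And>N x. (\<Sum>n<N. (P ^^ n) (indicator {a - 1..b + 1}) x) \<le> e x"
    using interval_potential_le by metis
  then obtain B where B: "0 \<le> B" "\<And>x. \<bar>e x\<bar> \<le> B" by (metis bounded_borelE)
  show thesis
  proof (rule that[of "L * B"])
    show "0 \<le> L * B" using L_nonneg B by simp
    fix x \<delta> :: real assume \<delta>: "\<bar>\<delta>\<bar> \<le> 1"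
    have gd: "bounded_borel (\<lambda>x. g (x + \<delta>) - g x)"
      by (intro bounded_borel_diff bounded_borel_shift bounded_borel_g)
    have ind: "bounded_borel (indicator {a - 1..b + 1} :: real \<Rightarrow> real)" by (rule bounded_borel_indicator) simp
    have le: "\<bar>g (z + \<delta>) - g z\<bar> \<le> (L * \<bar>\<delta>\<bar>) * indicator {a - 1..b + 1} z" for z
    proof (cases "z \<in> {a - 1..b + 1}")
      case True then show ?thesis using g_lip[of "z + \<delta>" z] by simp
    next
      case False
    then have "z \<notin> {a..b}" "z + \<delta> \<notin> {a..b}" using \<delta> by auto
    then show ?thesis using g_supp L_nonneg by simp
    qed
    have "\<bar>(P ^^ n) g (x + \<delta>) - (P ^^ n) g x\<bar> \<le> (L * \<bar>\<delta>\<bar>) * (P ^^ n) (indicator {a - 1..b + 1}) x" for n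
    proof -
      have eq: "(P ^^ n) g (x + \<delta>) - (P ^^ n) g x = (P ^^ n) (\<lambda>x. g (x + \<delta>) - g x) x"
        by (simp only: P_pow_diff[OF bounded_borel_shift[OF bounded_borel_g] bounded_borel_g] P_pow_shift)
      have "(P ^^ n) (\<lambda>x. g (x + \<delta>) - g x) x \<le> (P ^^ n) (\<lambda>z. (L * \<bar>\<delta>\<bar>) * indicator {a - 1..b + 1} z) x"
        using le by (intro P_pow_mono gd bounded_borel_cmult ind) (metis abs_ge_self order_trans)
      moreover have "(P ^^ n) (\<lambda>z. (- (L * \<bar>\<delta>\<bar>)) * indicator {a - 1..b + 1} z) x \<le> (P ^^ n) (\<lambda>x. g (x + \<delta>) - g x) x"
        using le by (intro P_pow_mono gd bounded_borel_cmult ind) (metis abs_le_D2 minus_le_iff mult_minus_left)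
      ultimately show ?thesis unfolding eq by (simp only: P_pow_cmult) (simp add: abs_le_iff)
    qed
    then have "\<bar>Zn N (x + \<delta>) - Zn N x\<bar> \<le> (\<Sum>n<N. (L * \<bar>\<delta>\<bar>) * (P ^^ n) (indicator {a - 1..b + 1}) x)" for N
      unfolding partial_pot_def sum_subtractf[symmetric] by (intro order_trans[OF sum_abs] sum_mono)
    also have "(\<Sum>n<N. (L * \<bar>\<delta>\<bar>) * (P ^^ n) (indicator {a - 1..b + 1}) x) \<le> (L * \<bar>\<delta>\<bar>) * B" for N
      unfolding sum_distrib_left[symmetric] using e(2)[of x N] B(2)[of x] L_nonneg by (intro mult_left_mono) auto
    finally have "\<bar>Zn N (x + \<delta>) - Zn N x\<bar> \<le> L * B * \<bar>\<delta>\<bar>" for N by (simp add: mult_ac)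
    then show "\<bar>Z (x + \<delta>) - Z x\<bar> \<le> L * B * \<bar>\<delta>\<bar>"
      by (intro LIMSEQ_le_const2[OF tendsto_rabs[OF tendsto_diff[OF Zn_tendsto Zn_tendsto]]]) auto
  qed
qed

end

section \<open>Asymptotic flatness of potentials\<close>

lemma small_step:
  fixes C r :: real
  assumes "0 \<le> C" "0 < r"
  obtains \<epsilon> where "0 < \<epsilon>" "\<epsilon> \<le> 1" "C * \<epsilon> \<le> r / 2"
\<comment> \<open>The denominator has C + 1 because C may be 0.\<close>
proof (rule that[of "min 1 (r / (2 * (C + 1)))"])
  have "(r / 2) * (C / (C + 1)) \<le> (r / 2) * 1"
    using assms by (intro mult_left_mono) auto
  then have "C * (r / (2 * (C + 1))) \<le> r / 2" by (simp add: mult.commute)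
  moreover have "C * min 1 (r / (2 * (C + 1))) \<le> C * (r / (2 * (C + 1)))"
    using assms by (intro mult_left_mono) auto
  ultimately show "C * min 1 (r / (2 * (C + 1))) \<le> r / 2" by linarith
qed (use assms in auto)

context test_function
begin

text \<open>Inserting P Z = Z - g into the expansion of the energy gives \<open>\<Gamma> Z\<close> =
  P (Z^2) - Z^2 + 2 Z g, and the first two terms telescope under iteration.\<close>

lemma sum_P_pow_\<Gamma>_Z:
  "(\<Sum>k<n. (P ^^ k) (\<Gamma> Z) x) = (P ^^ n) (\<lambda>z. (Z z)\<^sup>2) x - (Z x)\<^sup>2 + 2 * (\<Sum>k<n. (P ^^ k) (\<lambda>z. Z z * g z) x)"
proof -
  note bd = bounded_borel_Z bounded_borel_g bounded_borel_power[OF bounded_borel_Z, of 2] bounded_borel_mult[OF bounded_borel_Z bounded_borel_g]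
  have \<Gamma>_Z: "\<Gamma> Z = (\<lambda>x. (P (\<lambda>z. (Z z)\<^sup>2) x - (Z x)\<^sup>2) + 2 * (Z x * g x))"
    by (rule ext, subst \<Gamma>_eq[OF bounded_borel_Z]) (simp add: P_Z algebra_simps power2_eq_square)
  have "(P ^^ k) (\<Gamma> Z) x = ((P ^^ Suc k) (\<lambda>z. (Z z)\<^sup>2) x - (P ^^ k) (\<lambda>z. (Z z)\<^sup>2) x) + 2 * (P ^^ k) (\<lambda>z. Z z * g z) x" for k
    unfolding \<Gamma>_Z using bd
    by (subst P_pow_add, (intro bounded_borel_diff bounded_borel_cmult bounded_borel_P bd)+, subst P_pow_diff)
       (auto intro: bounded_borel_P simp: P_pow_cmult funpow_swap1)
  then have "(\<Sum>k<n. (P ^^ k) (\<Gamma> Z) x) =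
      (\<Sum>k<n. (P ^^ Suc k) (\<lambda>z. (Z z)\<^sup>2) x - (P ^^ k) (\<lambda>z. (Z z)\<^sup>2) x) + 2 * (\<Sum>k<n. (P ^^ k) (\<lambda>z. Z z * g z) x)"
    by (simp only: sum.distrib sum_distrib_left)
  also have "(\<Sum>k<n. (P ^^ Suc k) (\<lambda>z. (Z z)\<^sup>2) x - (P ^^ k) (\<lambda>z. (Z z)\<^sup>2) x) = (P ^^ n) (\<lambda>z. (Z z)\<^sup>2) x - (Z x)\<^sup>2"
    using sum_lessThan_telescope[of "\<lambda>k. (P ^^ k) (\<lambda>z. (Z z)\<^sup>2) x" n] by (simp only: funpow_0)
  finally show ?thesis .
qed

lemma P_pow_Z: "(P ^^ k) Z = (\<lambda>x. Z x - Zn k x)"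
proof (induction k)
  case (Suc k)
  have "P (\<lambda>x. Z x - Zn k x) x = Z x - Zn (Suc k) x" for x
    by (simp add: P_diff[OF bounded_borel_Z bounded_borel_Zn] P_Z P_Zn)
  then show ?case using Suc by auto
qed (simp add: partial_pot_def)

lemma g_tendsto_at_bot: "(g \<longlongrightarrow> 0) at_bot"
proof (rule Lim_transform_eventually[OF tendsto_const])
  show "\<forall>\<^sub>F x in at_bot. 0 = g x"
    using eventually_le_at_bot[of "a - 1"] by eventually_elim (simp add: g_supp)
qed

lemma Zn_tendsto_at_bot: "(Zn n \<longlongrightarrow> 0) at_bot"
proof -
  have "((\<lambda>x. \<Sum>k<n. (P ^^ k) g x) \<longlongrightarrow> (\<Sum>k<n. 0)) at_bot"
    by (intro tendsto_sum P_pow_tendsto_at_bot bounded_borel_g g_tendsto_at_bot)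
  then show ?thesis by (simp add: partial_pot_def[abs_def])
qed

text \<open>
  The potential \<open>Z\<close> is almost harmonic far to the left, so \<open>P\<^sup>k Z\<^sup>2\<close> is almost increasing in
  \<open>k\<close>, with increments at least \<open>\<Gamma> (P\<^sup>k Z) \<approx> \<Gamma> Z\<close>.  As \<open>Z\<^sup>2\<close> is bounded, \<open>\<Gamma> Z\<close> must vanish in
  the limit.
\<close>

lemma \<Gamma>_Z_tendsto: "(\<Gamma> Z \<longlongrightarrow> 0) at_bot"
proof (rule tendstoI)
  fix r :: real assume r: "0 < r"
  obtain B where B: "0 \<le> B" "\<And>x. \<bar>Z x\<bar> \<le> B" using bounded_borel_Z by (metis bounded_borelE)
  have Z_B: "Z x \<le> B" for x using B(2)[of x] by simp
  \<comment> \<open>Collects the terms to be discarded: the part coming from the potential of Z g,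
    and the squares from \<open>\<Gamma>_le_diff\<close>. All are built from \<open>Zn k\<close>
    with k <= n, so for fixed n they vanish at minus infinity.\<close>
  define s where "s n x = 4 * B * Zn n x + 4 * (\<Sum>k<n. P (\<lambda>z. (Zn k z)\<^sup>2) x + (Zn k x)\<^sup>2)" for n x
  have main: "of_nat n * \<Gamma> Z x \<le> 2 * B\<^sup>2 + s n x" for n x
  proof -
    have "of_nat n * \<Gamma> Z x = (\<Sum>k<n. \<Gamma> Z x)" by simp
    also have "\<dots> \<le> (\<Sum>k<n. 2 * (P ^^ k) (\<Gamma> Z) x + 4 * (P (\<lambda>z. (Zn k z)\<^sup>2) x + (Zn k x)\<^sup>2))"
    proof (rule sum_mono)
      fix k
      have "\<Gamma> Z x \<le> 2 * \<Gamma> ((P ^^ k) Z) x + 4 * (P (\<lambda>z. (Zn k z)\<^sup>2) x + (Zn k x)\<^sup>2)"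
        unfolding P_pow_Z by (rule \<Gamma>_le_diff[OF bounded_borel_Z bounded_borel_Zn])
      with \<Gamma>_P_pow_le[OF bounded_borel_Z, of k x]
      show "\<Gamma> Z x \<le> 2 * (P ^^ k) (\<Gamma> Z) x + 4 * (P (\<lambda>z. (Zn k z)\<^sup>2) x + (Zn k x)\<^sup>2)" by linarith
    qed
    also have "\<dots> = 2 * (\<Sum>k<n. (P ^^ k) (\<Gamma> Z) x) + 4 * (\<Sum>k<n. P (\<lambda>z. (Zn k z)\<^sup>2) x + (Zn k x)\<^sup>2)"
      by (subst sum.distrib) (simp only: sum_distrib_left)
    also have "(\<Sum>k<n. (P ^^ k) (\<Gamma> Z) x) \<le> B\<^sup>2 + 2 * (B * Zn n x)"
    proof -
      have "(P ^^ n) (\<lambda>z. (Z z)\<^sup>2) x \<le> (P ^^ n) (\<lambda>z. B\<^sup>2) x"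
        using Z_nonneg Z_B by (intro P_pow_mono bounded_borel_power bounded_borel_Z bounded_borel_const power_mono)
      then have "(P ^^ n) (\<lambda>z. (Z z)\<^sup>2) x \<le> B\<^sup>2" by simp
      moreover have "(\<Sum>k<n. (P ^^ k) (\<lambda>z. Z z * g z) x) \<le> (\<Sum>k<n. B * (P ^^ k) g x)"
      proof (rule sum_mono)
        fix k
        have "(P ^^ k) (\<lambda>z. Z z * g z) x \<le> (P ^^ k) (\<lambda>z. B * g z) x"
          using Z_B g_nonneg by (intro P_pow_mono bounded_borel_mult bounded_borel_cmult bounded_borel_Z bounded_borel_g mult_right_mono)
        then show "(P ^^ k) (\<lambda>z. Z z * g z) x \<le> B * (P ^^ k) g x" by (simp only: P_pow_cmult)
      qed
      moreover have "(\<Sum>k<n. B * (P ^^ k) g x) = B * Zn n x" by (simp only: partial_pot_def sum_distrib_left)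
      ultimately show ?thesis unfolding sum_P_pow_\<Gamma>_Z using zero_le_power2[of "Z x"] by linarith
    qed
    finally show ?thesis by (simp add: s_def algebra_simps)
  qed
  have s0: "(s n \<longlongrightarrow> 0) at_bot" for n
  proof -
    have sq: "((\<lambda>x. (Zn k x)\<^sup>2) \<longlongrightarrow> 0) at_bot" for k
      using tendsto_power[OF Zn_tendsto_at_bot, of k 2] by simp
    have "((\<lambda>x. P (\<lambda>z. (Zn k z)\<^sup>2) x) \<longlongrightarrow> 0) at_bot" for k
      by (intro P_tendsto_at_bot sq bounded_borel_power bounded_borel_Zn)
    then have "(s n \<longlongrightarrow> 4 * B * 0 + 4 * (\<Sum>k<n. 0 + 0)) at_bot"
      unfolding s_def by (intro tendsto_intros Zn_tendsto_at_bot sq)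
    then show ?thesis by simp
  qed
  \<comment> \<open>n r must exceed 2 B^2 together with the error \<open>s n x\<close>, which will
    be below 1.\<close>
  obtain n :: nat where n: "(2 * B\<^sup>2 + 1) / r < of_nat n" using reals_Archimedean2 by blast
  have n': "2 * B\<^sup>2 + 1 < of_nat n * r" using n r by (simp add: field_simps)
  have "\<forall>\<^sub>F x in at_bot. s n x < 1" using s0 by (rule order_tendstoD) simp
  then show "\<forall>\<^sub>F x in at_bot. dist (\<Gamma> Z x) 0 < r"
  proof eventually_elim
    case (elim x)
    then have "of_nat n * \<Gamma> Z x < of_nat n * r" using main[of n x] n' by linarith
    then have "\<Gamma> Z x < r" by (simp add: mult_less_cancel_left)
    then show ?case using \<Gamma>_nonneg[of Z x] by simp
  qed
qed

text \<open>
  The asymptotic periods of the potential form a closed group containing the support of \<open>M\<close>, hence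
  the whole line unless \<open>M\<close> lives on a lattice.
\<close>

definition flat :: "real set" where
  "flat = {c. ((\<lambda>x. Z (x + c) - Z x) \<longlongrightarrow> 0) at_bot}"

lemma flat_diff: "c \<in> flat \<Longrightarrow> d \<in> flat \<Longrightarrow> c - d \<in> flat"
proof -
  assume cd: "c \<in> flat" "d \<in> flat"
  then have "((\<lambda>x. (Z (x + c) - Z x) - (Z (x + d) - Z x)) \<longlongrightarrow> 0 - 0) at_bot"
    unfolding flat_def by (intro tendsto_diff) auto
  from tendsto_shift_at_bot[OF this, of "- d"] show ?thesis by (simp add: flat_def algebra_simps)
qed

text \<open>The Lipschitz constant of Z does not depend on the position, so a period within
  \<epsilon> of c leaves an error of at most C \<epsilon> everywhere.\<close>

lemma flat_closed:
  assumes "\<And>\<epsilon>. 0 < \<epsilon> \<Longrightarrow> \<exists>d\<in>flat. \<bar>c - d\<bar> < \<epsilon>" shows "c \<in> flat"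
  unfolding flat_def
proof (safe, rule tendstoI)
  fix r :: real assume r: "0 < r"
  obtain C where C: "0 \<le> C" "\<And>x \<delta>. \<bar>\<delta>\<bar> \<le> 1 \<Longrightarrow> \<bar>Z (x + \<delta>) - Z x\<bar> \<le> C * \<bar>\<delta>\<bar>"
    using Z_lipschitz by metis
  obtain \<epsilon> where \<epsilon>: "0 < \<epsilon>" "\<epsilon> \<le> 1" "C * \<epsilon> \<le> r / 2"
    using small_step[OF C(1) r] by metis
  obtain d where d: "d \<in> flat" "\<bar>c - d\<bar> < \<epsilon>" using assms[OF \<epsilon>(1)] by blast
  have "\<forall>\<^sub>F x in at_bot. \<bar>Z (x + d) - Z x\<bar> < r / 2"
    using tendstoD[of "\<lambda>x. Z (x + d) - Z x" 0 at_bot "r / 2"] d r by (simp add: flat_def)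
  then show "\<forall>\<^sub>F x in at_bot. dist (Z (x + c) - Z x) 0 < r"
  proof eventually_elim
    case (elim x)
    have "\<bar>Z ((x + d) + (c - d)) - Z (x + d)\<bar> \<le> C * \<bar>c - d\<bar>" using d \<epsilon> by (intro C) simp
    also have "\<dots> \<le> C * \<epsilon>" using d C by (intro mult_left_mono) auto
    finally have "\<bar>Z (x + c) - Z (x + d)\<bar> \<le> C * \<epsilon>" by simp
    then show ?case using elim \<epsilon>(3) unfolding dist_real_def by linarith
  qed
qed

text \<open>If Z (x + c) differs from Z x by r or more, then by the Lipschitz bound every step
  within \<epsilon> of c still changes Z by at least r/2. These steps alone contribute (r/2)^2 p to
  the energy at x, which tends to 0.\<close>

lemma support_flat:
  assumes supp: "\<And>\<epsilon>. 0 < \<epsilon> \<Longrightarrow> 0 < prob {c - \<epsilon><..<c + \<epsilon>}" shows "c \<in> flat"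
  unfolding flat_def
proof (safe, rule tendstoI)
  fix r :: real assume r: "0 < r"
  obtain C where C: "0 \<le> C" "\<And>x \<delta>. \<bar>\<delta>\<bar> \<le> 1 \<Longrightarrow> \<bar>Z (x + \<delta>) - Z x\<bar> \<le> C * \<bar>\<delta>\<bar>"
    using Z_lipschitz by metis
  obtain \<epsilon> where \<epsilon>: "0 < \<epsilon>" "\<epsilon> \<le> 1" "C * \<epsilon> \<le> r / 2"
    using small_step[OF C(1) r] by metis
  define p where "p = prob {c - \<epsilon><..<c + \<epsilon>}"
  have p: "0 < p" unfolding p_def by (rule supp[OF \<epsilon>(1)])
  have "\<forall>\<^sub>F x in at_bot. \<Gamma> Z x < (r / 2)\<^sup>2 * p"
    using \<Gamma>_Z_tendsto by (rule order_tendstoD) (use r p in simp)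
  then show "\<forall>\<^sub>F x in at_bot. dist (Z (x + c) - Z x) 0 < r"
  proof eventually_elim
    case (elim x)
    show ?case
    proof (rule ccontr)
      assume "\<not> dist (Z (x + c) - Z x) 0 < r"
      then have far: "r \<le> \<bar>Z (x + c) - Z x\<bar>" by (simp add: dist_real_def)
      have "(r / 2)\<^sup>2 * p = (\<integral>y. (r / 2)\<^sup>2 * indicator {c - \<epsilon><..<c + \<epsilon>} y \<partial>M)"
        by (simp add: p_def)
      also have "\<dots> \<le> \<Gamma> Z x"
        unfolding \<Gamma>_def
      proof (rule integral_mono)
        show "integrable M (\<lambda>y. (Z (x + y) - Z x)\<^sup>2)"
          using integrable_shift[OF bounded_borel_increment[OF bounded_borel_Z]] .
        show "integrable M (\<lambda>y. (r / 2)\<^sup>2 * indicator {c - \<epsilon><..<c + \<epsilon>} y)"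
          by (intro integrable_mult_right integrable_real_indicator) (auto simp: less_top[symmetric])
        fix y
        show "(r / 2)\<^sup>2 * indicator {c - \<epsilon><..<c + \<epsilon>} y \<le> (Z (x + y) - Z x)\<^sup>2"
        proof (cases "y \<in> {c - \<epsilon><..<c + \<epsilon>}")
          case True
          then have y: "\<bar>y - c\<bar> < \<epsilon>" by auto
          have "\<bar>Z ((x + c) + (y - c)) - Z (x + c)\<bar> \<le> C * \<bar>y - c\<bar>" using y \<epsilon> by (intro C) simp
          also have "\<dots> \<le> C * \<epsilon>" using y C by (intro mult_left_mono) auto
          finally have "\<bar>Z (x + y) - Z (x + c)\<bar> \<le> C * \<epsilon>" by simp
          then have "\<bar>r / 2\<bar> \<le> \<bar>Z (x + y) - Z x\<bar>" using far \<epsilon>(3) r by linarith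
          then show ?thesis using True by (simp only: abs_le_square_iff) simp
        qed simp
      qed
      finally show False using elim by simp
    qed
  qed
qed

lemma Z_increment_tendsto:
  assumes nonlattice: "\<And>d. 0 < d \<Longrightarrow> prob (range (\<lambda>k::int. d * of_int k)) \<noteq> 1"
  shows "((\<lambda>x. Z (x + c) - Z x) \<longlongrightarrow> 0) at_bot"
proof -
  have zero: "0 \<in> flat" by (simp add: flat_def)
  have "c \<in> flat"
  proof (rule real_subgroup_cases[OF zero flat_diff])
    fix d :: real assume 1: "0 < d" "flat \<subseteq> range (\<lambda>k::int. d * of_int k)"
    \<comment> \<open>Points outside the support have null neighbourhoods; rational endpoints make
      them countably many, so their union is null although uncountably many points are
      covered.\<close>
    define J where "J = {(p, q). p \<in> \<rat> \<and> q \<in> \<rat> \<and> prob {p<..<q::real} = 0}"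
    have "countable J"
      by (rule countable_subset[of _ "\<rat> \<times> \<rat>"]) (auto simp: J_def countable_rat)
    then have null: "(\<Union>(p, q)\<in>J. {p<..<q}) \<in> null_sets M"
      by (intro null_sets_UN') (auto simp: J_def null_sets_def emeasure_eq_measure)
    have sub: "- range (\<lambda>k::int. d * of_int k) \<subseteq> (\<Union>(p, q)\<in>J. {p<..<q})"
    proof
      fix y assume "y \<in> - range (\<lambda>k::int. d * of_int k)"
      then have "y \<notin> flat" using 1 by auto
      then obtain \<epsilon> where \<epsilon>: "0 < \<epsilon>" "\<not> 0 < prob {y - \<epsilon><..<y + \<epsilon>}" using support_flat by blast
      obtain p q where pq: "p \<in> \<rat>" "y - \<epsilon> < p" "p < y" "q \<in> \<rat>" "y < q" "q < y + \<epsilon>"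
        using Rats_dense_in_real[of "y - \<epsilon>" y] Rats_dense_in_real[of y "y + \<epsilon>"] \<epsilon> by auto
      have "prob {p<..<q} \<le> prob {y - \<epsilon><..<y + \<epsilon>}" using pq by (intro finite_measure_mono) auto
      then have "prob {p<..<q} = 0" using \<epsilon> measure_nonneg[of M "{p<..<q}"] by linarith
      then show "y \<in> (\<Union>(p, q)\<in>J. {p<..<q})" using pq by (intro UN_I[of "(p, q)"]) (auto simp: J_def)
    qed
    have meas: "range (\<lambda>k::int. d * of_int k) \<in> sets borel"
      by (rule sets.countable[OF _ countable_image[OF countableI_type]]) simp
    have "- range (\<lambda>k::int. d * of_int k) \<in> null_sets M"
      using borel_comp[OF meas] by (intro null_sets_subset[OF null _ sub]) simp
    then have "prob (space M - range (\<lambda>k::int. d * of_int k)) = 0"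
      by (simp add: null_sets_def measure_def Compl_eq_Diff_UNIV)
    then have "prob (range (\<lambda>k::int. d * of_int k)) = 1"
      using prob_compl[of "range (\<lambda>k::int. d * of_int k)"] meas by simp
    with nonlattice[OF 1(1)] show "c \<in> flat" by simp
  next
    assume "\<And>x \<epsilon>. 0 < \<epsilon> \<Longrightarrow> \<exists>y\<in>flat. \<bar>x - y\<bar> < \<epsilon>"
    then show "c \<in> flat" by (intro flat_closed)
  qed
  then show ?thesis by (simp add: flat_def)
qed

end

section \<open>The integrated renewal equation\<close>

lemma nn_integral_lborel_shift:
  assumes [measurable]: "f \<in> borel_measurable borel"
  shows "(\<integral>\<^sup>+s. f (s + c) \<partial>lborel) = (\<integral>\<^sup>+s. f s \<partial>(lborel :: real measure))"
  using nn_integral_real_affine[of f 1 c] by (simp add: ac_simps)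

context random_walk
begin

definition upper_integral :: "(real \<Rightarrow> real) \<Rightarrow> real \<Rightarrow> ennreal" where
  "upper_integral f x = (\<integral>\<^sup>+s. ennreal (f (x + s)) * indicator {0..} s \<partial>lborel)"

lemma ennreal_P:
  assumes "bounded_borel f" "\<And>x. 0 \<le> f x"
  shows "ennreal (P f x) = (\<integral>\<^sup>+y. ennreal (f (x + y)) \<partial>M)"
  unfolding P_def using assms by (intro nn_integral_eq_integral[symmetric] integrable_shift) auto

lemma upper_integral_P:
  assumes f: "bounded_borel f" "\<And>x. 0 \<le> f x"
  shows "upper_integral (P f) x = (\<integral>\<^sup>+y. upper_integral f (x + y) \<partial>M)"
proof -
  interpret lborel_M: pair_sigma_finite lborel M ..
  have [measurable]: "f \<in> borel_measurable borel" using f by (simp add: bounded_borel_def)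
  have "upper_integral (P f) x = (\<integral>\<^sup>+s. (\<integral>\<^sup>+y. ennreal (f (x + y + s)) * indicator {0..} s \<partial>M) \<partial>lborel)"
    unfolding upper_integral_def ennreal_P[OF f]
    by (intro nn_integral_cong, subst nn_integral_multc[symmetric]) (auto simp: add_ac)
  also have "\<dots> = (\<integral>\<^sup>+y. (\<integral>\<^sup>+s. ennreal (f (x + y + s)) * indicator {0..} s \<partial>lborel) \<partial>M)"
    by (rule lborel_M.Fubini'[symmetric]) measurable
  finally show ?thesis by (simp add: upper_integral_def)
qed

lemma measurable_prob_atMost [measurable]: "(\<lambda>s. prob {..s}) \<in> borel_measurable borel"
  by (rule borel_measurable_mono) (auto simp: mono_def intro: finite_measure_mono)

lemma prob_greaterThan: "prob {s<..} = 1 - prob {..s}"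
  using prob_compl[of "{..s}"] by (simp add: Compl_eq_Diff_UNIV[symmetric])

lemma measurable_prob_greaterThan [measurable]: "(\<lambda>s. prob {s<..}) \<in> borel_measurable borel"
  unfolding prob_greaterThan by measurable

text \<open>
  This is \<open>H - P H\<close>, where \<open>H\<close> is the convolution of \<open>f\<close> with the indicator of the half line, with
  the negative terms moved to the other side.
\<close>

lemma ladder_identity:
  assumes f: "bounded_borel f" "\<And>x. 0 \<le> f x"
  shows "(\<integral>\<^sup>+s. ennreal (f (x + s)) * (ennreal (prob {s<..}) * indicator {0..} s) \<partial>lborel) + upper_integral (P f) x
    = (\<integral>\<^sup>+s. ennreal (f (x + s)) * (ennreal (prob {..s}) * indicator {..<0} s) \<partial>lborel) + upper_integral f x"
proof -
  interpret lborel_M: pair_sigma_finite lborel M ..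
  have [measurable]: "f \<in> borel_measurable borel" using f by (simp add: bounded_borel_def)
  have "upper_integral (P f) x = (\<integral>\<^sup>+y. (\<integral>\<^sup>+s. ennreal (f (x + y + s)) * indicator {0..} s \<partial>lborel) \<partial>M)"
    using upper_integral_P[OF f] by (simp add: upper_integral_def)
  also have "\<dots> = (\<integral>\<^sup>+y. (\<integral>\<^sup>+s. ennreal (f (x + s)) * indicator {y..} s \<partial>lborel) \<partial>M)"
  proof (rule nn_integral_cong)
    fix y
    have "(\<integral>\<^sup>+s. ennreal (f (x + (s + y))) * indicator {y..} (s + y) \<partial>lborel) = (\<integral>\<^sup>+s. ennreal (f (x + s)) * indicator {y..} s \<partial>lborel)"
      by (rule nn_integral_lborel_shift) measurable
    then show "(\<integral>\<^sup>+s. ennreal (f (x + y + s)) * indicator {0..} s \<partial>lborel) = (\<integral>\<^sup>+s. ennreal (f (x + s)) * indicator {y..} s \<partial>lborel)"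
      by (simp add: ac_simps indicator_def)
  qed
  also have "\<dots> = (\<integral>\<^sup>+s. (\<integral>\<^sup>+y. ennreal (f (x + s)) * indicator {..s} y \<partial>M) \<partial>lborel)"
  proof (subst lborel_M.Fubini'[symmetric])
    show "(\<integral>\<^sup>+y. (\<integral>\<^sup>+s. ennreal (f (x + s)) * indicator {y..} s \<partial>lborel) \<partial>M) = (\<integral>\<^sup>+y. (\<integral>\<^sup>+s. ennreal (f (x + s)) * indicator {..s} y \<partial>lborel) \<partial>M)"
      by (intro nn_integral_cong) (auto simp: indicator_def)
  qed (simp add: indicator_def)
  also have "\<dots> = (\<integral>\<^sup>+s. ennreal (f (x + s)) * ennreal (prob {..s}) \<partial>lborel)"
    by (simp add: nn_integral_cmult emeasure_eq_measure)
  finally have PH: "upper_integral (P f) x = (\<integral>\<^sup>+s. ennreal (f (x + s)) * ennreal (prob {..s}) \<partial>lborel)" .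
  \<comment> \<open>For s >= 0 the two tail probabilities add up to 1; for s < 0 the weight
    \<open>prob {..s}\<close> occurs on both sides.\<close>
  show ?thesis
    unfolding PH unfolding upper_integral_def prob_greaterThan
    by (subst (1 2) nn_integral_add[symmetric])
       (auto intro!: nn_integral_cong simp: indicator_def distrib_left[symmetric] simp flip: ennreal_plus)
qed

lemma nn_integral_tail_pos:
  "(\<integral>\<^sup>+s. ennreal (prob {s<..}) * indicator {0..} s \<partial>lborel) = (\<integral>\<^sup>+y. ennreal (max y 0) \<partial>M)"
proof -
  interpret lborel_M: pair_sigma_finite lborel M ..
  have "(\<integral>\<^sup>+s. ennreal (prob {s<..}) * indicator {0..} s \<partial>lborel) = (\<integral>\<^sup>+s. (\<integral>\<^sup>+y. indicator {s<..} y * indicator {0..} s \<partial>M) \<partial>lborel)"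
    by (simp add: nn_integral_multc emeasure_eq_measure)
  also have "\<dots> = (\<integral>\<^sup>+y. (\<integral>\<^sup>+s. indicator {s<..} y * indicator {0..} s \<partial>lborel) \<partial>M)"
    by (rule lborel_M.Fubini'[symmetric]) (simp add: indicator_def)
  also have "\<dots> = (\<integral>\<^sup>+y. (\<integral>\<^sup>+s. indicator {0..<y} s \<partial>lborel) \<partial>M)"
    by (intro nn_integral_cong) (auto simp: indicator_def)
  also have "\<dots> = (\<integral>\<^sup>+y. ennreal (max y 0) \<partial>M)"
    by (intro nn_integral_cong) (auto simp: max_def ennreal_neg)
  finally show ?thesis .
qed

lemma nn_integral_tail_neg:
  "(\<integral>\<^sup>+s. ennreal (prob {..s}) * indicator {..<0} s \<partial>lborel) = (\<integral>\<^sup>+y. ennreal (max (- y) 0) \<partial>M)"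
proof -
  interpret lborel_M: pair_sigma_finite lborel M ..
  have "(\<integral>\<^sup>+s. ennreal (prob {..s}) * indicator {..<0} s \<partial>lborel) = (\<integral>\<^sup>+s. (\<integral>\<^sup>+y. indicator {..s} y * indicator {..<0} s \<partial>M) \<partial>lborel)"
    by (simp add: nn_integral_multc emeasure_eq_measure)
  also have "\<dots> = (\<integral>\<^sup>+y. (\<integral>\<^sup>+s. indicator {..s} y * indicator {..<0} s \<partial>lborel) \<partial>M)"
    by (rule lborel_M.Fubini'[symmetric]) (simp add: indicator_def)
  also have "\<dots> = (\<integral>\<^sup>+y. (\<integral>\<^sup>+s. indicator {y..<0} s \<partial>lborel) \<partial>M)"
    by (intro nn_integral_cong) (auto simp: indicator_def)
  also have "\<dots> = (\<integral>\<^sup>+y. ennreal (max (- y) 0) \<partial>M)"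
    by (intro nn_integral_cong) (auto simp: max_def ennreal_neg)
  finally show ?thesis .
qed

end

section \<open>The renewal identity for potentials\<close>

context test_function
begin

definition g_upper :: "real \<Rightarrow> real" where "g_upper x = enn2real (upper_integral g x)"

lemma g_integral_finite: "(\<integral>\<^sup>+s. ennreal (g s) \<partial>lborel) < \<infinity>"
proof -
  have "(\<integral>\<^sup>+s. ennreal (g s) \<partial>lborel) \<le> (\<integral>\<^sup>+s. ennreal (L * \<bar>b - a + 1\<bar>) * indicator {a..b} s \<partial>lborel)"
  proof (rule nn_integral_mono)
    fix s show "ennreal (g s) \<le> ennreal (L * \<bar>b - a + 1\<bar>) * indicator {a..b} s"
      using g_le[of s] by (cases "s \<in> {a..b}") (auto simp: g_supp intro: ennreal_leI)
  qed
  also have "\<dots> = ennreal (L * \<bar>b - a + 1\<bar>) * ennreal (max 0 (b - a))"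
    by (subst nn_integral_cmult_indicator) (auto simp: emeasure_lborel_Icc_eq max_def)
  also have "\<dots> < \<infinity>" by (simp add: ennreal_mult_less_top)
  finally show ?thesis .
qed

lemma upper_integral_g_le: "upper_integral g x \<le> (\<integral>\<^sup>+s. ennreal (g s) \<partial>lborel)"
proof -
  note [measurable] = bounded_borel_measurable[OF bounded_borel_g]
  have "upper_integral g x \<le> (\<integral>\<^sup>+s. ennreal (g (s + x)) \<partial>lborel)"
    unfolding upper_integral_def by (intro nn_integral_mono) (auto simp: indicator_def ac_simps)
  also have "\<dots> = (\<integral>\<^sup>+s. ennreal (g s) \<partial>lborel)" by (rule nn_integral_lborel_shift) measurable
  finally show ?thesis .
qed

lemma upper_integral_g_eq:
  assumes "x \<le> a" shows "upper_integral g x = (\<integral>\<^sup>+s. ennreal (g s) \<partial>lborel)"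
proof -
  note [measurable] = bounded_borel_measurable[OF bounded_borel_g]
  have "upper_integral g x = (\<integral>\<^sup>+s. ennreal (g (s + x)) \<partial>lborel)"
    unfolding upper_integral_def
  proof (rule nn_integral_cong)
    fix s show "ennreal (g (x + s)) * indicator {0..} s = ennreal (g (s + x))"
      using assms g_supp[of "s + x"] by (cases "0 \<le> s") (auto simp: ac_simps)
  qed
  also have "\<dots> = (\<integral>\<^sup>+s. ennreal (g s) \<partial>lborel)" by (rule nn_integral_lborel_shift) measurable
  finally show ?thesis .
qed

lemma ennreal_g_upper: "ennreal (g_upper x) = upper_integral g x"
  unfolding g_upper_def using upper_integral_g_le[of x] g_integral_finite by (intro ennreal_enn2real) (simp add: le_less_trans)

lemma g_upper_nonneg: "0 \<le> g_upper x"
  by (simp add: g_upper_def)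

lemma bounded_borel_g_upper: "bounded_borel g_upper"
proof (rule bounded_borelI)
  note [measurable] = bounded_borel_measurable[OF bounded_borel_g]
  show "g_upper \<in> borel_measurable borel" unfolding g_upper_def upper_integral_def by measurable
  show "\<bar>g_upper x\<bar> \<le> enn2real (\<integral>\<^sup>+s. ennreal (g s) \<partial>lborel)" for x
    unfolding g_upper_def using upper_integral_g_le[of x] g_integral_finite by (simp add: enn2real_mono)
qed

lemma upper_integral_P_pow: "upper_integral ((P ^^ n) g) x = ennreal ((P ^^ n) g_upper x)"
proof (induction n arbitrary: x)
  case (Suc n)
  have "upper_integral ((P ^^ Suc n) g) x = (\<integral>\<^sup>+y. ennreal ((P ^^ n) g_upper (x + y)) \<partial>M)"
    using upper_integral_P[OF bounded_borel_P_pow[OF bounded_borel_g] P_pow_g_nonneg] Suc by simp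
  also have "\<dots> = ennreal (P ((P ^^ n) g_upper) x)"
    by (intro ennreal_P[symmetric] bounded_borel_P_pow bounded_borel_g_upper P_pow_nonneg g_upper_nonneg)
  finally show ?case by simp
qed (simp add: ennreal_g_upper)

lemma upper_integral_add:
  assumes f: "bounded_borel f" "\<And>x. 0 \<le> f x" and f': "bounded_borel f'" "\<And>x. 0 \<le> f' x"
  shows "upper_integral (\<lambda>x. f x + f' x) x = upper_integral f x + upper_integral f' x"
  using bounded_borel_measurable[OF f(1)] bounded_borel_measurable[OF f'(1)] f(2) f'(2)
  unfolding upper_integral_def by (subst nn_integral_add[symmetric]) (auto simp: distrib_right)

text \<open>Allows this term to be cancelled in \<open>ennreal\<close> below; it is the reason for
  working with partial potentials first.\<close>

lemma upper_integral_Zn_finite: "upper_integral (Zn n) x < \<infinity>"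
proof (induction n)
  case 0 then show ?case by (simp add: partial_pot_def upper_integral_def)
next
  case (Suc n)
  have "Zn (Suc n) = (\<lambda>x. Zn n x + (P ^^ n) g x)" by (simp add: partial_pot_def fun_eq_iff)
  then show ?case using Suc
    by (simp add: upper_integral_add bounded_borel_Zn Zn_nonneg bounded_borel_P_pow bounded_borel_g P_pow_g_nonneg upper_integral_P_pow)
qed

text \<open>\<open>Zn (Suc n)\<close> splits both as g + P (Zn n) and as Zn n + P^n g. Comparing the
  two eliminates the upper integral of P (Zn n) from the identity for f = \<open>Zn n\<close>, at
  the price of the remainder \<open>(P ^^ n) g_upper\<close>.\<close>

lemma ladder_identity_Zn:
  "(\<integral>\<^sup>+s. ennreal (Zn n (x + s)) * (ennreal (prob {s<..}) * indicator {0..} s) \<partial>lborel) + ennreal ((P ^^ n) g_upper x)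
    = (\<integral>\<^sup>+s. ennreal (Zn n (x + s)) * (ennreal (prob {..s}) * indicator {..<0} s) \<partial>lborel) + upper_integral g x"
  (is "?L + _ = ?R + _")
proof -
  note bd = bounded_borel_Zn Zn_nonneg bounded_borel_P_pow bounded_borel_P bounded_borel_g P_pow_g_nonneg g_nonneg
  have PZn_nonneg: "0 \<le> P (Zn n) x" for x
    using P_pow_nonneg[of "Zn n" 1 x] bd by simp
  have 1: "upper_integral (Zn (Suc n)) x = upper_integral g x + upper_integral (P (Zn n)) x"
  proof -
    have "Zn (Suc n) = (\<lambda>x. g x + P (Zn n) x)" by (simp add: P_Zn)
    then show ?thesis using PZn_nonneg bd by (simp add: upper_integral_add)
  qed
  have 2: "upper_integral (Zn (Suc n)) x = upper_integral (Zn n) x + ennreal ((P ^^ n) g_upper x)"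
  proof -
    have "Zn (Suc n) = (\<lambda>x. Zn n x + (P ^^ n) g x)" by (simp add: partial_pot_def fun_eq_iff)
    then show ?thesis using bd by (simp add: upper_integral_add upper_integral_P_pow)
  qed
  have 3: "?L + upper_integral (P (Zn n)) x = ?R + upper_integral (Zn n) x"
    by (rule ladder_identity) (auto intro: bd)
  have "upper_integral (Zn n) x + (?L + ennreal ((P ^^ n) g_upper x)) = ?L + (upper_integral (Zn n) x + ennreal ((P ^^ n) g_upper x))"
    by (simp only: ac_simps)
  also have "\<dots> = ?L + (upper_integral g x + upper_integral (P (Zn n)) x)" using 1 2 by (simp only:)
  also have "\<dots> = (?L + upper_integral (P (Zn n)) x) + upper_integral g x" by (simp only: ac_simps)
  also have "\<dots> = upper_integral (Zn n) x + (?R + upper_integral g x)" unfolding 3 by (simp only: ac_simps)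
  finally show ?thesis using upper_integral_Zn_finite[of n x] ennreal_add_left_cancel by fastforce
qed

text \<open>\<open>g_upper\<close> is bounded and vanishes above b, so the remainder is controlled
  by the probability that the walk is still below b after n steps.\<close>

lemma P_pow_g_upper_tendsto: "(\<lambda>n. (P ^^ n) g_upper x) \<longlonglongrightarrow> 0"
proof -
  obtain B where B: "0 \<le> B" "\<And>x. \<bar>g_upper x\<bar> \<le> B" using bounded_borel_g_upper by (metis bounded_borelE)
  have le: "g_upper x \<le> B * indicator {..b} x" for x
  proof (cases "x \<le> b")
    case True then show ?thesis using B(2)[of x] by simp
  next
    case False
    have "upper_integral g x = (\<integral>\<^sup>+s. 0 \<partial>(lborel :: real measure))"
      unfolding upper_integral_def
    proof (rule nn_integral_cong)
      fix s show "ennreal (g (x + s)) * indicator {0..} s = 0"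
        using False g_supp[of "x + s"] by (cases "0 \<le> s") auto
    qed
    then show ?thesis using False by (simp add: g_upper_def)
  qed
  have "(P ^^ n) g_upper x \<le> B * (P ^^ n) (indicator {..b}) x" for n
  proof -
    have "(P ^^ n) g_upper x \<le> (P ^^ n) (\<lambda>x. B * indicator {..b} x) x"
      by (intro P_pow_mono bounded_borel_g_upper bounded_borel_cmult bounded_borel_indicator le) simp
    then show ?thesis by (simp only: P_pow_cmult)
  qed
  moreover have "(\<lambda>n. B * (P ^^ n) (indicator {..b}) x) \<longlonglongrightarrow> 0"
    by (rule tendsto_mult_right_zero[OF P_pow_halfline_tendsto])
  ultimately show ?thesis
    using P_pow_nonneg[OF bounded_borel_g_upper g_upper_nonneg]
    by (intro tendsto_sandwich[of "\<lambda>_. 0" "\<lambda>n. (P ^^ n) g_upper x"]) auto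
qed

lemma Zn_nn_integral_tendsto:
  assumes [measurable]: "q \<in> borel_measurable borel" and fin: "\<And>s. q s < top"
  shows "(\<lambda>n. \<integral>\<^sup>+s. ennreal (Zn n (x + s)) * q s \<partial>lborel) \<longlonglongrightarrow> (\<integral>\<^sup>+s. ennreal (Z (x + s)) * q s \<partial>lborel)"
proof (rule nn_integral_LIMSEQ)
  note [measurable] = bounded_borel_measurable[OF bounded_borel_Zn]
  show "(\<lambda>s. ennreal (Zn i (x + s)) * q s) \<in> borel_measurable lborel" for i by measurable
  have "incseq (\<lambda>n. Zn n x)" for x
    by (rule incseq_SucI) (simp add: partial_pot_def P_pow_g_nonneg)
  then show "incseq (\<lambda>n s. ennreal (Zn n (x + s)) * q s)"
    by (auto simp: incseq_def le_fun_def intro!: mult_right_mono ennreal_leI)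
  show "(\<lambda>n. ennreal (Zn n (x + s)) * q s) \<longlonglongrightarrow> ennreal (Z (x + s)) * q s" for s
    unfolding mult.commute[of _ "q s"]
    by (intro ennreal_tendsto_cmult fin tendsto_ennrealI Zn_tendsto)
qed

lemma renewal_identity:
  "(\<integral>\<^sup>+s. ennreal (Z (x + s)) * (ennreal (prob {s<..}) * indicator {0..} s) \<partial>lborel)
    = (\<integral>\<^sup>+s. ennreal (Z (x + s)) * (ennreal (prob {..s}) * indicator {..<0} s) \<partial>lborel) + upper_integral g x"
proof -
  have "(\<lambda>n. (\<integral>\<^sup>+s. ennreal (Zn n (x + s)) * (ennreal (prob {s<..}) * indicator {0..} s) \<partial>lborel) + ennreal ((P ^^ n) g_upper x))
     \<longlonglongrightarrow> (\<integral>\<^sup>+s. ennreal (Z (x + s)) * (ennreal (prob {s<..}) * indicator {0..} s) \<partial>lborel) + ennreal 0"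
    by (intro tendsto_add Zn_nn_integral_tendsto tendsto_ennrealI P_pow_g_upper_tendsto)
       (measurable, simp add: indicator_def)
  moreover have "(\<lambda>n. (\<integral>\<^sup>+s. ennreal (Zn n (x + s)) * (ennreal (prob {..s}) * indicator {..<0} s) \<partial>lborel) + upper_integral g x)
     \<longlonglongrightarrow> (\<integral>\<^sup>+s. ennreal (Z (x + s)) * (ennreal (prob {..s}) * indicator {..<0} s) \<partial>lborel) + upper_integral g x"
    by (intro tendsto_add Zn_nn_integral_tendsto tendsto_const)
       (measurable, simp add: indicator_def)
  ultimately show ?thesis unfolding ladder_identity_Zn using LIMSEQ_unique by fastforce
qed

end

section \<open>Blackwell's renewal theorem\<close>

context test_function
begin

text \<open>Dominated convergence: under an integrable weight, asymptotic flatness lets Z (x + s) be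
  replaced by Z x.\<close>

lemma weighted_Z_tendsto:
  assumes nonlattice: "\<And>d. 0 < d \<Longrightarrow> prob (range (\<lambda>k::int. d * of_int k)) \<noteq> 1"
    and q: "integrable lborel q"
  shows "((\<lambda>x. (\<integral>s. Z (x + s) * q s \<partial>lborel) - Z x * (\<integral>s. q s \<partial>lborel)) \<longlongrightarrow> 0) at_bot"
proof (rule tendsto_at_botI_sequentially)
  fix X :: "nat \<Rightarrow> real" assume X: "filterlim X at_bot sequentially"
  obtain B where B: "0 \<le> B" "\<And>x. \<bar>Z x\<bar> \<le> B" using bounded_borel_Z by (metis bounded_borelE)
  note [measurable] = bounded_borel_measurable[OF bounded_borel_Z] borel_measurable_integrable[OF q]
  have int: "integrable lborel (\<lambda>s. Z (x + s) * q s)" for x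
  proof (rule Bochner_Integration.integrable_bound[OF integrable_mult_right[OF q, of B]])
    show "AE s in lborel. norm (Z (x + s) * q s) \<le> norm (B * q s)"
      using B by (auto simp: abs_mult intro!: mult_right_mono)
  qed measurable
  have "(\<lambda>n. \<integral>s. (Z (X n + s) - Z (X n)) * q s \<partial>lborel) \<longlonglongrightarrow> (\<integral>s. 0 \<partial>(lborel :: real measure))"
  proof (rule integral_dominated_convergence[where w="\<lambda>s. (2 * B) * \<bar>q s\<bar>"])
    show "integrable lborel (\<lambda>s. (2 * B) * \<bar>q s\<bar>)" using q by auto
    show "AE s in lborel. (\<lambda>n. (Z (X n + s) - Z (X n)) * q s) \<longlonglongrightarrow> 0"
      by (intro AE_I2 tendsto_mult_left_zero filterlim_compose[OF Z_increment_tendsto X] nonlattice)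
    show "AE s in lborel. norm ((Z (X n + s) - Z (X n)) * q s) \<le> (2 * B) * \<bar>q s\<bar>" for n
    proof (rule AE_I2)
      fix s
      have "\<bar>Z (X n + s) - Z (X n)\<bar> \<le> 2 * B" using B(2)[of "X n + s"] B(2)[of "X n"] by linarith
      then show "norm ((Z (X n + s) - Z (X n)) * q s) \<le> (2 * B) * \<bar>q s\<bar>" by (simp add: abs_mult mult_right_mono)
    qed
  qed measurable
  moreover have "(\<integral>s. (Z (x + s) - Z x) * q s \<partial>lborel) = (\<integral>s. Z (x + s) * q s \<partial>lborel) - Z x * (\<integral>s. q s \<partial>lborel)" for x
    using int[of x] q by (simp add: left_diff_distrib)
  ultimately show "(\<lambda>n. (\<integral>s. Z (X n + s) * q s \<partial>lborel) - Z (X n) * (\<integral>s. q s \<partial>lborel)) \<longlonglongrightarrow> 0" by simp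
qed

end

context positive_drift_walk
begin

definition mean_pos :: ennreal where "mean_pos = (\<integral>\<^sup>+y. ennreal (max y 0) \<partial>M)"

definition mean_neg :: ennreal where "mean_neg = (\<integral>\<^sup>+y. ennreal (max (- y) 0) \<partial>M)"

definition mean_inv :: real where
  "mean_inv = (if mean_pos = \<infinity> then 0 else 1 / (enn2real mean_pos - enn2real mean_neg))"

lemma mean_neg_eq: "mean_neg = ennreal (\<integral>y. max (- y) 0 \<partial>M)"
  unfolding mean_neg_def using neg_integrable by (intro nn_integral_eq_integral) auto

lemma mean_neg_finite: "mean_neg < \<infinity>"
  by (simp add: mean_neg_eq)

lemma mean_diff_pos:
  assumes "mean_pos < \<infinity>" shows "0 < enn2real mean_pos - enn2real mean_neg"
proof -
  have pos: "integrable M (\<lambda>y. max y 0)"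
    using assms unfolding mean_pos_def by (intro integrableI_nonneg) auto
  have mp: "mean_pos = ennreal (\<integral>y. max y 0 \<partial>M)"
    unfolding mean_pos_def using pos by (intro nn_integral_eq_integral) auto
  obtain K where K: "0 < K" "0 < (\<integral>y. min y K \<partial>M)" using ex_trunc by auto
  have "(\<integral>y. min y K \<partial>M) \<le> (\<integral>y. max y 0 - max (- y) 0 \<partial>M)"
    using K pos neg_integrable by (intro integral_mono integrable_min) auto
  also have "\<dots> = (\<integral>y. max y 0 \<partial>M) - (\<integral>y. max (- y) 0 \<partial>M)"
    using pos neg_integrable by simp
  finally show ?thesis using K by (simp add: mp mean_neg_eq)
qed

lemma mean_inv_nonneg: "0 \<le> mean_inv"
  using mean_diff_pos by (simp add: mean_inv_def less_top[symmetric] less_imp_le)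

end

context test_function
begin

definition g_total :: real where "g_total = enn2real (\<integral>\<^sup>+s. ennreal (g s) \<partial>lborel)"

text \<open>The weights p and q have total masses E X^+ and E X^-. With Z (x + s) replaced by Z x,
  the renewal identity reads Z x * (E X^+ - E X^-) = integral of g, up to o(1). If E X^+ is
  infinite, p is truncated: Z x times the truncated mass stays bounded, and that mass can be made
  arbitrarily large.\<close>

lemma Z_tendsto:
  assumes nonlattice: "\<And>d. 0 < d \<Longrightarrow> prob (range (\<lambda>k::int. d * of_int k)) \<noteq> 1"
  shows "(Z \<longlongrightarrow> g_total * mean_inv) at_bot"
proof -
  obtain B where B: "0 \<le> B" "\<And>x. \<bar>Z x\<bar> \<le> B" using bounded_borel_Z by (metis bounded_borelE)
  have Z_B: "Z x \<le> B" for x using B(2)[of x] by simp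
  note [measurable] = bounded_borel_measurable[OF bounded_borel_Z]
  define p where "p s = prob {s<..} * indicator {0..} s" for s :: real
  define q where "q s = prob {..s} * indicator {..<0} s" for s :: real
  have p_nonneg: "0 \<le> p s" and q_nonneg: "0 \<le> q s" for s by (auto simp: p_def q_def)
  have [measurable]: "p \<in> borel_measurable borel" "q \<in> borel_measurable borel"
    unfolding p_def q_def by measurable
  have ennreal_p: "ennreal (p s) = ennreal (prob {s<..}) * indicator {0..} s"
    and ennreal_q: "ennreal (q s) = ennreal (prob {..s}) * indicator {..<0} s" for s
    by (auto simp: p_def q_def indicator_def)
  have p_int: "(\<integral>\<^sup>+s. ennreal (p s) \<partial>lborel) = mean_pos"
    unfolding ennreal_p nn_integral_tail_pos mean_pos_def ..
  have q_int: "(\<integral>\<^sup>+s. ennreal (q s) \<partial>lborel) = mean_neg"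
    unfolding ennreal_q nn_integral_tail_neg mean_neg_def ..
  have q_integrable: "integrable lborel q"
    using mean_neg_finite q_nonneg unfolding q_int[symmetric] by (intro integrableI_nonneg) auto
  have Zw_integrable: "integrable lborel (\<lambda>s. Z (x + s) * r s)" if "integrable lborel r" for r x
  proof (rule Bochner_Integration.integrable_bound[OF integrable_mult_right[OF that, of B]])
    note [measurable] = borel_measurable_integrable[OF that]
    show "(\<lambda>s. Z (x + s) * r s) \<in> borel_measurable lborel" by measurable
    show "AE s in lborel. norm (Z (x + s) * r s) \<le> norm (B * r s)"
      using B by (auto simp: abs_mult intro!: mult_right_mono)
  qed
  have Zq_eq: "(\<integral>\<^sup>+s. ennreal (Z (x + s)) * ennreal (q s) \<partial>lborel) = ennreal (\<integral>s. Z (x + s) * q s \<partial>lborel)" for x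
    using Zw_integrable[OF q_integrable] Z_nonneg q_nonneg
    by (subst nn_integral_eq_integral[symmetric]) (auto simp: ennreal_mult)
  have identity: "(\<integral>\<^sup>+s. ennreal (Z (x + s)) * ennreal (p s) \<partial>lborel) = ennreal ((\<integral>s. Z (x + s) * q s \<partial>lborel) + g_total)"
    if "x \<le> a" for x
  proof -
    have "(\<integral>\<^sup>+s. ennreal (Z (x + s)) * ennreal (p s) \<partial>lborel) = ennreal (\<integral>s. Z (x + s) * q s \<partial>lborel) + ennreal g_total"
      unfolding ennreal_p renewal_identity unfolding ennreal_q[symmetric] Zq_eq upper_integral_g_eq[OF that] g_total_def
      using g_integral_finite by simp
    also have "\<dots> = ennreal ((\<integral>s. Z (x + s) * q s \<partial>lborel) + g_total)"
      using Z_nonneg q_nonneg by (intro ennreal_plus[symmetric]) (auto simp: g_total_def)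
    finally show ?thesis .
  qed
  have wt: "((\<lambda>x. (\<integral>s. Z (x + s) * r s \<partial>lborel) - Z x * (\<integral>s. r s \<partial>lborel)) \<longlongrightarrow> 0) at_bot"
    if "integrable lborel r" for r
    using nonlattice that by (rule weighted_Z_tendsto)
  show ?thesis
  proof (cases "mean_pos = \<infinity>")
    case False
    then have fin: "mean_pos < \<infinity>" by (simp add: less_top)
    have p_integrable: "integrable lborel p"
      using fin p_nonneg unfolding p_int[symmetric] by (intro integrableI_nonneg) auto
    define m where "m = enn2real mean_pos - enn2real mean_neg"
    have m: "0 < m" unfolding m_def by (rule mean_diff_pos[OF fin])
    have ip: "(\<integral>s. p s \<partial>lborel) = enn2real mean_pos"
      unfolding p_int[symmetric] using p_integrable p_nonneg by (subst nn_integral_eq_integral) auto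
    have iq: "(\<integral>s. q s \<partial>lborel) = enn2real mean_neg"
      unfolding q_int[symmetric] using q_integrable q_nonneg by (subst nn_integral_eq_integral) auto
    have real_id: "(\<integral>s. Z (x + s) * p s \<partial>lborel) = (\<integral>s. Z (x + s) * q s \<partial>lborel) + g_total" if "x \<le> a" for x
    proof -
      have "ennreal (\<integral>s. Z (x + s) * p s \<partial>lborel) = (\<integral>\<^sup>+s. ennreal (Z (x + s)) * ennreal (p s) \<partial>lborel)"
        using Zw_integrable[OF p_integrable] Z_nonneg p_nonneg
        by (subst nn_integral_eq_integral[symmetric]) (auto simp: ennreal_mult)
      also note identity[OF that]
      finally show ?thesis using Z_nonneg q_nonneg p_nonneg
        by (subst (asm) ennreal_inj) (auto simp: g_total_def)
    qed
    have "((\<lambda>x. ((\<integral>s. Z (x + s) * p s \<partial>lborel) - Z x * (\<integral>s. p s \<partial>lborel))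
        - ((\<integral>s. Z (x + s) * q s \<partial>lborel) - Z x * (\<integral>s. q s \<partial>lborel))) \<longlongrightarrow> 0 - 0) at_bot"
      by (intro tendsto_diff wt p_integrable q_integrable)
    moreover have "\<forall>\<^sub>F x in at_bot. ((\<integral>s. Z (x + s) * p s \<partial>lborel) - Z x * (\<integral>s. p s \<partial>lborel))
        - ((\<integral>s. Z (x + s) * q s \<partial>lborel) - Z x * (\<integral>s. q s \<partial>lborel)) = g_total - Z x * m"
      using eventually_le_at_bot[of a]
    proof eventually_elim
      case (elim x)
      show ?case unfolding real_id[OF elim] ip iq m_def by (simp add: algebra_simps)
    qed
    ultimately have "((\<lambda>x. g_total - Z x * m) \<longlongrightarrow> 0 - 0) at_bot" by (rule Lim_transform_eventually)
    then have "((\<lambda>x. (g_total - (g_total - Z x * m)) * (1 / m)) \<longlongrightarrow> (g_total - (0 - 0)) * (1 / m)) at_bot"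
      by (rule tendsto_mult[OF tendsto_diff[OF tendsto_const] tendsto_const])
    then show ?thesis using m False by (simp add: mean_inv_def m_def)
  next
    case True
    \<comment> \<open>A bound independent of the truncation level: the right side of the identity is
      at most B times the mass of q plus \<open>g_total\<close>, and the 1 pays for replacing Z (x +
      s) by Z x.\<close>
    define C where "C = B * (\<integral>s. q s \<partial>lborel) + g_total + 1"
    have C: "0 < C" using B q_nonneg unfolding C_def
      by (intro add_nonneg_pos add_nonneg_nonneg mult_nonneg_nonneg) (auto simp: g_total_def)
    have ub: "Z x * (\<integral>s. p s * indicator {..N} s \<partial>lborel) \<le> (\<integral>s. Z (x + s) * (p s * indicator {..N} s) \<partial>lborel) + 1 \<Longrightarrow>
        x \<le> a \<Longrightarrow> Z x * (\<integral>s. p s * indicator {..N} s \<partial>lborel) \<le> C"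
      if pN: "integrable lborel (\<lambda>s. p s * indicator {..N} s)" for x N
    proof -
      assume le: "Z x * (\<integral>s. p s * indicator {..N} s \<partial>lborel) \<le> (\<integral>s. Z (x + s) * (p s * indicator {..N} s) \<partial>lborel) + 1" and x: "x \<le> a"
      have "ennreal (\<integral>s. Z (x + s) * (p s * indicator {..N} s) \<partial>lborel) = (\<integral>\<^sup>+s. ennreal (Z (x + s) * (p s * indicator {..N} s)) \<partial>lborel)"
        using Zw_integrable[OF pN] Z_nonneg p_nonneg by (intro nn_integral_eq_integral[symmetric]) auto
      also have "\<dots> \<le> (\<integral>\<^sup>+s. ennreal (Z (x + s)) * ennreal (p s) \<partial>lborel)"
        using Z_nonneg p_nonneg by (intro nn_integral_mono) (auto simp: indicator_def ennreal_mult)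
      also note identity[OF x]
      finally have "(\<integral>s. Z (x + s) * (p s * indicator {..N} s) \<partial>lborel) \<le> (\<integral>s. Z (x + s) * q s \<partial>lborel) + g_total"
        using Z_nonneg q_nonneg by (subst (asm) ennreal_le_iff) (auto simp: g_total_def)
      moreover have "(\<integral>s. Z (x + s) * q s \<partial>lborel) \<le> (\<integral>s. B * q s \<partial>lborel)"
        using Zw_integrable[OF q_integrable] q_integrable Z_B q_nonneg by (intro integral_mono mult_right_mono) auto
      ultimately show ?thesis using le by (simp add: C_def)
    qed
    have "(Z \<longlongrightarrow> 0) at_bot"
    proof (rule tendstoI)
      fix r :: real assume r: "0 < r"
      have pN: "integrable lborel (\<lambda>s. p s * indicator {..N} s)" for N :: real
      proof (rule Bochner_Integration.integrable_bound)
        show "integrable lborel (indicator {0..N} :: real \<Rightarrow> real)"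
          by (rule integrable_real_indicator) (auto simp: emeasure_lborel_Icc_eq)
        show "AE s in lborel. norm (p s * indicator {..N} s) \<le> norm (indicator {0..N} s :: real)"
          by (auto simp: p_def indicator_def)
      qed measurable
      have "(\<lambda>n. \<integral>\<^sup>+s. ennreal (p s) * indicator {..real n} s \<partial>lborel) \<longlonglongrightarrow> (\<integral>\<^sup>+s. ennreal (p s) \<partial>lborel)"
      proof (rule nn_integral_LIMSEQ)
        show "incseq (\<lambda>n s. ennreal (p s) * indicator {..real n} s)"
          by (auto simp: incseq_def le_fun_def indicator_def)
        show "(\<lambda>n. ennreal (p s) * indicator {..real n} s) \<longlonglongrightarrow> ennreal (p s)" for s
        proof (rule Lim_transform_eventually[OF tendsto_const])
          obtain n0 :: nat where "s \<le> real n0" using real_arch_simple by blast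
          then show "\<forall>\<^sub>F n in sequentially. ennreal (p s) = ennreal (p s) * indicator {..real n} s"
            by (auto simp: eventually_sequentially indicator_def intro!: exI[of _ n0])
        qed
      qed measurable
      then have "(\<lambda>n. \<integral>\<^sup>+s. ennreal (p s) * indicator {..real n} s \<partial>lborel) \<longlonglongrightarrow> \<infinity>"
        unfolding p_int True .
      then have "\<forall>\<^sub>F n in sequentially. ennreal (C / r) < (\<integral>\<^sup>+s. ennreal (p s) * indicator {..real n} s \<partial>lborel)"
        by (rule order_tendstoD) simp
      then obtain n where "ennreal (C / r) < (\<integral>\<^sup>+s. ennreal (p s) * indicator {..real n} s \<partial>lborel)"
        by (auto simp: eventually_sequentially)
      also have "\<dots> = ennreal (\<integral>s. p s * indicator {..real n} s \<partial>lborel)"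
        using pN p_nonneg by (subst nn_integral_eq_integral[symmetric]) (auto simp: indicator_def intro!: nn_integral_cong)
      finally have n: "C / r < (\<integral>s. p s * indicator {..real n} s \<partial>lborel)"
        using C r by (simp add: ennreal_less_iff)
      define I where "I = (\<integral>s. p s * indicator {..real n} s \<partial>lborel)"
      have I: "0 < I" "C < r * I" using n C r unfolding I_def[symmetric] by (auto simp: field_simps intro: less_trans[of _ "C / r"])
      have "\<forall>\<^sub>F x in at_bot. - 1 < (\<integral>s. Z (x + s) * (p s * indicator {..real n} s) \<partial>lborel) - Z x * I"
        using wt[OF pN[of "real n"]] unfolding I_def by (rule order_tendstoD) simp
      with eventually_le_at_bot[of a] show "\<forall>\<^sub>F x in at_bot. dist (Z x) 0 < r"
      proof eventually_elim
        case (elim x)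
        have "Z x * I \<le> C" unfolding I_def
          by (rule ub[OF pN]) (use elim in \<open>simp_all add: I_def\<close>)
        then have "Z x * I < r * I" using I by linarith
        then show ?case using I Z_nonneg[of x] by (simp add: mult_less_cancel_right)
      qed
    qed
    then show ?thesis using True by (simp add: mean_inv_def)
  qed
qed

end

section \<open>From Lipschitz functions to intervals\<close>

definition trapezoid :: "real \<Rightarrow> real \<Rightarrow> real \<Rightarrow> real \<Rightarrow> real" where
  "trapezoid p q \<epsilon> x = max 0 (min 1 (min ((x - p) / \<epsilon>) ((q - x) / \<epsilon>)))"

lemma trapezoid_le:
  assumes "0 < \<epsilon>" shows "trapezoid p q \<epsilon> x \<le> indicator {p<..<q} x"
proof (cases "x \<in> {p<..<q}")
  case False
  then have "(x - p) / \<epsilon> \<le> 0 \<or> (q - x) / \<epsilon> \<le> 0" using assms by (auto simp: divide_le_0_iff)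
  then have "trapezoid p q \<epsilon> x \<le> 0" unfolding trapezoid_def by linarith
  with False show ?thesis by simp
qed (simp add: trapezoid_def)

lemma trapezoid_ge:
  assumes "0 < \<epsilon>" shows "indicator {p + \<epsilon>..q - \<epsilon>} x \<le> trapezoid p q \<epsilon> x"
proof (cases "x \<in> {p + \<epsilon>..q - \<epsilon>}")
  case True
  then have "1 \<le> (x - p) / \<epsilon>" "1 \<le> (q - x) / \<epsilon>" using assms by (auto simp: le_divide_eq)
  with True show ?thesis by (simp add: trapezoid_def)
qed (simp add: trapezoid_def)

lemma trapezoid_lipschitz:
  assumes "0 < \<epsilon>" shows "\<bar>trapezoid p q \<epsilon> x - trapezoid p q \<epsilon> y\<bar> \<le> (1 / \<epsilon>) * \<bar>x - y\<bar>"
proof -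
  have "(x - p) / \<epsilon> - (y - p) / \<epsilon> = (1 / \<epsilon>) * (x - y)" "(q - y) / \<epsilon> - (q - x) / \<epsilon> = (1 / \<epsilon>) * (x - y)"
    by (simp_all add: diff_divide_distrib)
  moreover have "\<bar>(1 / \<epsilon>) * (x - y)\<bar> = (1 / \<epsilon>) * \<bar>x - y\<bar>" using assms by (simp add: abs_mult)
  ultimately show ?thesis unfolding trapezoid_def by linarith
qed

context positive_drift_walk
begin

lemma test_function_trapezoid:
  assumes "0 < \<epsilon>" shows "test_function M (trapezoid p q \<epsilon>) p q (1 / \<epsilon>)"
proof unfold_locales
  show nonneg: "0 \<le> trapezoid p q \<epsilon> x" for x by (simp add: trapezoid_def)
  show "trapezoid p q \<epsilon> x = 0" if "x \<notin> {p..q}" for x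
    using trapezoid_le[OF assms, of p q x] nonneg[of x] that by (auto simp: indicator_def split: if_splits)
qed (rule trapezoid_lipschitz[OF assms])

abbreviation U :: "real \<Rightarrow> real \<Rightarrow> real" where
  "U h \<equiv> pot (indicator {0<..h})"

lemma dominated_interval: "dominated (indicator {0<..h})"
  unfolding dominated_def
  by (intro conjI exI[of _ 1] exI[of _ 0] exI[of _ h] bounded_borel_indicator) (auto simp: indicator_def)

text \<open>\<open>U h x\<close> is the renewal mass of (-x, h - x], so \<open>at_bot\<close> looks
  along the drift. The indicator lies between two trapezoids with ramps of width \<epsilon>, whose
  integrals differ from h by at most 2 \<epsilon>.\<close>

theorem blackwell:
  assumes nonlattice: "\<And>d. 0 < d \<Longrightarrow> prob (range (\<lambda>k::int. d * of_int k)) \<noteq> 1"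
    and h: "0 < h"
  shows "(U h \<longlongrightarrow> h * mean_inv) at_bot"
proof (rule tendstoI)
  fix r :: real assume r: "0 < r"
  obtain \<epsilon>0 where \<epsilon>0: "0 < \<epsilon>0" "mean_inv * \<epsilon>0 \<le> (r / 2) / 2"
    by (rule small_step[OF mean_inv_nonneg, of "r / 2"]) (use r in auto)
  \<comment> \<open>The bound h/4 keeps the inner plateau nonempty; \<epsilon>0 makes the error 2
    \<epsilon> * \<open>mean_inv\<close> at most r/2.\<close>
  define \<epsilon> where "\<epsilon> = min (h / 4) \<epsilon>0"
  have \<epsilon>: "0 < \<epsilon>" "\<epsilon> \<le> h / 4" "2 * \<epsilon> * mean_inv \<le> r / 2"
  proof -
    show "0 < \<epsilon>" using h \<epsilon>0 by (simp add: \<epsilon>_def)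
    show "\<epsilon> \<le> h / 4" unfolding \<epsilon>_def by (rule min.cobounded1)
    have "mean_inv * \<epsilon> \<le> mean_inv * \<epsilon>0"
      unfolding \<epsilon>_def using mean_inv_nonneg by (intro mult_left_mono) auto
    then show "2 * \<epsilon> * mean_inv \<le> r / 2" using \<epsilon>0 by (simp add: mult_ac)
  qed
  interpret lo: test_function M "trapezoid 0 h \<epsilon>" 0 h "1 / \<epsilon>" by (rule test_function_trapezoid[OF \<epsilon>(1)])
  interpret up: test_function M "trapezoid (- \<epsilon>) (h + \<epsilon>) \<epsilon>" "- \<epsilon>" "h + \<epsilon>" "1 / \<epsilon>" by (rule test_function_trapezoid[OF \<epsilon>(1)])
  have lo_total: "h - 2 * \<epsilon> \<le> lo.g_total"
  proof -
    have "ennreal (h - 2 * \<epsilon>) = (\<integral>\<^sup>+s. indicator {0 + \<epsilon>..h - \<epsilon>} s \<partial>lborel)" using \<epsilon> h by simp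
    also have "\<dots> \<le> (\<integral>\<^sup>+s. ennreal (trapezoid 0 h \<epsilon> s) \<partial>lborel)"
    proof (rule nn_integral_mono)
      fix s :: real
      have "ennreal (indicator {0 + \<epsilon>..h - \<epsilon>} s) \<le> ennreal (trapezoid 0 h \<epsilon> s)"
        by (intro ennreal_leI trapezoid_ge \<epsilon>)
      then show "indicator {0 + \<epsilon>..h - \<epsilon>} s \<le> ennreal (trapezoid 0 h \<epsilon> s)" by (simp only: ennreal_indicator)
    qed
    finally have "enn2real (ennreal (h - 2 * \<epsilon>)) \<le> lo.g_total"
      unfolding lo.g_total_def using lo.g_integral_finite by (intro enn2real_mono) auto
    then show ?thesis using \<epsilon> h by simp
  qed
  have up_total: "up.g_total \<le> h + 2 * \<epsilon>"
  proof -
    have "(\<integral>\<^sup>+s. ennreal (trapezoid (- \<epsilon>) (h + \<epsilon>) \<epsilon> s) \<partial>lborel) \<le> (\<integral>\<^sup>+s. indicator {- \<epsilon><..<h + \<epsilon>} s \<partial>lborel)"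
    proof (rule nn_integral_mono)
      fix s :: real
      have "ennreal (trapezoid (- \<epsilon>) (h + \<epsilon>) \<epsilon> s) \<le> ennreal (indicator {- \<epsilon><..<h + \<epsilon>} s)"
        by (intro ennreal_leI trapezoid_le \<epsilon>)
      then show "ennreal (trapezoid (- \<epsilon>) (h + \<epsilon>) \<epsilon> s) \<le> indicator {- \<epsilon><..<h + \<epsilon>} s" by (simp only: ennreal_indicator)
    qed
    also have "\<dots> = ennreal (h + 2 * \<epsilon>)" using \<epsilon> h by simp
    finally have "up.g_total \<le> enn2real (ennreal (h + 2 * \<epsilon>))"
      unfolding up.g_total_def by (intro enn2real_mono) auto
    also have "\<dots> = h + 2 * \<epsilon>" using \<epsilon> h by (intro enn2real_ennreal) simp
    finally show ?thesis .
  qed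
  have le: "lo.Z x \<le> U h x" for x
  proof (rule pot_mono[OF lo.dominated_g dominated_interval])
    show "trapezoid 0 h \<epsilon> z \<le> indicator {0<..h} z" for z
      using trapezoid_le[OF \<epsilon>(1), of 0 h z] by (rule order_trans) (auto simp: indicator_def)
  qed
  have ge: "U h x \<le> up.Z x" for x
  proof (rule pot_mono[OF dominated_interval up.dominated_g])
    show "indicator {0<..h} z \<le> trapezoid (- \<epsilon>) (h + \<epsilon>) \<epsilon> z" for z
      using trapezoid_ge[OF \<epsilon>(1), of "- \<epsilon>" "h + \<epsilon>" z] by (rule order_trans[rotated]) (auto simp: indicator_def)
  qed
  have "h * mean_inv - r / 2 \<le> lo.g_total * mean_inv"
    using mult_right_mono[OF lo_total mean_inv_nonneg] \<epsilon>(3) by (simp add: algebra_simps)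
  then have "h * mean_inv - r < lo.g_total * mean_inv" using r by linarith
  then have 1: "\<forall>\<^sub>F x in at_bot. h * mean_inv - r < lo.Z x"
    using lo.Z_tendsto[OF nonlattice] by (intro order_tendstoD) auto
  have "up.g_total * mean_inv \<le> h * mean_inv + r / 2"
    using mult_right_mono[OF up_total mean_inv_nonneg] \<epsilon>(3) by (simp add: algebra_simps)
  then have "up.g_total * mean_inv < h * mean_inv + r" using r by linarith
  then have 2: "\<forall>\<^sub>F x in at_bot. up.Z x < h * mean_inv + r"
    using up.Z_tendsto[OF nonlattice] by (intro order_tendstoD) auto
  from 1 2 show "\<forall>\<^sub>F x in at_bot. dist (U h x) (h * mean_inv) < r"
  proof eventually_elim
    case (elim x)
    then show ?case using le[of x] ge[of x] by (simp add: dist_real_def abs_less_iff)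
  qed
qed

end

section \<open>First entrance decomposition of Markov additive kernels\<close>

lemma infsum_eq_nn_integral_count_space:
  fixes f :: "'a :: countable \<Rightarrow> ennreal"
  shows "infsum f S = (\<integral>\<^sup>+x. f x \<partial>count_space S)"
proof (rule antisym)
  have "sum f T \<le> (\<integral>\<^sup>+x. f x \<partial>count_space S)" if "finite T" "T \<subseteq> S" for T
  proof -
    have "sum f T = (\<integral>\<^sup>+x. f x * indicator T x \<partial>count_space UNIV)"
      using that by (simp add: nn_integral_count_space_indicator[symmetric] nn_integral_count_space_finite)
    also have "\<dots> \<le> (\<integral>\<^sup>+x. f x * indicator S x \<partial>count_space UNIV)"
      using that by (intro nn_integral_mono) (auto simp: indicator_def)
    finally show ?thesis by (simp add: nn_integral_count_space_indicator)
  qed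
  then show "infsum f S \<le> (\<integral>\<^sup>+x. f x \<partial>count_space S)"
    by (subst nonneg_infsum_complete) (auto intro!: SUP_least)
next
  \<comment> \<open>A sequence of finite sets exhausting S, so that monotone convergence applies to
    the supremum over finite subsets.\<close>
  define T where "T n = {x \<in> S. to_nat x < n}" for n
  have fin: "finite (T n)" for n
    by (rule finite_imageD[of to_nat]) (auto simp: T_def inj_on_def intro: finite_subset[of _ "{..<n}"])
  have "(\<integral>\<^sup>+x. f x \<partial>count_space S) = (\<integral>\<^sup>+x. f x * indicator S x \<partial>count_space UNIV)"
    by (rule nn_integral_count_space_indicator) (simp add: NO_MATCH_def)
  also have "\<dots> = (\<integral>\<^sup>+x. (SUP n. f x * indicator (T n) x) \<partial>count_space UNIV)"
  proof (rule nn_integral_cong)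
    fix x
    show "f x * indicator S x = (SUP n. f x * indicator (T n) x)"
    proof (cases "x \<in> S")
      case True
      then have "f x \<le> (SUP n. f x * indicator (T n) x)"
        by (intro SUP_upper2[of "Suc (to_nat x)"]) (auto simp: T_def)
      moreover have "(SUP n. f x * indicator (T n) x) \<le> f x" by (intro SUP_least) (auto simp: indicator_def)
      ultimately show ?thesis using True by simp
    qed (simp add: T_def)
  qed
  also have "\<dots> = (SUP n. \<integral>\<^sup>+x. f x * indicator (T n) x \<partial>count_space UNIV)"
    by (rule nn_integral_monotone_convergence_SUP) (auto simp: incseq_def le_fun_def T_def indicator_def)
  also have "\<dots> = (SUP n. sum f (T n))"
    using fin by (simp add: nn_integral_count_space_indicator[symmetric] nn_integral_count_space_finite)
  also have "\<dots> \<le> infsum f S"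
    using fin by (subst nonneg_infsum_complete) (auto intro!: SUP_least SUP_upper simp: T_def)
  finally show "(\<integral>\<^sup>+x. f x \<partial>count_space S) \<le> infsum f S" .
qed

text \<open>
  The kernel of a Markov additive process is a nonnegative matrix \<open>W\<close> on the states together with
  the laws \<open>F i k\<close> of the increments.  It acts on functions of a state and a position; \<open>mstep\<close> is
  its action on functions of the state alone.  The increments enter through a map \<open>\<phi>\<close>, so that the
  same state process can carry several additive parts.
\<close>

definition mstep :: "(nat \<Rightarrow> nat \<Rightarrow> ennreal) \<Rightarrow> (nat \<Rightarrow> ennreal) \<Rightarrow> nat \<Rightarrow> ennreal" where
  "mstep W r i = (\<integral>\<^sup>+k. W i k * r k \<partial>count_space UNIV)"

definition avoid :: "nat \<Rightarrow> (nat \<Rightarrow> nat \<Rightarrow> ennreal) \<Rightarrow> nat \<Rightarrow> nat \<Rightarrow> ennreal" where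
  "avoid s W i k = (if k = s then 0 else W i k)"

definition enter :: "nat \<Rightarrow> (nat \<Rightarrow> nat \<Rightarrow> ennreal) \<Rightarrow> nat \<Rightarrow> nat \<Rightarrow> ennreal" where
  "enter s W i k = (if k = s then W i k else 0)"

text \<open>The n-th term weighs the paths that avoid s for n steps and then enter it. For a
  stochastic matrix this is the probability of ever entering s after time 0; in general it is the
  mass of the first entrance law.\<close>

definition hit :: "nat \<Rightarrow> (nat \<Rightarrow> nat \<Rightarrow> ennreal) \<Rightarrow> nat \<Rightarrow> ennreal" where
  "hit s W i = (\<Sum>n. (mstep (avoid s W) ^^ n) (\<lambda>i. W i s) i)"

lemma mstep_mono: "(\<And>k. r k \<le> r' k) \<Longrightarrow> mstep W r i \<le> mstep W r' i"
  unfolding mstep_def by (intro nn_integral_mono mult_left_mono) auto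

lemma mstep_add: "mstep W (\<lambda>k. r k + r' k) i = mstep W r i + mstep W r' i"
  unfolding mstep_def by (simp add: distrib_left nn_integral_add)

lemma mstep_cmult: "mstep W (\<lambda>k. c * r k) i = c * mstep W r i"
  unfolding mstep_def by (simp add: mult.left_commute nn_integral_cmult)

lemma mstep_suminf: "mstep W (\<lambda>k. \<Sum>n. r n k) i = (\<Sum>n. mstep W (r n) i)"
proof -
  have "mstep W (\<lambda>k. \<Sum>n. r n k) i = (\<integral>\<^sup>+k. (\<Sum>n. W i k * r n k) \<partial>count_space UNIV)"
    by (simp only: mstep_def ennreal_suminf_cmult)
  also have "\<dots> = (\<Sum>n. mstep W (r n) i)"
    unfolding mstep_def by (rule nn_integral_suminf) simp
  finally show ?thesis .
qed

lemma mstep_enter: "mstep (enter s W) r i = W i s * r s"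
proof -
  have "mstep (enter s W) r i = (\<integral>\<^sup>+k. (W i s * r s) * indicator {s} k \<partial>count_space UNIV)"
    unfolding mstep_def enter_def by (intro nn_integral_cong) (auto simp: indicator_def)
  then show ?thesis by simp
qed

lemma mstep_split: "mstep W r i = W i s * r s + mstep (avoid s W) r i"
proof -
  have "mstep W r i = mstep (enter s W) r i + mstep (avoid s W) r i"
    unfolding mstep_def
    by (subst nn_integral_add[symmetric]) (auto simp: distrib_right[symmetric] avoid_def enter_def intro!: nn_integral_cong)
  then show ?thesis by (simp add: mstep_enter)
qed

lemma suminf_Suc_ennreal: "(\<Sum>n. f n) = f 0 + (\<Sum>n. f (Suc n))" for f :: "nat \<Rightarrow> ennreal"
proof -
  have "(\<Sum>n. f n) = (\<Sum>n. f (n + 1)) + (\<Sum>n<1. f n)" by (rule suminf_offset[OF summableI])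
  also have "\<dots> = f 0 + (\<Sum>n. f (Suc n))" by (simp only: add.commute lessThan_Suc One_nat_def) simp
  finally show ?thesis .
qed

lemma mstep_pow_suminf_unfold:
  "(\<Sum>n. (mstep W ^^ n) r i) = r i + mstep W (\<lambda>k. \<Sum>n. (mstep W ^^ n) r k) i"
  unfolding mstep_suminf suminf_Suc_ennreal[of "\<lambda>n. (mstep W ^^ n) r i"] by simp

lemma hit_unfold: "hit s W i = W i s + mstep (avoid s W) (hit s W) i"
  unfolding hit_def by (rule mstep_pow_suminf_unfold)

lemma suminf_le_ennrealI: "(\<And>N. (\<Sum>n<N. f n) \<le> c) \<Longrightarrow> (\<Sum>n. f n) \<le> c" for f :: "nat \<Rightarrow> ennreal"
  by (rule suminf_le_const[OF summableI])

lemma suminf_commute_ennreal: "(\<Sum>m. \<Sum>n. a m n) = (\<Sum>n. \<Sum>m. a m n)" for a :: "nat \<Rightarrow> nat \<Rightarrow> ennreal"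
proof -
  have "(\<Sum>m. \<Sum>n. a m n) = (\<integral>\<^sup>+m. (\<Sum>n. a m n) \<partial>count_space UNIV)" by (simp add: nn_integral_count_space_nat)
  also have "\<dots> = (\<Sum>n. \<integral>\<^sup>+m. a m n \<partial>count_space UNIV)" by (rule nn_integral_suminf) simp
  finally show ?thesis by (simp add: nn_integral_count_space_nat)
qed

lemma suminf_restrict_ennreal: "(\<Sum>n. if n < N then a n else 0) = (\<Sum>n<N. a n)" for a :: "nat \<Rightarrow> ennreal"
  by (subst suminf_finite[of "{..<N}"]) auto

text \<open>The Neumann series is the least solution of x = r + W x: its partial sums stay below
  every supersolution by induction. Upper bounds for entrance quantities reduce to checking one
  inequality.\<close>

lemma mstep_pow_suminf_least:
  assumes "\<And>i. r i + mstep W x i \<le> x i"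
  shows "(\<Sum>n. (mstep W ^^ n) r i) \<le> x i"
proof (rule suminf_le_ennrealI)
  fix N show "(\<Sum>n<N. (mstep W ^^ n) r i) \<le> x i"
  proof (induction N arbitrary: i)
    case (Suc N)
    have sum: "mstep W (\<lambda>k. \<Sum>n<N. (mstep W ^^ n) r k) i = (\<Sum>n<N. (mstep W ^^ Suc n) r i)" for N i
      by (induction N) (auto simp: mstep_add, simp add: mstep_def)
    have "(\<Sum>n<Suc N. (mstep W ^^ n) r i) = r i + mstep W (\<lambda>k. \<Sum>n<N. (mstep W ^^ n) r k) i"
      unfolding sum sum.lessThan_Suc_shift by simp
    also have "\<dots> \<le> r i + mstep W x i" by (intro add_left_mono mstep_mono Suc)
    finally show ?case using assms[of i] by simp
  qed simp
qed

locale additive_kernel =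
  fixes F :: "nat \<Rightarrow> nat \<Rightarrow> real measure"
  assumes dist: "real_distribution (F i j)"
begin

definition step :: "(real \<Rightarrow> 'b :: real_normed_vector) \<Rightarrow> (nat \<Rightarrow> nat \<Rightarrow> ennreal) \<Rightarrow>
    (nat \<Rightarrow> 'b \<Rightarrow> ennreal) \<Rightarrow> nat \<Rightarrow> 'b \<Rightarrow> ennreal" where
  "step \<phi> W f i x = (\<integral>\<^sup>+k. W i k * (\<integral>\<^sup>+y. f k (x + \<phi> y) \<partial>F i k) \<partial>count_space UNIV)"

lemma sets_F [simp, measurable_cong]: "sets (F i j) = sets borel"
  using dist[of i j] by (rule real_distribution.events_eq_borel)

lemma space_F [simp]: "space (F i j) = UNIV"
  using dist[of i j] by (rule real_distribution.space_eq_univ)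

lemma emeasure_F_UNIV [simp]: "emeasure (F i j) UNIV = 1"
proof -
  interpret real_distribution "F i j" by (rule dist)
  show ?thesis using emeasure_space_1 by simp
qed

lemma sigma_finite_F: "sigma_finite_measure (F i j)"
proof -
  interpret real_distribution "F i j" by (rule dist)
  show ?thesis ..
qed

definition meas :: "(nat \<Rightarrow> 'b :: topological_space \<Rightarrow> ennreal) \<Rightarrow> bool" where
  "meas f \<longleftrightarrow> (\<forall>k. f k \<in> borel_measurable borel)"

lemma measD [measurable_dest]: "meas f \<Longrightarrow> f k \<in> borel_measurable borel"
  by (simp add: meas_def)

lemma meas_shift:
  fixes f :: "nat \<Rightarrow> 'b :: {real_normed_vector, second_countable_topology} \<Rightarrow> ennreal"
  assumes f: "meas f" and [measurable]: "\<phi> \<in> borel_measurable borel"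
  shows "(\<lambda>y. f k (x + \<phi> y)) \<in> borel_measurable (F i k)"
proof -
  note [measurable] = measD[OF f]
  show ?thesis by measurable
qed

lemma meas_step:
  fixes f :: "nat \<Rightarrow> 'b :: {real_normed_vector, second_countable_topology} \<Rightarrow> ennreal"
  assumes f: "meas f" and [measurable]: "\<phi> \<in> borel_measurable borel"
  shows "meas (step \<phi> W f)"
  unfolding meas_def step_def nn_integral_count_space_nat
proof
  fix i
  note [measurable] = measD[OF f]
  have "(\<lambda>x. \<integral>\<^sup>+y. f k (x + \<phi> y) \<partial>F i k) \<in> borel_measurable borel" for k
    by (rule sigma_finite_measure.borel_measurable_nn_integral[OF sigma_finite_F]) measurable
  then show "(\<lambda>x. \<Sum>k. W i k * (\<integral>\<^sup>+y. f k (x + \<phi> y) \<partial>F i k)) \<in> borel_measurable borel" by measurable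
qed

lemma meas_step_pow:
  fixes f :: "nat \<Rightarrow> 'b :: {real_normed_vector, second_countable_topology} \<Rightarrow> ennreal"
  assumes "meas f" "\<phi> \<in> borel_measurable borel"
  shows "meas ((step \<phi> W ^^ n) f)"
  using assms by (induction n) (auto intro: meas_step)

lemma step_mono: "(\<And>k x. f k x \<le> g k x) \<Longrightarrow> step \<phi> W f i x \<le> step \<phi> W g i x"
  unfolding step_def by (intro nn_integral_mono mult_left_mono) auto

text \<open>C is a region that no increment leaves. It will be the half line [0, infinity), on which
  \<open>ennreal\<close> is additive.\<close>

lemma step_mono_on:
  assumes "\<And>k x. x \<in> C \<Longrightarrow> f k x \<le> g k x" "\<And>x y. x \<in> C \<Longrightarrow> x + \<phi> y \<in> C" "x \<in> C"
  shows "step \<phi> W f i x \<le> step \<phi> W g i x"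
  unfolding step_def using assms by (intro nn_integral_mono mult_left_mono) auto

lemma step_pow_mono: "(\<And>k x. f k x \<le> g k x) \<Longrightarrow> (step \<phi> W ^^ n) f i x \<le> (step \<phi> W ^^ n) g i x"
  by (induction n arbitrary: i x) (auto intro: step_mono)

lemma step_add:
  fixes f :: "nat \<Rightarrow> 'b :: {real_normed_vector, second_countable_topology} \<Rightarrow> ennreal"
  assumes f: "meas f" and g: "meas g" and \<phi>: "\<phi> \<in> borel_measurable borel"
  shows "step \<phi> W (\<lambda>k x. f k x + g k x) i x = step \<phi> W f i x + step \<phi> W g i x"
  unfolding step_def
  by (simp add: nn_integral_add meas_shift[OF f \<phi>] meas_shift[OF g \<phi>] distrib_left)

lemma step_suminf:
  fixes f :: "nat \<Rightarrow> nat \<Rightarrow> 'b :: {real_normed_vector, second_countable_topology} \<Rightarrow> ennreal"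
  assumes f: "\<And>n. meas (f n)" and \<phi>: "\<phi> \<in> borel_measurable borel"
  shows "step \<phi> W (\<lambda>k x. \<Sum>n. f n k x) i x = (\<Sum>n. step \<phi> W (f n) i x)"
proof -
  have "step \<phi> W (\<lambda>k x. \<Sum>n. f n k x) i x = (\<integral>\<^sup>+k. (\<Sum>n. W i k * (\<integral>\<^sup>+y. f n k (x + \<phi> y) \<partial>F i k)) \<partial>count_space UNIV)"
    by (simp only: step_def nn_integral_suminf[OF meas_shift[OF f \<phi>]] ennreal_suminf_cmult)
  also have "\<dots> = (\<Sum>n. step \<phi> W (f n) i x)"
    unfolding step_def by (rule nn_integral_suminf) simp
  finally show ?thesis .
qed

lemma step_sum:
  fixes f :: "nat \<Rightarrow> nat \<Rightarrow> 'b :: {real_normed_vector, second_countable_topology} \<Rightarrow> ennreal"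
  assumes f: "\<And>n. meas (f n)" and \<phi>: "\<phi> \<in> borel_measurable borel"
  shows "step \<phi> W (\<lambda>k x. \<Sum>n<N. f n k x) i x = (\<Sum>n<N. step \<phi> W (f n) i x)"
proof -
  have "step \<phi> W (\<lambda>k x. \<Sum>n. if n < N then f n k x else 0) i x = (\<Sum>n. step \<phi> W (\<lambda>k x. if n < N then f n k x else 0) i x)"
  proof (rule step_suminf[OF _ \<phi>])
    show "meas (\<lambda>k x. if n < N then f n k x else 0)" for n
      using f[of n] by (cases "n < N") (auto simp: meas_def)
  qed
  moreover have "step \<phi> W (\<lambda>k x. if n < N then f n k x else 0) i x = (if n < N then step \<phi> W (f n) i x else 0)" for n
    by (auto simp: step_def)
  ultimately show ?thesis by (simp add: suminf_restrict_ennreal)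
qed

lemma step_pow_add:
  fixes f :: "nat \<Rightarrow> 'b :: {real_normed_vector, second_countable_topology} \<Rightarrow> ennreal"
  assumes "meas f" "meas g" and "\<phi> \<in> borel_measurable borel"
  shows "(step \<phi> W ^^ n) (\<lambda>k x. f k x + g k x) = (\<lambda>i x. (step \<phi> W ^^ n) f i x + (step \<phi> W ^^ n) g i x)"
  using assms by (induction n) (auto intro!: ext simp: step_add meas_step_pow)

lemma step_const: "step \<phi> W (\<lambda>k x. r k) i x = mstep W r i"
  by (simp add: step_def mstep_def)

lemma step_pow_const: "(step \<phi> W ^^ n) (\<lambda>k x. r k) = (\<lambda>i x. (mstep W ^^ n) r i)"
  by (induction n) (auto intro!: ext simp: step_const)

lemma step_translate: "step \<phi> W (\<lambda>k x. f k (x + c)) i x = step \<phi> W f i (x + c)"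
  by (simp add: step_def ac_simps)

lemma step_pow_translate: "(step \<phi> W ^^ n) (\<lambda>k x. f k (x + c)) = (\<lambda>i x. (step \<phi> W ^^ n) f i (x + c))"
  by (induction n) (auto intro!: ext simp: step_translate)

text \<open>An additive map of positions carries the walk to the walk with projected increments. The
  coordinates of a planar walk and their difference are thereby compared under a single
  kernel.\<close>

lemma step_project:
  assumes "\<And>x y. \<psi> (x + y) = \<psi> x + \<psi> y"
  shows "step \<phi> W (\<lambda>k x. f k (\<psi> x)) i x = step (\<lambda>y. \<psi> (\<phi> y)) W f i (\<psi> x)"
  by (simp add: step_def assms)

lemma step_pow_project:
  assumes "\<And>x y. \<psi> (x + y) = \<psi> x + \<psi> y"
  shows "(step \<phi> W ^^ n) (\<lambda>k x. f k (\<psi> x)) = (\<lambda>i x. (step (\<lambda>y. \<psi> (\<phi> y)) W ^^ n) f i (\<psi> x))"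
  by (induction n) (auto intro!: ext simp: step_project[OF assms])

lemma step_cong_on:
  assumes "\<And>k x. x \<in> C \<Longrightarrow> f k x = g k x" "\<And>x y. x \<in> C \<Longrightarrow> x + \<phi> y \<in> C" "x \<in> C"
  shows "step \<phi> W f i x = step \<phi> W g i x"
  using assms by (simp add: step_def)

lemma step_pow_cong_on:
  assumes "\<And>k x. x \<in> C \<Longrightarrow> f k x = g k x" "\<And>x y. x \<in> C \<Longrightarrow> x + \<phi> y \<in> C"
  shows "x \<in> C \<Longrightarrow> (step \<phi> W ^^ n) f i x = (step \<phi> W ^^ n) g i x"
proof (induction n arbitrary: i x)
  case (Suc n)
  show ?case using step_cong_on[of C "(step \<phi> W ^^ n) f" "(step \<phi> W ^^ n) g" \<phi> x W i] Suc assms by simp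
qed (use assms in simp)

lemma step_split: "step \<phi> W f i x = step \<phi> (enter s W) f i x + step \<phi> (avoid s W) f i x"
  unfolding step_def
  by (subst nn_integral_add[symmetric]) (auto simp: distrib_right[symmetric] avoid_def enter_def intro!: nn_integral_cong)

lemma step_enter: "step \<phi> (enter s W) f i x = W i s * (\<integral>\<^sup>+y. f s (x + \<phi> y) \<partial>F i s)"
proof -
  have "step \<phi> (enter s W) f i x = (\<integral>\<^sup>+k. (W i s * (\<integral>\<^sup>+y. f s (x + \<phi> y) \<partial>F i s)) * indicator {s} k \<partial>count_space UNIV)"
    unfolding step_def enter_def by (intro nn_integral_cong) (auto simp: indicator_def)
  then show ?thesis by simp
qed

text \<open>
  The integral of \<open>f\<close> over the position at the first entrance into \<open>s\<close> after time 0, for the process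
  started in state \<open>i\<close> at position \<open>x\<close>.
\<close>

definition entrance :: "(real \<Rightarrow> 'b :: real_normed_vector) \<Rightarrow> nat \<Rightarrow> (nat \<Rightarrow> nat \<Rightarrow> ennreal) \<Rightarrow>
    ('b \<Rightarrow> ennreal) \<Rightarrow> nat \<Rightarrow> 'b \<Rightarrow> ennreal" where
  "entrance \<phi> s W f i x = (\<Sum>n. (step \<phi> (avoid s W) ^^ n) (step \<phi> (enter s W) (\<lambda>_. f)) i x)"

lemma meas_enter:
  fixes f :: "'b :: {real_normed_vector, second_countable_topology} \<Rightarrow> ennreal"
  shows "f \<in> borel_measurable borel \<Longrightarrow> \<phi> \<in> borel_measurable borel \<Longrightarrow> meas (step \<phi> W (\<lambda>_. f))"
  by (intro meas_step) (auto simp: meas_def)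

lemma meas_entrance:
  fixes f :: "'b :: {real_normed_vector, second_countable_topology} \<Rightarrow> ennreal"
  assumes "f \<in> borel_measurable borel" "\<phi> \<in> borel_measurable borel"
  shows "meas (entrance \<phi> s W f)"
  unfolding meas_def entrance_def
  by (intro allI borel_measurable_suminf_order measD meas_step_pow meas_enter assms)

lemma entrance_unfold:
  fixes f :: "'b :: {real_normed_vector, second_countable_topology} \<Rightarrow> ennreal"
  assumes "f \<in> borel_measurable borel" "\<phi> \<in> borel_measurable borel"
  shows "entrance \<phi> s W f i x = step \<phi> (enter s W) (\<lambda>_. f) i x + step \<phi> (avoid s W) (entrance \<phi> s W f) i x"
  unfolding entrance_def
  by (subst step_suminf[OF meas_step_pow[OF meas_enter[OF assms] assms(2)] assms(2)], subst suminf_Suc_ennreal) simp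

lemma entrance_mono: "(\<And>x. f x \<le> g x) \<Longrightarrow> entrance \<phi> s W f i x \<le> entrance \<phi> s W g i x"
  unfolding entrance_def by (intro suminf_le summableI step_pow_mono step_mono)

lemma entrance_add:
  fixes f :: "'b :: {real_normed_vector, second_countable_topology} \<Rightarrow> ennreal"
  assumes "f \<in> borel_measurable borel" "g \<in> borel_measurable borel" "\<phi> \<in> borel_measurable borel"
  shows "entrance \<phi> s W (\<lambda>x. f x + g x) i x = entrance \<phi> s W f i x + entrance \<phi> s W g i x"
proof -
  have "step \<phi> (enter s W) (\<lambda>_ x. f x + g x) = (\<lambda>i x. step \<phi> (enter s W) (\<lambda>_. f) i x + step \<phi> (enter s W) (\<lambda>_. g) i x)"
    using assms by (intro ext step_add) (auto simp: meas_def)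
  then show ?thesis
    unfolding entrance_def using assms
    by (simp add: step_pow_add meas_enter suminf_add[symmetric] summableI)
qed

lemma step_pow_suminf:
  fixes f :: "nat \<Rightarrow> nat \<Rightarrow> 'b :: {real_normed_vector, second_countable_topology} \<Rightarrow> ennreal"
  assumes "\<And>n. meas (f n)" "\<phi> \<in> borel_measurable borel"
  shows "(step \<phi> W ^^ m) (\<lambda>k x. \<Sum>n. f n k x) = (\<lambda>i x. \<Sum>n. (step \<phi> W ^^ m) (f n) i x)"
  using assms by (induction m) (auto intro!: ext simp: step_suminf meas_step_pow)

lemma entrance_suminf:
  fixes f :: "nat \<Rightarrow> 'b :: {real_normed_vector, second_countable_topology} \<Rightarrow> ennreal"
  assumes "\<And>n. f n \<in> borel_measurable borel" "\<phi> \<in> borel_measurable borel"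
  shows "entrance \<phi> s W (\<lambda>x. \<Sum>n. f n x) i x = (\<Sum>n. entrance \<phi> s W (f n) i x)"
proof -
  have "step \<phi> (enter s W) (\<lambda>_ x. \<Sum>n. f n x) = (\<lambda>i x. \<Sum>n. step \<phi> (enter s W) (\<lambda>_. f n) i x)"
    using assms by (intro ext step_suminf) (auto simp: meas_def)
  then show ?thesis
    unfolding entrance_def using assms
    by (subst suminf_commute_ennreal) (simp add: step_pow_suminf meas_enter)
qed

lemma entrance_const: "entrance \<phi> s W (\<lambda>_. c) i x = c * hit s W i"
proof -
  have pow: "(mstep V ^^ n) (\<lambda>i. c * r i) = (\<lambda>i. c * (mstep V ^^ n) r i)" for V n r
    by (induction n) (auto intro!: ext simp: mstep_cmult)
  have "step \<phi> (enter s W) (\<lambda>_ _. c) = (\<lambda>i x. c * W i s)"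
    using step_const[of \<phi> "enter s W" "\<lambda>_. c"] by (auto simp: fun_eq_iff mstep_enter mult.commute)
  then show ?thesis by (simp add: entrance_def step_pow_const pow hit_def ennreal_suminf_cmult)
qed

lemma entrance_translate: "entrance \<phi> s W (\<lambda>x. f (x + c)) i x = entrance \<phi> s W f i (x + c)"
  unfolding entrance_def step_translate[of \<phi> "enter s W" "\<lambda>_. f" c, abs_def] step_pow_translate ..

lemma entrance_project:
  assumes "\<And>x y. \<psi> (x + y) = \<psi> x + \<psi> y"
  shows "entrance \<phi> s W (\<lambda>x. f (\<psi> x)) i x = entrance (\<lambda>y. \<psi> (\<phi> y)) s W f i (\<psi> x)"
  unfolding entrance_def step_project[OF assms, of \<phi> "enter s W" "\<lambda>_. f", abs_def] step_pow_project[OF assms] ..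

lemma entrance_cong_on:
  assumes "\<And>x. x \<in> C \<Longrightarrow> f x = g x" "\<And>x y. x \<in> C \<Longrightarrow> x + \<phi> y \<in> C" "x \<in> C"
  shows "entrance \<phi> s W f i x = entrance \<phi> s W g i x"
  unfolding entrance_def
  by (intro arg_cong[where f=suminf] ext step_pow_cong_on[of C] step_cong_on[of C]) (use assms in auto)

definition potential :: "(real \<Rightarrow> 'b :: real_normed_vector) \<Rightarrow> (nat \<Rightarrow> nat \<Rightarrow> ennreal) \<Rightarrow>
    (nat \<Rightarrow> 'b \<Rightarrow> ennreal) \<Rightarrow> nat \<Rightarrow> 'b \<Rightarrow> ennreal" where
  "potential \<phi> W f i x = (\<Sum>n. (step \<phi> W ^^ n) f i x)"

context
  fixes \<phi> :: "real \<Rightarrow> 'b :: {real_normed_vector, second_countable_topology}"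
    and s :: nat and W :: "nat \<Rightarrow> nat \<Rightarrow> ennreal" and f :: "nat \<Rightarrow> 'b \<Rightarrow> ennreal"
  assumes \<phi>: "\<phi> \<in> borel_measurable borel" and f: "meas f" and supp: "\<And>k x. k \<noteq> s \<Longrightarrow> f k x = 0"
begin

lemma step_avoid_f: "step \<phi> (avoid s W) f i x = 0"
proof -
  have "avoid s W i k * (\<integral>\<^sup>+y. f k (x + \<phi> y) \<partial>F i k) = 0" for k by (cases "k = s") (auto simp: avoid_def supp)
  then show ?thesis by (simp only: step_def nn_integral_0_iff_AE) simp
qed

lemma step_enter_cong: "step \<phi> (enter s W) g i x = step \<phi> (enter s W) (\<lambda>_. g s) i x"
  by (simp add: step_enter)

lemma meas_partial: "meas (\<lambda>k x. \<Sum>n<N. (step \<phi> W ^^ n) f k x)"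
  unfolding meas_def by (intro allI borel_measurable_sum measD meas_step_pow f \<phi>)

lemma meas_potential: "meas (potential \<phi> W f)"
  unfolding meas_def potential_def by (intro allI borel_measurable_suminf_order measD meas_step_pow f \<phi>)

lemma partial_potential_Suc:
  "(\<Sum>n<Suc N. (step \<phi> W ^^ n) f i x) = f i x + step \<phi> W (\<lambda>k x. \<Sum>n<N. (step \<phi> W ^^ n) f k x) i x"
  unfolding sum.lessThan_Suc_shift by (subst step_sum) (auto intro: meas_step_pow f \<phi>)

text \<open>Only an inequality holds at finite horizon: the first entrance takes at least one step,
  so at most N of the N + 1 terms remain afterwards. Starting off s nothing is collected before the
  entrance.\<close>

lemma partial_potential_le:
  "(\<Sum>n<Suc N. (step \<phi> W ^^ n) f i x) \<le> f i x + entrance \<phi> s W (\<lambda>x. \<Sum>n<N. (step \<phi> W ^^ n) f s x) i x"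
proof (induction N arbitrary: i x)
  case (Suc N)
  let ?V = "\<lambda>N k x. \<Sum>n<N. (step \<phi> W ^^ n) f k x"
  have mV: "(\<lambda>x. ?V N s x) \<in> borel_measurable borel" for N using meas_partial[of N] by (simp add: meas_def)
  have "step \<phi> (avoid s W) (?V (Suc N)) i x \<le> step \<phi> (avoid s W) (\<lambda>i x. f i x + entrance \<phi> s W (\<lambda>x. ?V N s x) i x) i x"
    by (intro step_mono Suc)
  also have "\<dots> = step \<phi> (avoid s W) f i x + step \<phi> (avoid s W) (entrance \<phi> s W (\<lambda>x. ?V N s x)) i x"
    by (rule step_add[OF f meas_entrance[OF mV \<phi>] \<phi>])
  also have "\<dots> = step \<phi> (avoid s W) (entrance \<phi> s W (\<lambda>x. ?V N s x)) i x"
    by (simp only: step_avoid_f add_0)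
  also have "\<dots> \<le> step \<phi> (avoid s W) (entrance \<phi> s W (\<lambda>x. ?V (Suc N) s x)) i x"
    by (intro step_mono entrance_mono) simp
  finally have le: "step \<phi> (avoid s W) (?V (Suc N)) i x \<le> step \<phi> (avoid s W) (entrance \<phi> s W (\<lambda>x. ?V (Suc N) s x)) i x" .
  have "?V (Suc (Suc N)) i x = f i x + (step \<phi> (enter s W) (?V (Suc N)) i x + step \<phi> (avoid s W) (?V (Suc N)) i x)"
    by (subst partial_potential_Suc) (simp only: step_split[of \<phi> W _ _ _ s])
  also have "\<dots> \<le> f i x + (step \<phi> (enter s W) (?V (Suc N)) i x + step \<phi> (avoid s W) (entrance \<phi> s W (\<lambda>x. ?V (Suc N) s x)) i x)"
    by (intro add_left_mono le)
  also have "\<dots> = f i x + entrance \<phi> s W (\<lambda>x. ?V (Suc N) s x) i x"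
    by (simp only: entrance_unfold[OF mV \<phi>, of s W "Suc N" i x] step_enter_cong[of "?V (Suc N)"])
  finally show ?case .
qed simp

lemma partial_potential_mono: "(\<Sum>n<N. (step \<phi> W ^^ n) f i x) \<le> potential \<phi> W f i x"
  unfolding potential_def by (intro sum_le_suminf summableI) auto

lemma potential_unfold: "potential \<phi> W f i x = f i x + step \<phi> W (potential \<phi> W f) i x"
  unfolding potential_def
  by (subst step_suminf[OF meas_step_pow[OF f \<phi>] \<phi>], subst suminf_Suc_ennreal) simp

text \<open>The upper bound is the limit of the finite-horizon estimate. For the lower bound the
  potential is unfolded N times, splitting each step into entering and avoiding s; nothing is
  subtracted, so infinite values do no harm.\<close>

lemma potential_first_entrance:
  "potential \<phi> W f i x = f i x + entrance \<phi> s W (potential \<phi> W f s) i x"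
proof (rule antisym)
  have ms: "potential \<phi> W f s \<in> borel_measurable borel" using meas_potential by (simp add: meas_def)
  show "potential \<phi> W f i x \<le> f i x + entrance \<phi> s W (potential \<phi> W f s) i x"
    unfolding potential_def[of _ _ _ i]
  proof (rule suminf_le_ennrealI)
    fix N
    have "(\<Sum>n<N. (step \<phi> W ^^ n) f i x) \<le> (\<Sum>n<Suc N. (step \<phi> W ^^ n) f i x)" by simp
    also have "\<dots> \<le> f i x + entrance \<phi> s W (\<lambda>x. \<Sum>n<N. (step \<phi> W ^^ n) f s x) i x" by (rule partial_potential_le)
    also have "\<dots> \<le> f i x + entrance \<phi> s W (potential \<phi> W f s) i x"
      by (intro add_left_mono entrance_mono partial_potential_mono)
    finally show "(\<Sum>n<N. (step \<phi> W ^^ n) f i x) \<le> f i x + entrance \<phi> s W (potential \<phi> W f s) i x" .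
  qed
  let ?X = "potential \<phi> W f" and ?A = "step \<phi> (avoid s W)" and ?B = "step \<phi> (enter s W)"
  have "f i x + (\<Sum>n<N. (?A ^^ n) (?B (\<lambda>_. ?X s)) i x) \<le> ?X i x" for N
  proof (induction N arbitrary: i x)
    case 0 then show ?case by (subst potential_unfold) simp
  next
    case (Suc N)
    have mB: "meas ((?A ^^ n) (?B (\<lambda>_. ?X s)))" for n by (intro meas_step_pow meas_enter ms \<phi>)
    have le: "?A (\<lambda>i x. \<Sum>n<N. (?A ^^ n) (?B (\<lambda>_. ?X s)) i x) i x \<le> ?A ?X i x"
    proof (rule step_mono)
      fix k y show "(\<Sum>n<N. (?A ^^ n) (?B (\<lambda>_. ?X s)) k y) \<le> ?X k y"
        by (rule order_trans[OF _ Suc]) simp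
    qed
    have "f i x + (\<Sum>n<Suc N. (?A ^^ n) (?B (\<lambda>_. ?X s)) i x)
      = f i x + (?B (\<lambda>_. ?X s) i x + ?A (\<lambda>i x. \<Sum>n<N. (?A ^^ n) (?B (\<lambda>_. ?X s)) i x) i x)"
      unfolding sum.lessThan_Suc_shift by (subst step_sum[OF mB \<phi>]) simp
    also have "\<dots> \<le> f i x + (?B (\<lambda>_. ?X s) i x + ?A ?X i x)"
      by (intro add_left_mono le)
    also have "\<dots> = ?X i x"
      by (simp only: potential_unfold[of i x] step_split[of \<phi> W ?X i x s] step_enter_cong[of ?X])
    finally show ?case .
  qed
  then have "f i x + (\<Sum>n<N. (?A ^^ n) (?B (\<lambda>_. ?X s)) i x) \<le> ?X i x" for N .
  then have "(SUP N. f i x + (\<Sum>n<N. (?A ^^ n) (?B (\<lambda>_. ?X s)) i x)) \<le> ?X i x" by (rule SUP_least)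
  then show "f i x + entrance \<phi> s W (?X s) i x \<le> ?X i x"
    unfolding entrance_def by (simp add: suminf_eq_SUP ennreal_SUP_add_right)
qed

text \<open>
  The successive positions at \<open>s\<close> form a random walk, and the potential at \<open>s\<close> is its renewal
  measure.
\<close>

lemma potential_eq_entrance_pow:
  "potential \<phi> W f s x = (\<Sum>n. ((\<lambda>g. entrance \<phi> s W g s) ^^ n) (f s) x)"
proof -
  let ?K = "\<lambda>g. entrance \<phi> s W g s"
  have fs: "f s \<in> borel_measurable borel" using f by (simp add: meas_def)
  have mK: "(?K ^^ n) (f s) \<in> borel_measurable borel" for n
  proof (induction n)
    case (Suc n)
    then show ?case using meas_entrance[OF _ \<phi>, of "(?K ^^ n) (f s)" s W] by (simp add: meas_def)
  qed (simp add: fs)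
  have KS: "entrance \<phi> s W (\<lambda>x. \<Sum>n<N. (?K ^^ n) (f s) x) s x = (\<Sum>n<N. (?K ^^ Suc n) (f s) x)" for N x
  proof -
    have "entrance \<phi> s W (\<lambda>x. \<Sum>n. if n < N then (?K ^^ n) (f s) x else 0) s x
       = (\<Sum>n. entrance \<phi> s W (\<lambda>x. if n < N then (?K ^^ n) (f s) x else 0) s x)"
      using mK by (intro entrance_suminf \<phi>) auto
    moreover have "entrance \<phi> s W (\<lambda>x. if n < N then (?K ^^ n) (f s) x else 0) s x = (if n < N then (?K ^^ Suc n) (f s) x else 0)" for n
      using entrance_const[of \<phi> s W 0] by auto
    ultimately show ?thesis by (simp add: suminf_restrict_ennreal)
  qed
  show ?thesis
  proof (rule antisym)
    have "(\<Sum>n<N. (step \<phi> W ^^ n) f s x) \<le> (\<Sum>n<N. (?K ^^ n) (f s) x)" for N x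
    proof (induction N arbitrary: x)
      case (Suc N)
      have "(\<Sum>n<Suc N. (step \<phi> W ^^ n) f s x) \<le> f s x + entrance \<phi> s W (\<lambda>x. \<Sum>n<N. (step \<phi> W ^^ n) f s x) s x"
        by (rule partial_potential_le)
      also have "\<dots> \<le> f s x + entrance \<phi> s W (\<lambda>x. \<Sum>n<N. (?K ^^ n) (f s) x) s x"
        by (intro add_left_mono entrance_mono Suc)
      also have "\<dots> = (\<Sum>n<Suc N. (?K ^^ n) (f s) x)"
        unfolding KS sum.lessThan_Suc_shift by simp
      finally show ?case .
    qed simp
    then show "potential \<phi> W f s x \<le> (\<Sum>n. (?K ^^ n) (f s) x)"
      unfolding potential_def by (intro suminf_le_ennrealI) (auto intro!: order_trans[OF _ sum_le_suminf] summableI)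
    have "(\<Sum>n<N. (?K ^^ n) (f s) x) \<le> potential \<phi> W f s x" for N x
    proof (induction N arbitrary: x)
      case (Suc N)
      have "(\<Sum>n<Suc N. (?K ^^ n) (f s) x) = f s x + entrance \<phi> s W (\<lambda>x. \<Sum>n<N. (?K ^^ n) (f s) x) s x"
        unfolding KS sum.lessThan_Suc_shift by simp
      also have "\<dots> \<le> f s x + entrance \<phi> s W (potential \<phi> W f s) s x"
        by (intro add_left_mono entrance_mono Suc)
      finally show ?case by (simp only: potential_first_entrance[of s x, symmetric])
    qed simp
    then show "(\<Sum>n. (?K ^^ n) (f s) x) \<le> potential \<phi> W f s x" by (intro suminf_le_ennrealI)
  qed
qed

end

end

section \<open>Recurrent kernels\<close>

lemma mstep_pow_cmult: "(mstep W ^^ n) (\<lambda>i. c * r i) = (\<lambda>i. c * (mstep W ^^ n) r i)"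
  by (induction n) (auto intro!: ext simp: mstep_cmult)

lemma mstep_pow_add: "(mstep W ^^ n) (\<lambda>i. r i + r' i) = (\<lambda>i. (mstep W ^^ n) r i + (mstep W ^^ n) r' i)"
  by (induction n) (auto intro!: ext simp: mstep_add)

lemma mstep_pow_mono: "(\<And>k. r k \<le> r' k) \<Longrightarrow> (mstep W ^^ n) r i \<le> (mstep W ^^ n) r' i"
  by (induction n arbitrary: i) (auto intro: mstep_mono)

lemma mstep_pow_suminf: "(mstep W ^^ n) (\<lambda>k. \<Sum>m. r m k) = (\<lambda>i. \<Sum>m. (mstep W ^^ n) (r m) i)"
  by (induction n) (auto intro!: ext simp: mstep_suminf)

lemma suminf_indicator_singleton: "(\<Sum>k. f k * indicator {k} i) = f i" for f :: "nat \<Rightarrow> ennreal"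
  by (subst suminf_finite[of "{i}"]) auto

lemma mstep_pow_expand: "(mstep W ^^ n) r i = (\<Sum>k. r k * (mstep W ^^ n) (indicator {k}) i)"
proof -
  have "(mstep W ^^ n) r i = (mstep W ^^ n) (\<lambda>j. \<Sum>k. r k * indicator {k} j) i"
    by (simp only: suminf_indicator_singleton)
  then show ?thesis by (simp only: mstep_pow_suminf mstep_pow_cmult)
qed

lemma mstep_indicator: "mstep W (indicator {k}) i = W i k"
  unfolding mstep_def nn_integral_count_space_nat
  by (subst suminf_finite[of "{k}"]) auto

lemma mstep_pow_fixed: "(\<And>i. mstep W r i = r i) \<Longrightarrow> (mstep W ^^ n) r = r"
  by (induction n) auto

lemma left_invariant_pow:
  assumes "\<And>k. (\<Sum>i. x i * W i k) = x k"
  shows "(\<Sum>i. x i * (mstep W ^^ n) r i) = (\<Sum>i. x i * r i)"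
proof (induction n)
  case (Suc n)
  have "(\<Sum>i. x i * mstep W y i) = (\<Sum>i. x i * y i)" for y
  proof -
    have "(\<Sum>i. x i * mstep W y i) = (\<Sum>i. \<Sum>k. x i * (W i k * y k))"
      by (simp only: mstep_def nn_integral_count_space_nat ennreal_suminf_cmult)
    also have "\<dots> = (\<Sum>k. \<Sum>i. y k * (x i * W i k))"
      by (subst suminf_commute_ennreal) (simp only: mult_ac)
    also have "\<dots> = (\<Sum>k. x k * y k)"
      by (simp only: ennreal_suminf_cmult assms mult.commute)
    finally show ?thesis .
  qed
  then show ?case using Suc by simp
qed simp

lemma ennreal_less_imp_add:
  fixes a b :: ennreal
  assumes "a < b" obtains d where "0 < d" "b = a + d"
  using assms by (metis add.right_neutral diff_add_cancel_ennreal add.commute less_imp_le not_gr_zero order_less_irrefl)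

locale recurrent_kernel = additive_kernel F for F :: "nat \<Rightarrow> nat \<Rightarrow> real measure" +
  fixes S :: "nat set" and W :: "nat \<Rightarrow> nat \<Rightarrow> ennreal" and u v :: "nat \<Rightarrow> ennreal" and s :: nat
  assumes s: "s \<in> S"
    and W_supp: "i \<notin> S \<or> k \<notin> S \<Longrightarrow> W i k = 0"
    and v_inv: "mstep W v i = v i"
    and v_pos: "i \<in> S \<Longrightarrow> 0 < v i" and v_fin: "v i < top" and v_supp: "i \<notin> S \<Longrightarrow> v i = 0"
    and u_inv: "(\<Sum>i. u i * W i k) = u k"
    and u_pos: "i \<in> S \<Longrightarrow> 0 < u i" and u_fin: "u i < top" and u_supp: "i \<notin> S \<Longrightarrow> u i = 0"
    and irred: "i \<in> S \<Longrightarrow> j \<in> S \<Longrightarrow> \<exists>n. 0 < (mstep W ^^ n) (indicator {j}) i"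
    and recurrent: "(\<Sum>n. (mstep W ^^ n) (indicator {s}) s) = top"
begin

abbreviation A where "A \<equiv> avoid s W"

lemma inverse_v: "inverse (v s) * v s = 1"
  using ennreal_divide_self[of "v s"] v_pos[OF s] v_fin[of s] by (simp add: divide_ennreal_def mult.commute)

lemma inverse_u: "inverse (u s) * u s = 1"
  using ennreal_divide_self[of "u s"] u_pos[OF s] u_fin[of s] by (simp add: divide_ennreal_def mult.commute)

text \<open>v / v_s solves the first-step equation of which \<open>hit\<close> is the least
  solution: splitting W v = v at s gives exactly that equation.\<close>

lemma hit_le: "hit s W i \<le> inverse (v s) * v i"
  unfolding hit_def
proof (rule mstep_pow_suminf_least)
  fix i
  have "inverse (v s) * (W i s * v s) = (inverse (v s) * v s) * W i s" by (simp only: mult_ac)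
  then have "W i s = inverse (v s) * (W i s * v s)" by (simp only: inverse_v mult_1)
  then have "W i s + mstep A (\<lambda>i. inverse (v s) * v i) i = inverse (v s) * (W i s * v s + mstep A v i)"
    by (simp only: mstep_cmult distrib_left)
  also have "\<dots> = inverse (v s) * v i" by (simp only: mstep_split[symmetric] v_inv)
  finally show "W i s + mstep A (\<lambda>i. inverse (v s) * v i) i \<le> inverse (v s) * v i" by simp
qed

text \<open>Were the return mass a < 1, the expected number of visits to s would be the geometric
  series in a, against recurrence.\<close>

lemma hit_s: "hit s W s = 1"
proof (rule ccontr)
  assume "hit s W s \<noteq> 1"
  moreover have "hit s W s \<le> 1" using hit_le[of s] inverse_v by simp
  ultimately have lt: "hit s W s < 1" by simp
  define a where "a = enn2real (hit s W s)"
  have a: "hit s W s = ennreal a" "0 \<le> a" "a < 1"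
  proof -
    show *: "hit s W s = ennreal a" unfolding a_def using lt by (intro ennreal_enn2real[symmetric]) (auto intro: less_trans)
    show "0 \<le> a" by (simp add: a_def)
    then show "a < 1" using lt unfolding * by (simp add: ennreal_less_iff flip: ennreal_1)
  qed
  \<comment> \<open>With all increments set to 0 the potential at s counts visits only, and the
    return operator is multiplication by \<open>hit s W s\<close> on constants.\<close>
  let ?f = "\<lambda>k (_ :: real). indicator {s} k :: ennreal" and ?\<phi> = "\<lambda>_ :: real. 0 :: real"
  let ?K = "\<lambda>g. entrance ?\<phi> s W g s"
  have pow: "(?K ^^ n) (\<lambda>_. 1) = (\<lambda>_. hit s W s ^ n)" for n
    by (induction n) (auto simp: entrance_const mult.commute)
  have "potential ?\<phi> W ?f s 0 = (\<Sum>n. (?K ^^ n) (?f s) 0)"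
    by (rule potential_eq_entrance_pow) (auto simp: meas_def)
  also have "\<dots> = (\<Sum>n. hit s W s ^ n)" using pow by simp
  also have "\<dots> = (\<Sum>n. ennreal (a ^ n))" using a by (simp add: ennreal_power)
  also have "\<dots> < top"
    using a by (subst suminf_ennreal2) (auto intro: summable_geometric)
  finally have "potential ?\<phi> W ?f s 0 < top" .
  moreover have "potential ?\<phi> W ?f s 0 = top"
    unfolding potential_def step_pow_const recurrent ..
  ultimately show False by simp
qed

text \<open>Since \<open>hit\<close> equals 1 at s, stopping at s and continuing from s agree there,
  and the taboo equation becomes full harmonicity.\<close>

lemma mstep_hit: "mstep W (hit s W) i = hit s W i"
  by (simp only: mstep_split[of W _ _ s] hit_s hit_unfold[of s W i, symmetric]) (simp add: hit_unfold[of s W i, symmetric])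

lemma mstep_zero_row: "i \<notin> S \<Longrightarrow> mstep W r i = 0"
  unfolding mstep_def by (simp add: W_supp)

text \<open>
  \<open>hit\<close> and \<open>v / v s\<close> are ordered fixed points of the matrix which agree at \<open>s\<close>; irreducibility
  propagates the equality.  The left eigenvector is treated in the same way below.
\<close>

lemma hit_eq: "hit s W i = inverse (v s) * v i"
proof (cases "i \<in> S")
  case True
  show ?thesis
  proof (rule ccontr)
    assume "hit s W i \<noteq> inverse (v s) * v i"
    with hit_le[of i] have "hit s W i < inverse (v s) * v i" by simp
    then obtain d where d: "0 < d" "inverse (v s) * v i = hit s W i + d" by (rule ennreal_less_imp_add)
    obtain n where n: "0 < (mstep W ^^ n) (indicator {i}) s" using irred[OF s True] by blast
    have le: "hit s W k + d * indicator {i} k \<le> inverse (v s) * v k" for k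
      using d hit_le[of k] by (cases "k = i") auto
    have "1 + d * (mstep W ^^ n) (indicator {i}) s = (mstep W ^^ n) (\<lambda>k. hit s W k + d * indicator {i} k) s"
      by (simp only: mstep_pow_add mstep_pow_cmult mstep_pow_fixed[OF mstep_hit] hit_s)
    also have "\<dots> \<le> (mstep W ^^ n) (\<lambda>k. inverse (v s) * v k) s" by (intro mstep_pow_mono le)
    also have "\<dots> = 1" by (simp only: mstep_pow_cmult mstep_pow_fixed[OF v_inv] inverse_v)
    finally have "1 + d * (mstep W ^^ n) (indicator {i}) s \<le> 1 + 0" by simp
    then have "d * (mstep W ^^ n) (indicator {i}) s \<le> 0" by (subst (asm) ennreal_add_left_cancel_le) simp
    then show False using d n by auto
  qed
next
  case False
  then show ?thesis using mstep_hit[of i] mstep_zero_row[of i] by (simp add: v_supp)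
qed

text \<open>The Green function of the excursion: expected visits to k from time 0 until just before
  the return to s, weighted by W. The start is counted, hence the value 1 at s.\<close>

definition occupation :: "nat \<Rightarrow> ennreal" where
  "occupation k = (\<Sum>n. (mstep A ^^ n) (indicator {k}) s)"

lemma suminf_mstep_avoid: "(\<Sum>n. (mstep A ^^ n) r s) = (\<Sum>k. r k * occupation k)"
proof -
  have "(\<Sum>n. (mstep A ^^ n) r s) = (\<Sum>n. \<Sum>k. r k * (mstep A ^^ n) (indicator {k}) s)"
    by (subst mstep_pow_expand) rule
  also have "\<dots> = (\<Sum>k. \<Sum>n. r k * (mstep A ^^ n) (indicator {k}) s)" by (rule suminf_commute_ennreal)
  finally show ?thesis by (simp only: ennreal_suminf_cmult occupation_def)
qed

lemma mstep_avoid_indicator: "mstep A (indicator {k}) = (\<lambda>i. if k = s then 0 else W i k)"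
  by (auto simp: mstep_indicator avoid_def)

lemma mstep_pow_zero: "(mstep V ^^ n) (\<lambda>_. 0) = (\<lambda>_. 0)"
  by (induction n) (auto simp: mstep_def)

lemma occupation_s: "occupation s = 1"
proof -
  have "(mstep A ^^ n) (indicator {s}) s = indicator {0} n" for n
    by (cases n) (auto simp: funpow_Suc_right mstep_avoid_indicator mstep_pow_zero simp del: funpow.simps(2))
  then have "occupation s = (\<Sum>n. 1 * indicator {n} (0 :: nat))" by (simp add: occupation_def indicator_def eq_commute)
  also have "\<dots> = 1" by (rule suminf_indicator_singleton)
  finally show ?thesis .
qed

text \<open>Away from s, peel off the last step before the visit. At s the sum over last steps is
  the return mass, which recurrence makes 1; this matches the visit at time 0.\<close>

lemma occupation_inv: "(\<Sum>i. occupation i * W i k) = occupation k"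
proof (cases "k = s")
  case True
  have "(\<Sum>i. W i s * occupation i) = hit s W s" unfolding hit_def suminf_mstep_avoid ..
  then show ?thesis using True by (simp add: occupation_s hit_s mult.commute)
next
  case False
  have 0: "(mstep A ^^ 0) (indicator {k}) s = 0" using False by simp
  have "occupation k = (\<Sum>n. (mstep A ^^ Suc n) (indicator {k}) s)"
    unfolding occupation_def by (subst suminf_Suc_ennreal) (simp only: 0 add_0)
  also have "\<dots> = (\<Sum>n. (mstep A ^^ n) (\<lambda>i. W i k) s)"
    using False by (simp only: funpow_Suc_right o_apply mstep_avoid_indicator if_False)
  also have "\<dots> = (\<Sum>i. W i k * occupation i)" by (rule suminf_mstep_avoid)
  finally show ?thesis by (simp add: mult.commute)
qed

text \<open>The mirror image of \<open>hit_le\<close>: truncated occupation stays below u / u_s by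
  induction, peeling the last step and using invariance of u. At s the two sides agree.\<close>

lemma occupation_le: "occupation k \<le> inverse (u s) * u k"
  unfolding occupation_def
proof (rule suminf_le_ennrealI)
  fix N
  show "(\<Sum>n<N. (mstep A ^^ n) (indicator {k}) s) \<le> inverse (u s) * u k"
  proof (induction N arbitrary: k)
    case (Suc N)
    show ?case
    proof (cases "k = s")
      case True
      have "(\<Sum>n<Suc N. (mstep A ^^ n) (indicator {k}) s) \<le> occupation k"
        unfolding occupation_def by (intro sum_le_suminf summableI) auto
      then show ?thesis using True by (simp only: occupation_s inverse_u)
    next
      case False
      have "(\<Sum>n<Suc N. (mstep A ^^ n) (indicator {k}) s) = (\<Sum>n<N. (mstep A ^^ Suc n) (indicator {k}) s)"
        unfolding sum.lessThan_Suc_shift using False by simp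
      also have "\<dots> = (\<Sum>n<N. (mstep A ^^ n) (\<lambda>i. W i k) s)"
        using False by (simp only: funpow_Suc_right o_apply mstep_avoid_indicator if_False)
      also have "\<dots> = (\<Sum>n<N. \<Sum>i. W i k * (mstep A ^^ n) (indicator {i}) s)"
        by (subst mstep_pow_expand) rule
      also have "\<dots> = (\<Sum>i. W i k * (\<Sum>n<N. (mstep A ^^ n) (indicator {i}) s))"
        by (subst suminf_sum[symmetric]) (simp_all only: summableI sum_distrib_left)
      also have "\<dots> \<le> (\<Sum>i. W i k * (inverse (u s) * u i))"
        by (intro suminf_le summableI mult_left_mono Suc) auto
      also have "\<dots> = inverse (u s) * (\<Sum>i. u i * W i k)"
        by (simp only: ennreal_suminf_cmult[symmetric] mult_ac)
      finally show ?thesis by (simp only: u_inv)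
    qed
  qed simp
qed

lemma occupation_eq: "occupation k = inverse (u s) * u k"
proof (cases "k \<in> S")
  case True
  show ?thesis
  proof (rule ccontr)
    assume "occupation k \<noteq> inverse (u s) * u k"
    with occupation_le[of k] have "occupation k < inverse (u s) * u k" by simp
    then obtain d where d: "0 < d" "inverse (u s) * u k = occupation k + d" by (rule ennreal_less_imp_add)
    obtain n where n: "0 < (mstep W ^^ n) (indicator {s}) k" using irred[OF True s] by blast
    let ?p = "\<lambda>i. (mstep W ^^ n) (indicator {s}) i"
    have inv: "(\<Sum>i. (inverse (u s) * u i) * W i k) = inverse (u s) * u k" for k
      by (simp only: mult.assoc ennreal_suminf_cmult u_inv)
    have le: "occupation i + d * indicator {k} i \<le> inverse (u s) * u i" for i
      using d occupation_le[of i] by (cases "i = k") auto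
    have "(\<Sum>i. occupation i * ?p i) = (\<Sum>i. occupation i * indicator {s} i)" by (rule left_invariant_pow[OF occupation_inv])
    also have "\<dots> = 1" by (subst suminf_finite[of "{s}"]) (auto simp: occupation_s)
    finally have 1: "(\<Sum>i. occupation i * ?p i) = 1" .
    have "(\<Sum>i. (inverse (u s) * u i) * ?p i) = (\<Sum>i. (inverse (u s) * u i) * indicator {s} i)" by (rule left_invariant_pow[OF inv])
    also have "\<dots> = 1" by (subst suminf_finite[of "{s}"]) (auto simp: inverse_u)
    finally have 2: "(\<Sum>i. (inverse (u s) * u i) * ?p i) = 1" .
    have 3: "(\<Sum>i. (d * indicator {k} i) * ?p i) = d * ?p k"
      by (subst suminf_finite[of "{k}"]) auto
    have "(\<Sum>i. (occupation i + d * indicator {k} i) * ?p i) = 1 + d * ?p k"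
      using 1 3 by (simp only: distrib_right suminf_add[OF summableI summableI, symmetric])
    moreover have "(\<Sum>i. (occupation i + d * indicator {k} i) * ?p i) \<le> (\<Sum>i. (inverse (u s) * u i) * ?p i)"
      by (intro suminf_le summableI mult_right_mono le) auto
    ultimately have "1 + d * ?p k \<le> 1 + 0" using 2 by simp
    then have "d * ?p k \<le> 0" by (subst (asm) ennreal_add_left_cancel_le) simp
    then show False using d n by auto
  qed
next
  case False
  then have "(\<Sum>i. occupation i * W i k) = 0" by (simp add: W_supp)
  then show ?thesis using False occupation_inv[of k] by (simp add: u_supp)
qed

text \<open>The contribution of one step from i to the mean position at the entrance: each step to k
  carries the mass \<open>hit s W k\<close> with which the path still reaches s.\<close>

definition mean_weight :: "(real \<Rightarrow> real) \<Rightarrow> nat \<Rightarrow> ennreal" where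
  "mean_weight \<phi> i = (\<integral>\<^sup>+k. W i k * (hit s W k * (\<integral>\<^sup>+y. ennreal (\<phi> y) \<partial>F i k)) \<partial>count_space UNIV)"

lemma mean_weight_split:
  "mean_weight \<phi> i = W i s * (\<integral>\<^sup>+y. ennreal (\<phi> y) \<partial>F i s)
    + (\<integral>\<^sup>+k. A i k * (hit s W k * (\<integral>\<^sup>+y. ennreal (\<phi> y) \<partial>F i k)) \<partial>count_space UNIV)"
  using mstep_split[of "\<lambda>_. W i" "\<lambda>k. hit s W k * (\<integral>\<^sup>+y. ennreal (\<phi> y) \<partial>F i k)" i s]
  unfolding mean_weight_def mstep_def avoid_def by (simp add: hit_s)

section \<open>Wald's identity for nonnegative increments\<close>

context
  fixes \<phi> :: "real \<Rightarrow> real"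
  assumes \<phi>: "\<phi> \<in> borel_measurable borel" and \<phi>_nonneg: "\<And>y. 0 \<le> \<phi> y"
begin

text \<open>Functions affine in the position stay affine under a step; nonnegativity of x and \<phi>
  is what makes the sum split in \<open>ennreal\<close>.\<close>

lemma step_linear:
  assumes "0 \<le> x"
  shows "step \<phi> V (\<lambda>k x. ennreal x * p k + q k) i x
    = ennreal x * mstep V p i + (\<integral>\<^sup>+k. V i k * (p k * (\<integral>\<^sup>+y. ennreal (\<phi> y) \<partial>F i k)) \<partial>count_space UNIV) + mstep V q i"
proof -
  have "(\<integral>\<^sup>+y. ennreal (x + \<phi> y) * p k + q k \<partial>F i k) = ennreal x * p k + (p k * (\<integral>\<^sup>+y. ennreal (\<phi> y) \<partial>F i k)) + q k" for k
  proof -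
    note [measurable] = \<phi>
    have "(\<integral>\<^sup>+y. ennreal (x + \<phi> y) * p k + q k \<partial>F i k) = (\<integral>\<^sup>+y. (ennreal x * p k + ennreal (\<phi> y) * p k) + q k \<partial>F i k)"
      by (simp only: ennreal_plus[OF assms \<phi>_nonneg] distrib_right)
    also have "\<dots> = ennreal x * p k + (p k * (\<integral>\<^sup>+y. ennreal (\<phi> y) \<partial>F i k)) + q k"
      by (simp add: nn_integral_add nn_integral_multc nn_integral_cmult mult.commute)
    finally show ?thesis .
  qed
  then have "step \<phi> V (\<lambda>k x. ennreal x * p k + q k) i x
      = (\<integral>\<^sup>+k. (ennreal x * (V i k * p k) + V i k * (p k * (\<integral>\<^sup>+y. ennreal (\<phi> y) \<partial>F i k))) + V i k * q k \<partial>count_space UNIV)"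
    unfolding step_def by (simp add: distrib_left mult_ac)
  then show ?thesis by (simp add: nn_integral_add nn_integral_cmult mstep_def)
qed

lemma step_enter_linear:
  assumes "0 \<le> x"
  shows "step \<phi> (enter s W) (\<lambda>_. ennreal) i x = ennreal x * W i s + W i s * (\<integral>\<^sup>+y. ennreal (\<phi> y) \<partial>F i s)"
proof -
  have "step \<phi> (enter s W) (\<lambda>k x. ennreal x * 1 + 0) i x = ennreal x * W i s + W i s * (\<integral>\<^sup>+y. ennreal (\<phi> y) \<partial>F i s)"
    unfolding step_linear[OF assms] mstep_enter
    using mstep_enter[of s "\<lambda>_. W i" "\<lambda>k. \<integral>\<^sup>+y. ennreal (\<phi> y) \<partial>F i k" i]
    by (simp add: mstep_def enter_def)
  then show ?thesis by simp
qed

lemma entrance_linear: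
  assumes "0 \<le> x"
  shows "entrance \<phi> s W ennreal i x = ennreal x * hit s W i + entrance \<phi> s W ennreal i 0"
proof -
  have "entrance \<phi> s W ennreal i x = entrance \<phi> s W (\<lambda>z. ennreal (z + x)) i 0"
    using entrance_translate[of \<phi> s W ennreal x i 0] by simp
  also have "\<dots> = entrance \<phi> s W (\<lambda>z. ennreal x + ennreal z) i 0"
    by (rule entrance_cong_on[of "{0..}"]) (use assms \<phi>_nonneg in \<open>auto simp: add.commute\<close>)
  also have "\<dots> = ennreal x * hit s W i + entrance \<phi> s W ennreal i 0"
    by (subst entrance_add) (auto simp: \<phi> entrance_const)
  finally show ?thesis .
qed

lemma entrance_linear_fixpoint:
  "entrance \<phi> s W ennreal i 0 = mean_weight \<phi> i + mstep A (\<lambda>i. entrance \<phi> s W ennreal i 0) i"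
proof -
  have "step \<phi> A (entrance \<phi> s W ennreal) i 0 = step \<phi> A (\<lambda>k x. ennreal x * hit s W k + entrance \<phi> s W ennreal k 0) i 0"
    by (rule step_cong_on[of "{0..}"]) (use \<phi>_nonneg in \<open>auto intro: entrance_linear\<close>)
  then show ?thesis
    by (subst entrance_unfold) (simp_all add: \<phi> step_linear step_enter_linear mean_weight_split add.assoc)
qed

text \<open>The mean position at the entrance accumulates step by step. One bound follows the
  partial sums with the affine majorant x * \<open>hit\<close> + T, an inductive hypothesis for all
  x >= 0; the other is minimality of the series.\<close>

lemma entrance_linear_eq: "entrance \<phi> s W ennreal i 0 = (\<Sum>n. (mstep A ^^ n) (mean_weight \<phi>) i)"
proof (rule antisym)
  define T where "T i = (\<Sum>n. (mstep A ^^ n) (mean_weight \<phi>) i)" for i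
  have T: "T i = mean_weight \<phi> i + mstep A T i" for i
    unfolding T_def by (rule mstep_pow_suminf_unfold)
  let ?B = "step \<phi> (enter s W) (\<lambda>_. ennreal)"
  have mB: "meas ((step \<phi> A ^^ n) ?B)" for n by (intro meas_step_pow meas_enter \<phi>) simp
  have "(\<Sum>n<N. (step \<phi> A ^^ n) ?B i x) \<le> ennreal x * hit s W i + T i" if "0 \<le> x" for N x i
    using that
  proof (induction N arbitrary: i x)
    case (Suc N)
    have le: "step \<phi> A (\<lambda>k x. \<Sum>n<N. (step \<phi> A ^^ n) ?B k x) i x \<le> step \<phi> A (\<lambda>k x. ennreal x * hit s W k + T k) i x"
      by (rule step_mono_on[of "{0..}"]) (use Suc \<phi>_nonneg in auto)
    have "(\<Sum>n<Suc N. (step \<phi> A ^^ n) ?B i x) = ?B i x + step \<phi> A (\<lambda>k x. \<Sum>n<N. (step \<phi> A ^^ n) ?B k x) i x"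
      unfolding sum.lessThan_Suc_shift by (subst step_sum[OF mB \<phi>]) simp
    also have "\<dots> \<le> ?B i x + step \<phi> A (\<lambda>k x. ennreal x * hit s W k + T k) i x"
      by (intro add_left_mono le)
    also have "\<dots> = ennreal x * (W i s + mstep A (hit s W) i) + (mean_weight \<phi> i + mstep A T i)"
      unfolding step_linear[OF Suc.prems] step_enter_linear[OF Suc.prems] mean_weight_split
      by (simp only: distrib_left add_ac)
    also have "\<dots> = ennreal x * hit s W i + T i" by (simp only: hit_unfold[symmetric] T[symmetric])
    finally show ?case .
  qed simp
  from this[of 0] show "entrance \<phi> s W ennreal i 0 \<le> (\<Sum>n. (mstep A ^^ n) (mean_weight \<phi>) i)"
    unfolding entrance_def T_def[symmetric] by (intro suminf_le_ennrealI) simp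
  show "(\<Sum>n. (mstep A ^^ n) (mean_weight \<phi>) i) \<le> entrance \<phi> s W ennreal i 0"
    by (rule mstep_pow_suminf_least) (simp only: entrance_linear_fixpoint[symmetric])
qed

text \<open>Sum the one-step contributions over an excursion: the occupation measure is u / u_s and
  the completion mass is v / v_s, which produces the two inverse factors.\<close>

lemma entrance_mean:
  "entrance \<phi> s W ennreal s 0 = inverse (u s) * inverse (v s) * (\<Sum>i. \<Sum>k. u i * W i k * v k * (\<integral>\<^sup>+y. ennreal (\<phi> y) \<partial>F i k))"
proof -
  have "entrance \<phi> s W ennreal s 0 = (\<Sum>i. mean_weight \<phi> i * (inverse (u s) * u i))"
    unfolding entrance_linear_eq suminf_mstep_avoid occupation_eq ..
  also have "\<dots> = (\<Sum>i. inverse (u s) * inverse (v s) * (\<Sum>k. u i * W i k * v k * (\<integral>\<^sup>+y. ennreal (\<phi> y) \<partial>F i k)))"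
    unfolding mean_weight_def nn_integral_count_space_nat hit_eq
    by (intro arg_cong[where f=suminf] ext, subst mult.commute) (simp only: ennreal_suminf_cmult[symmetric] mult_ac)
  finally show ?thesis by (simp only: ennreal_suminf_cmult)
qed

end

text \<open>
  Running the walk with increments \<open>(x\<^sup>+, x\<^sup>-)\<close> in the plane makes Wald's identity available for
  nonnegative quantities only, so that no integrability of the positive part is needed.
\<close>

lemma entrance_pos_neg:
  defines "pos \<equiv> \<lambda>y::real. max y 0" and "neg \<equiv> \<lambda>y::real. max (- y) 0"
  shows "entrance (\<lambda>y. y) s W (\<lambda>x. ennreal (pos x)) s 0 + entrance neg s W ennreal s 0
       = entrance (\<lambda>y. y) s W (\<lambda>x. ennreal (neg x)) s 0 + entrance pos s W ennreal s 0"
    and "entrance (\<lambda>y. y) s W (\<lambda>x. ennreal (neg x)) s 0 \<le> entrance neg s W ennreal s 0"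
proof -
  define \<phi> where "\<phi> y = (pos y, neg y)" for y
  have [measurable]: "pos \<in> borel_measurable borel" "neg \<in> borel_measurable borel"
    unfolding pos_def neg_def by measurable
  have \<phi>: "\<phi> \<in> borel_measurable borel" unfolding \<phi>_def borel_prod[symmetric] by measurable
  have diff: "fst (\<phi> y) - snd (\<phi> y) = y" for y by (simp add: \<phi>_def pos_def neg_def max_def)
  let ?E = "\<lambda>f. entrance \<phi> s W f s (0 :: real \<times> real)"
  have p: "?E (\<lambda>z. ennreal (pos (fst z - snd z))) = entrance (\<lambda>y. y) s W (\<lambda>x. ennreal (pos x)) s 0"
    using entrance_project[of "\<lambda>z. fst z - snd z" \<phi> s W "\<lambda>x. ennreal (pos x)" s 0] by (simp add: diff)
  have n: "?E (\<lambda>z. ennreal (neg (fst z - snd z))) = entrance (\<lambda>y. y) s W (\<lambda>x. ennreal (neg x)) s 0"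
    using entrance_project[of "\<lambda>z. fst z - snd z" \<phi> s W "\<lambda>x. ennreal (neg x)" s 0] by (simp add: diff)
  have f: "?E (\<lambda>z. ennreal (fst z)) = entrance pos s W ennreal s 0"
    using entrance_project[of fst \<phi> s W ennreal s 0] by (simp add: \<phi>_def)
  have g: "?E (\<lambda>z. ennreal (snd z)) = entrance neg s W ennreal s 0"
    using entrance_project[of snd \<phi> s W ennreal s 0] by (simp add: \<phi>_def)
  have [measurable]: "(\<lambda>z::real \<times> real. fst z) \<in> borel_measurable borel" "(\<lambda>z::real \<times> real. snd z) \<in> borel_measurable borel"
    by (simp_all add: borel_measurable_continuous_onI continuous_on_fst continuous_on_snd)
  have orthant: "x + \<phi> y \<in> {z. 0 \<le> fst z \<and> 0 \<le> snd z}" if "x \<in> {z. 0 \<le> fst z \<and> 0 \<le> snd z}" for x y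
    using that by (auto simp: \<phi>_def pos_def neg_def)
  have "?E (\<lambda>z. ennreal (pos (fst z - snd z)) + ennreal (snd z)) = ?E (\<lambda>z. ennreal (neg (fst z - snd z)) + ennreal (fst z))"
  proof (rule entrance_cong_on[OF _ orthant])
    fix z :: "real \<times> real" assume z: "z \<in> {z. 0 \<le> fst z \<and> 0 \<le> snd z}"
    have "ennreal (pos (fst z - snd z)) + ennreal (snd z) = ennreal (pos (fst z - snd z) + snd z)"
      using z by (intro ennreal_plus[symmetric]) (auto simp: pos_def)
    also have "pos (fst z - snd z) + snd z = neg (fst z - snd z) + fst z" by (simp add: pos_def neg_def max_def)
    also have "ennreal \<dots> = ennreal (neg (fst z - snd z)) + ennreal (fst z)"
      using z by (intro ennreal_plus) (auto simp: neg_def)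
    finally show "ennreal (pos (fst z - snd z)) + ennreal (snd z) = ennreal (neg (fst z - snd z)) + ennreal (fst z)" .
  qed auto
  then show "entrance (\<lambda>y. y) s W (\<lambda>x. ennreal (pos x)) s 0 + entrance neg s W ennreal s 0
       = entrance (\<lambda>y. y) s W (\<lambda>x. ennreal (neg x)) s 0 + entrance pos s W ennreal s 0"
    unfolding p[symmetric] n[symmetric] f[symmetric] g[symmetric]
    by (subst (1 2) entrance_add[OF _ _ \<phi>, symmetric]) simp_all
  \<comment> \<open>\<open>entrance_mono\<close> asks for an inequality on the whole plane, while
    this one holds on the quadrant. The minimum gives a function that is dominated everywhere and
    agrees on the quadrant.\<close>
  have "?E (\<lambda>z. ennreal (neg (fst z - snd z))) = ?E (\<lambda>z. min (ennreal (neg (fst z - snd z))) (ennreal (snd z)))"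
  proof (rule entrance_cong_on[OF _ orthant])
    fix z :: "real \<times> real" assume "z \<in> {z. 0 \<le> fst z \<and> 0 \<le> snd z}"
    then have "ennreal (neg (fst z - snd z)) \<le> ennreal (snd z)" by (intro ennreal_leI) (auto simp: neg_def)
    then show "ennreal (neg (fst z - snd z)) = min (ennreal (neg (fst z - snd z))) (ennreal (snd z))" by (simp add: min_def)
  qed auto
  also have "\<dots> \<le> ?E (\<lambda>z. ennreal (snd z))" by (intro entrance_mono) simp
  finally show "entrance (\<lambda>y. y) s W (\<lambda>x. ennreal (neg x)) s 0 \<le> entrance neg s W ennreal s 0"
    by (simp only: n g)
qed

end

section \<open>The first entrance law as a measure\<close>

context additive_kernel
begin

lemma step_cmult:
  fixes f :: "nat \<Rightarrow> 'b :: {real_normed_vector, second_countable_topology} \<Rightarrow> ennreal"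
  assumes f: "meas f" and \<phi>: "\<phi> \<in> borel_measurable borel"
  shows "step \<phi> W (\<lambda>k x. c * f k x) i x = c * step \<phi> W f i x"
  unfolding step_def
  by (simp add: nn_integral_cmult meas_shift[OF f \<phi>] mult.left_commute)

lemma step_pow_cmult:
  fixes f :: "nat \<Rightarrow> 'b :: {real_normed_vector, second_countable_topology} \<Rightarrow> ennreal"
  assumes "meas f" "\<phi> \<in> borel_measurable borel"
  shows "(step \<phi> W ^^ n) (\<lambda>k x. c * f k x) = (\<lambda>i x. c * (step \<phi> W ^^ n) f i x)"
  using assms by (induction n) (auto intro!: ext simp: step_cmult meas_step_pow)

lemma entrance_cmult:
  fixes f :: "'b :: {real_normed_vector, second_countable_topology} \<Rightarrow> ennreal"
  assumes "f \<in> borel_measurable borel" "\<phi> \<in> borel_measurable borel"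
  shows "entrance \<phi> s W (\<lambda>x. c * f x) i x = c * entrance \<phi> s W f i x"
proof -
  have "step \<phi> (enter s W) (\<lambda>_ x. c * f x) = (\<lambda>i x. c * step \<phi> (enter s W) (\<lambda>_. f) i x)"
    using assms by (intro ext step_cmult) (auto simp: meas_def)
  then show ?thesis
    unfolding entrance_def using assms by (simp add: step_pow_cmult meas_enter ennreal_suminf_cmult)
qed

lemma step_SUP:
  fixes f :: "nat \<Rightarrow> nat \<Rightarrow> 'b :: {real_normed_vector, second_countable_topology} \<Rightarrow> ennreal"
  assumes f: "\<And>n. meas (f n)" and \<phi>: "\<phi> \<in> borel_measurable borel" and inc: "\<And>m n k x. m \<le> n \<Longrightarrow> f m k x \<le> f n k x"
  shows "step \<phi> W (\<lambda>k x. SUP n. f n k x) i x = (SUP n. step \<phi> W (f n) i x)"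
proof -
  have "(\<integral>\<^sup>+y. (SUP n. f n k (x + \<phi> y)) \<partial>F i k) = (SUP n. \<integral>\<^sup>+y. f n k (x + \<phi> y) \<partial>F i k)" for k
    by (rule nn_integral_monotone_convergence_SUP) (auto simp: incseq_def le_fun_def inc intro: meas_shift[OF f \<phi>])
  then have "step \<phi> W (\<lambda>k x. SUP n. f n k x) i x = (\<integral>\<^sup>+k. (SUP n. W i k * (\<integral>\<^sup>+y. f n k (x + \<phi> y) \<partial>F i k)) \<partial>count_space UNIV)"
    unfolding step_def by (simp only: SUP_mult_left_ennreal)
  also have "\<dots> = (SUP n. step \<phi> W (f n) i x)"
    unfolding step_def
    by (rule nn_integral_monotone_convergence_SUP)
       (auto simp: incseq_def le_fun_def intro!: mult_left_mono nn_integral_mono inc)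
  finally show ?thesis .
qed

lemma step_pow_SUP:
  fixes f :: "nat \<Rightarrow> nat \<Rightarrow> 'b :: {real_normed_vector, second_countable_topology} \<Rightarrow> ennreal"
  assumes f: "\<And>n. meas (f n)" and \<phi>: "\<phi> \<in> borel_measurable borel" and inc: "\<And>m n k x. m \<le> n \<Longrightarrow> f m k x \<le> f n k x"
  shows "(step \<phi> W ^^ N) (\<lambda>k x. SUP n. f n k x) = (\<lambda>i x. SUP n. (step \<phi> W ^^ N) (f n) i x)"
  by (induction N) (auto intro!: ext simp: step_SUP[OF meas_step_pow[OF f \<phi>] \<phi> step_pow_mono[OF inc]])

lemma entrance_SUP:
  fixes f :: "nat \<Rightarrow> 'b :: {real_normed_vector, second_countable_topology} \<Rightarrow> ennreal"
  assumes f: "\<And>n. f n \<in> borel_measurable borel" and \<phi>: "\<phi> \<in> borel_measurable borel" and inc: "\<And>m n x. m \<le> n \<Longrightarrow> f m x \<le> f n x"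
  shows "entrance \<phi> s W (\<lambda>x. SUP n. f n x) i x = (SUP n. entrance \<phi> s W (f n) i x)"
proof -
  have B: "step \<phi> (enter s W) (\<lambda>_ x. SUP n. f n x) = (\<lambda>i x. SUP n. step \<phi> (enter s W) (\<lambda>_. f n) i x)"
    using f by (intro ext step_SUP \<phi> inc) (auto simp: meas_def)
  have inc': "step \<phi> (enter s W) (\<lambda>_. f m) i x \<le> step \<phi> (enter s W) (\<lambda>_. f n) i x" if "m \<le> n" for m n i x
    using that by (intro step_mono inc)
  have "entrance \<phi> s W (\<lambda>x. SUP n. f n x) i x = (\<Sum>N. SUP n. (step \<phi> (avoid s W) ^^ N) (step \<phi> (enter s W) (\<lambda>_. f n)) i x)"
    unfolding entrance_def B by (simp only: step_pow_SUP[OF meas_enter[OF f \<phi>] \<phi> inc'])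
  also have "\<dots> = (SUP n. entrance \<phi> s W (f n) i x)"
    unfolding entrance_def by (rule ennreal_suminf_SUP_eq) (auto simp: incseq_def intro!: step_pow_mono inc')
  finally show ?thesis .
qed

text \<open>\<open>entrance\<close> is positive and countably additive in f, so its values on
  indicators define a measure, and the usual induction extends the formula to all f. By translation
  invariance the measure from x = 0 serves every x.\<close>

lemma entrance_measure:
  obtains \<kappa> :: "real measure" where "sets \<kappa> = sets borel"
    "\<And>f x. f \<in> borel_measurable borel \<Longrightarrow> (\<integral>\<^sup>+z. f (x + z) \<partial>\<kappa>) = entrance (\<lambda>y. y) s W f i x"
proof -
  have id: "(\<lambda>y::real. y) \<in> borel_measurable borel" by simp
  let ?G = "\<lambda>f. entrance (\<lambda>y. y) s W f i (0 :: real)"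
  define \<kappa> where "\<kappa> = measure_of UNIV (sets (borel :: real measure)) (\<lambda>E. ?G (indicator E))"
  have sets: "sets \<kappa> = sets borel"
    unfolding \<kappa>_def using sets.sigma_sets_eq[of "borel :: real measure"] by (subst sets_measure_of) auto
  have em: "emeasure \<kappa> E = ?G (indicator E)" if "E \<in> sets borel" for E
    unfolding \<kappa>_def
  proof (rule emeasure_measure_of_sigma)
    show "sigma_algebra UNIV (sets (borel :: real measure))"
      using sets.sigma_algebra_axioms[of "borel :: real measure"] by simp
    show "positive (sets borel) (\<lambda>E. ?G (indicator E))"
      using entrance_const[of "\<lambda>y. y" s W 0 i 0] by (simp add: positive_def indicator_def[abs_def])
    show "countably_additive (sets borel) (\<lambda>E. ?G (indicator E))"
    proof (rule countably_additiveI)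
      fix D :: "nat \<Rightarrow> real set" assume D: "range D \<subseteq> sets borel" "disjoint_family D"
      have "(\<Sum>n. ?G (indicator (D n))) = ?G (\<lambda>x. \<Sum>n. indicator (D n) x)"
        using D by (intro entrance_suminf[symmetric] id) auto
      also have "(\<lambda>x. \<Sum>n. indicator (D n) x :: ennreal) = indicator (\<Union>n. D n)"
        using suminf_indicator[OF D(2)] by auto
      finally show "(\<Sum>n. ?G (indicator (D n))) = ?G (indicator (\<Union>n. D n))" .
    qed
  qed (rule that)
  have int: "(\<integral>\<^sup>+z. f z \<partial>\<kappa>) = ?G f" if "f \<in> borel_measurable borel" for f
    using that
  proof (induction rule: borel_measurable_induct)
    case (cong f g)
    then have "f = g" by auto
    then show ?case using cong by simp
  next
    case (set E)
    then show ?case using em[of E] sets by simp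
  next
    case (mult f c)
    then show ?case using sets by (simp add: entrance_cmult id nn_integral_cmult measurable_cong_sets[OF sets refl])
  next
    case (add f g)
    then show ?case using sets by (simp add: entrance_add id nn_integral_add measurable_cong_sets[OF sets refl])
  next
    case (seq U)
    have inc: "U m x \<le> U n x" if "m \<le> n" for m n x using seq(3) that by (auto simp: incseq_def le_fun_def)
    have "(\<integral>\<^sup>+z. (SUP n. U n z) \<partial>\<kappa>) = (SUP n. \<integral>\<^sup>+z. U n z \<partial>\<kappa>)"
      using seq by (intro nn_integral_monotone_convergence_SUP) (auto simp: measurable_cong_sets[OF sets refl])
    also have "\<dots> = (SUP n. ?G (U n))" using seq by simp
    also have "\<dots> = ?G (\<lambda>x. SUP n. U n x)" using seq by (intro entrance_SUP[symmetric] id inc) auto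
    finally show ?case by (simp add: SUP_apply[abs_def])
  qed
  show thesis
  proof (rule that[OF sets])
    fix f :: "real \<Rightarrow> ennreal" and x assume f: "f \<in> borel_measurable borel"
    then have "(\<integral>\<^sup>+z. f (z + x) \<partial>\<kappa>) = ?G (\<lambda>z. f (z + x))" by (intro int) simp
    then show "(\<integral>\<^sup>+z. f (x + z) \<partial>\<kappa>) = entrance (\<lambda>y. y) s W f i x"
      using entrance_translate[of "\<lambda>y. y" s W f x i 0] by (simp add: add.commute)
  qed
qed

end

section \<open>Lattice spans\<close>

definition lattice :: "real \<Rightarrow> real set" where
  "lattice d = range (\<lambda>k::int. d * of_int k)"

lemma lattice_0 [simp]: "0 \<in> lattice d"
  unfolding lattice_def by (rule image_eqI[of _ _ 0]) auto

lemma lattice_mult [simp]: "d * of_int k \<in> lattice d"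
  unfolding lattice_def by (rule rangeI)

lemma lattice_add: "x \<in> lattice d \<Longrightarrow> y \<in> lattice d \<Longrightarrow> x + y \<in> lattice d"
  unfolding lattice_def by (auto simp: distrib_left[symmetric] simp flip: of_int_add)

lemma lattice_uminus: "x \<in> lattice d \<Longrightarrow> - x \<in> lattice d"
  unfolding lattice_def by (auto simp: mult_minus_right[symmetric] simp del: mult_minus_right simp flip: of_int_minus)

lemma lattice_diff: "x \<in> lattice d \<Longrightarrow> y \<in> lattice d \<Longrightarrow> x - y \<in> lattice d"
  using lattice_add[of x d "- y"] lattice_uminus[of y d] by simp

lemma lattice_add_iff: "x \<in> lattice d \<Longrightarrow> x + y \<in> lattice d \<longleftrightarrow> y \<in> lattice d"
  using lattice_add[of x d y] lattice_diff[of "x + y" d x] by auto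

lemma countable_lattice: "countable (lattice d)"
  unfolding lattice_def by (rule countable_image[OF countableI_type])

lemma lattice_borel [measurable]: "lattice d \<in> sets borel"
  by (rule sets.countable[OF _ countable_lattice]) simp

lemma lattice_shift_eq: "range (\<lambda>k::int. c + d * of_int k) = {y. y - c \<in> lattice d}"
  unfolding lattice_def by (auto simp: image_iff algebra_simps)

context recurrent_kernel
begin

lemma id_borel: "(\<lambda>y::real. y) \<in> borel_measurable borel"
  by simp

text \<open>The pairs (i, x) with x - \<gamma> i + \<gamma> s in the lattice form a set that almost
  no step leaves; a function vanishing there does so after one step. At state s the condition says
  that x is in the lattice.\<close>

lemma step_vanish_on_lattice:
  assumes inc: "\<And>k. V i k \<noteq> 0 \<Longrightarrow> AE y in F i k. y - (\<gamma> k - \<gamma> i) \<in> lattice d"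
    and g: "\<And>k z. V i k \<noteq> 0 \<Longrightarrow> z - \<gamma> k + \<gamma> s \<in> lattice d \<Longrightarrow> g k z = 0"
    and x: "x - \<gamma> i + \<gamma> s \<in> lattice d"
  shows "step (\<lambda>y. y) V g i x = 0"
proof -
  have "V i k * (\<integral>\<^sup>+y. g k (x + y) \<partial>F i k) = 0" for k
  proof (cases "V i k = 0")
    case False
    have "AE y in F i k. g k (x + y) = 0"
      using inc[OF False]
    proof eventually_elim
      case (elim y)
      have "(x + y) - \<gamma> k + \<gamma> s = (x - \<gamma> i + \<gamma> s) + (y - (\<gamma> k - \<gamma> i))" by simp
      also have "\<dots> \<in> lattice d" by (intro lattice_add x elim)
      finally show ?case by (rule g[OF False])
    qed
    then have "(\<integral>\<^sup>+y. g k (x + y) \<partial>F i k) = (\<integral>\<^sup>+y. 0 \<partial>F i k)" by (rule nn_integral_cong_AE)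
    then show ?thesis by simp
  qed simp
  then show ?thesis by (simp only: step_def) simp
qed

lemma entrance_vanish_on_lattice:
  assumes inc: "\<And>i k. W i k \<noteq> 0 \<Longrightarrow> AE y in F i k. y - (\<gamma> k - \<gamma> i) \<in> lattice d"
  shows "entrance (\<lambda>y. y) s W (indicator (- lattice d)) s 0 = 0"
proof -
  have "(step (\<lambda>y. y) A ^^ n) (step (\<lambda>y. y) (enter s W) (\<lambda>_. indicator (- lattice d))) i x = 0"
    if "x - \<gamma> i + \<gamma> s \<in> lattice d" for n i x
    using that
  proof (induction n arbitrary: i x)
    case 0
    have "step (\<lambda>y. y) (enter s W) (\<lambda>_. indicator (- lattice d)) i x = 0"
    proof (rule step_vanish_on_lattice[OF _ _ 0])
      show "enter s W i k \<noteq> 0 \<Longrightarrow> AE y in F i k. y - (\<gamma> k - \<gamma> i) \<in> lattice d" for k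
        using inc[of i k] by (auto simp: enter_def split: if_splits)
      show "enter s W i k \<noteq> 0 \<Longrightarrow> z - \<gamma> k + \<gamma> s \<in> lattice d \<Longrightarrow> indicator (- lattice d) z = 0" for k z
        by (auto simp: enter_def indicator_def split: if_splits)
    qed
    then show ?case by simp
  next
    case (Suc n)
    have "step (\<lambda>y. y) A ((step (\<lambda>y. y) A ^^ n) (step (\<lambda>y. y) (enter s W) (\<lambda>_. indicator (- lattice d)))) i x = 0"
    proof (rule step_vanish_on_lattice[OF _ _ Suc.prems])
      show "A i k \<noteq> 0 \<Longrightarrow> AE y in F i k. y - (\<gamma> k - \<gamma> i) \<in> lattice d" for k
        using inc[of i k] by (auto simp: avoid_def split: if_splits)
    qed (rule Suc.IH)
    then show ?case by simp
  qed
  then show ?thesis unfolding entrance_def by simp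
qed

text \<open>
  The integral \<open>h i x\<close> of the indicator of the complement of the lattice over the first entrance law
  is harmonic, and for each state its zeros form a coset of the lattice; these cosets give the
  shifts \<open>\<gamma>\<close>.
\<close>

lemma lattice_of_entrance:
  assumes d: "0 < d" and null: "entrance (\<lambda>y. y) s W (indicator (- lattice d)) s 0 = 0"
  obtains \<gamma> where "\<And>i. 0 \<le> \<gamma> i" "\<And>i. \<gamma> i < d"
    "\<And>i k. W i k \<noteq> 0 \<Longrightarrow> AE y in F i k. y - (\<gamma> k - \<gamma> i) \<in> lattice d"
proof -
  define f :: "real \<Rightarrow> ennreal" where "f = indicator (- lattice d)"
  define h where "h = entrance (\<lambda>y. y) s W f"
  have f_meas [measurable]: "f \<in> borel_measurable borel" unfolding f_def by measurable
  have f_shift [measurable]: "(\<lambda>z. f (z + x)) \<in> borel_measurable borel" for x by measurable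
  have f_periodic: "f (z + x) = f z" if "x \<in> lattice d" for x z
    using lattice_add_iff[OF that, of z] by (simp add: f_def indicator_def add.commute)
  have h_shift: "h i x = entrance (\<lambda>y. y) s W (\<lambda>z. f (z + x)) i 0" for i x
    using entrance_translate[of "\<lambda>y. y" s W f x i 0] by (simp add: h_def)
  have h_periodic: "h i (z + x) = h i z" if "x \<in> lattice d" for x z i
    using f_periodic[OF that] h_shift[of i "z + x"] h_shift[of i z] by (simp add: add.assoc[symmetric])
  \<comment> \<open>Starting points in different cosets cannot both end in the lattice under the
    same displacement, so their escape masses cover the whole entrance mass. Hence the zeros of
    \<open>h i\<close> lie in one coset.\<close>
  have two: "hit s W i \<le> h i x + h i x'" if "x - x' \<notin> lattice d" for i x x'
  proof -
    have "entrance (\<lambda>y. y) s W (\<lambda>_. 1) i 0 \<le> entrance (\<lambda>y. y) s W (\<lambda>z. f (z + x) + f (z + x')) i 0"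
    proof (rule entrance_mono)
      fix z
      have "\<not> (z + x \<in> lattice d \<and> z + x' \<in> lattice d)" using that lattice_diff[of "z + x" d "z + x'"] by auto
      then show "1 \<le> f (z + x) + f (z + x')" by (auto simp: f_def indicator_def)
    qed
    also have "\<dots> = h i x + h i x'" unfolding h_shift by (rule entrance_add) (simp_all add: f_shift)
    finally show ?thesis by (simp add: entrance_const)
  qed
  have h_le: "h i x \<le> hit s W i" for i x
    using entrance_mono[of f "\<lambda>_. 1" "\<lambda>y. y" s W i x] by (simp add: h_def entrance_const f_def indicator_def)
  have h_s0: "h s 0 = 0" using null by (simp add: h_def f_def)
  have h_s: "h s = f"
  proof
    fix x
    show "h s x = f x"
    proof (cases "x \<in> lattice d")
      case True
      then show ?thesis using h_periodic[OF True, of s 0] h_s0 by (simp add: f_def)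
    next
      case False
      then have "1 \<le> h s x" using two[of x 0 s] h_s0 by (simp add: hit_s)
      then show ?thesis using False h_le[of s x] by (simp add: f_def hit_s antisym)
    qed
  qed
  have mh: "meas h" unfolding h_def by (rule meas_entrance) simp_all
  \<comment> \<open>Because \<open>h s = f\<close>, the value collected on entering s equals the
    value of continuing from s, so the entering and avoiding parts recombine into the full
    step.\<close>
  have harmonic: "h i x = step (\<lambda>y. y) W h i x" for i x
    unfolding step_split[of "\<lambda>y. y" W h i x s] step_enter h_s
    unfolding h_def by (subst entrance_unfold) (simp_all add: step_enter)
  have zero_step: "AE y in F i k. h k (x + y) = 0" if "h i x = 0" "W i k \<noteq> 0" for i k x
  proof -
    have "(\<integral>\<^sup>+k. W i k * (\<integral>\<^sup>+y. h k (x + y) \<partial>F i k) \<partial>count_space UNIV) = 0"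
      using harmonic[of i x] that by (simp add: step_def)
    then have "W i k * (\<integral>\<^sup>+y. h k (x + y) \<partial>F i k) = 0"
      by (subst (asm) nn_integral_0_iff_AE) (auto simp: AE_count_space)
    then have "(\<integral>\<^sup>+y. h k (x + y) \<partial>F i k) = 0" using that by simp
    then show ?thesis using meas_shift[OF mh id_borel, of k x i] by (simp add: nn_integral_0_iff_AE)
  qed
  \<comment> \<open>Zeros propagate along paths of positive weight: from a zero of h almost every
    step with nonzero weight leads to another zero, and almost every means at least one.\<close>
  have reach: "\<exists>x. h k x = 0" if "0 < (mstep W ^^ n) (indicator {k}) i" "\<exists>x. h i x = 0" for n i k
    using that
  proof (induction n arbitrary: i)
    case 0
    then show ?case by (cases "i = k") auto
  next
    case (Suc n)
    have "\<exists>l. W i l \<noteq> 0 \<and> 0 < (mstep W ^^ n) (indicator {k}) l"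
    proof (rule ccontr)
      assume "\<nexists>l. W i l \<noteq> 0 \<and> 0 < (mstep W ^^ n) (indicator {k}) l"
      then have z: "W i l * (mstep W ^^ n) (indicator {k}) l = 0" for l by auto
      have "(mstep W ^^ Suc n) (indicator {k}) i = 0"
        unfolding funpow.simps o_apply mstep_def[of W "(mstep W ^^ n) (indicator {k})"] z by simp
      with Suc.prems show False by simp
    qed
    then obtain l where l: "W i l \<noteq> 0" "0 < (mstep W ^^ n) (indicator {k}) l" by blast
    obtain x where "h i x = 0" using Suc.prems by blast
    then have ae: "AE y in F i l. h l (x + y) = 0" using l by (intro zero_step)
    have "\<exists>y. h l (x + y) = 0"
    proof (rule ccontr)
      assume "\<nexists>y. h l (x + y) = 0"
      then have "AE y in F i l. False" using ae by auto
      then show False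
        using emeasure_F_UNIV[of i l] by (simp add: AE_iff_measurable[OF _ refl])
    qed
    then show ?case using Suc.IH[OF l(2)] by blast
  qed
  have ex0: "\<exists>x. 0 \<le> x \<and> x < d \<and> h i x = 0" if i: "i \<in> S" for i
  proof -
    obtain n where "0 < (mstep W ^^ n) (indicator {i}) s" using irred[OF s i] by blast
    then obtain c where c: "h i c = 0" using reach h_s0 by blast
    have "h i (c + d * of_int (- \<lfloor>c / d\<rfloor>)) = 0" by (simp only: h_periodic[OF lattice_mult] c)
    moreover have "0 \<le> c + d * of_int (- \<lfloor>c / d\<rfloor>)" "c + d * of_int (- \<lfloor>c / d\<rfloor>) < d"
      using d floor_divide_lower[of d c] floor_divide_upper[of d c] by (auto simp: algebra_simps)
    ultimately show ?thesis by blast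
  qed
  define \<gamma> where "\<gamma> i = (if i \<in> S then SOME x. 0 \<le> x \<and> x < d \<and> h i x = 0 else 0)" for i
  have \<gamma>: "0 \<le> \<gamma> i \<and> \<gamma> i < d \<and> (i \<in> S \<longrightarrow> h i (\<gamma> i) = 0)" for i
  proof (cases "i \<in> S")
    case True
    have "0 \<le> \<gamma> i \<and> \<gamma> i < d \<and> h i (\<gamma> i) = 0"
      unfolding \<gamma>_def if_P[OF True] by (rule someI_ex[OF ex0[OF True]])
    then show ?thesis by simp
  qed (simp add: \<gamma>_def d)
  show thesis
  proof (rule that[of \<gamma>])
    fix i k assume W: "W i k \<noteq> 0"
    then have iS: "i \<in> S" and kS: "k \<in> S" using W_supp[of i k] by auto
    have hk: "0 < hit s W k"
      unfolding hit_eq using v_pos[OF kS] inverse_v by (auto simp: zero_less_iff_neq_zero)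
    have "AE y in F i k. h k (\<gamma> i + y) = 0" using zero_step[OF _ W, of "\<gamma> i"] \<gamma>[of i] iS by blast
    then show "AE y in F i k. y - (\<gamma> k - \<gamma> i) \<in> lattice d"
    proof eventually_elim
      case (elim y)
      have "(\<gamma> i + y) - \<gamma> k \<in> lattice d"
      proof (rule ccontr)
        assume "(\<gamma> i + y) - \<gamma> k \<notin> lattice d"
        from two[OF this, of k] elim \<gamma>[of k] kS hk show False by simp
      qed
      then show ?case by (simp add: algebra_simps)
    qed
  qed (use \<gamma> in auto)
qed

end

lemma positive_drift_walkI:
  assumes M: "real_distribution M"
    and neg: "(\<integral>\<^sup>+y. ennreal (max (- y) 0) \<partial>M) < top"
    and less: "(\<integral>\<^sup>+y. ennreal (max (- y) 0) \<partial>M) < (\<integral>\<^sup>+y. ennreal (max y 0) \<partial>M)"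
  shows "positive_drift_walk M"
proof -
  interpret random_walk M using M by (simp add: random_walk_def)
  have negi: "integrable M (\<lambda>y. max (- y) 0)"
    using neg by (intro integrableI_nonneg) auto
  have "(\<lambda>n. \<integral>\<^sup>+y. ennreal (min (max y 0) (real n)) \<partial>M) \<longlonglongrightarrow> (\<integral>\<^sup>+y. ennreal (max y 0) \<partial>M)"
  proof (rule nn_integral_LIMSEQ)
    show "incseq (\<lambda>n y. ennreal (min (max y 0) (real n)))"
      by (auto simp: incseq_def le_fun_def intro!: ennreal_leI)
    show "(\<lambda>n. ennreal (min (max y 0) (real n))) \<longlonglongrightarrow> ennreal (max y 0)" for y
    proof (rule Lim_transform_eventually[OF tendsto_const])
      obtain n0 :: nat where "max y 0 \<le> real n0" using real_arch_simple by blast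
      then show "\<forall>\<^sub>F n in sequentially. ennreal (max y 0) = ennreal (min (max y 0) (real n))"
        by (auto simp: eventually_sequentially min_def intro!: exI[of _ n0])
    qed
  qed measurable
  from order_tendstoD(1)[OF this less] obtain n where
    n: "(\<integral>\<^sup>+y. ennreal (max (- y) 0) \<partial>M) < (\<integral>\<^sup>+y. ennreal (min (max y 0) (real n)) \<partial>M)"
    by (auto simp: eventually_sequentially)
  \<comment> \<open>n may be 0, while the truncation level has to be positive.\<close>
  define K where "K = real n + 1"
  have bd: "bounded_borel (\<lambda>y. min (max y 0) K)"
    by (rule bounded_borelI[where B=K]) (auto simp: K_def)
  have int: "integrable M (\<lambda>y. min (max y 0) K)" by (rule integrable_bounded_borel[OF bd])
  have "ennreal (\<integral>y. max (- y) 0 \<partial>M) = (\<integral>\<^sup>+y. ennreal (max (- y) 0) \<partial>M)"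
    using negi by (intro nn_integral_eq_integral[symmetric]) auto
  also note n
  also have "(\<integral>\<^sup>+y. ennreal (min (max y 0) (real n)) \<partial>M) \<le> (\<integral>\<^sup>+y. ennreal (min (max y 0) K) \<partial>M)"
    by (intro nn_integral_mono ennreal_leI) (auto simp: K_def)
  also have "\<dots> = ennreal (\<integral>y. min (max y 0) K \<partial>M)"
    using int by (intro nn_integral_eq_integral) (auto simp: K_def)
  finally have "(\<integral>y. max (- y) 0 \<partial>M) < (\<integral>y. min (max y 0) K \<partial>M)"
    by (subst (asm) ennreal_less_iff) auto
  moreover have "(\<integral>y. min y K \<partial>M) = (\<integral>y. min (max y 0) K - max (- y) 0 \<partial>M)"
    by (intro Bochner_Integration.integral_cong) (auto simp: K_def min_def max_def)
  ultimately have "0 < (\<integral>y. min y K \<partial>M)" using int negi by simp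
  moreover have "0 < K" by (simp add: K_def)
  ultimately show ?thesis using negi by unfold_locales auto
qed

context positive_drift_walk
begin

lemma ennreal_U:
  "(\<Sum>n. ((\<lambda>g x. \<integral>\<^sup>+z. g (x + z) \<partial>M) ^^ n) (indicator {0<..h}) x) = ennreal (U h x)"
proof -
  note bd = dominated_bounded_borel[OF dominated_interval] and nonneg = P_pow_dominated_nonneg[OF dominated_interval]
  have "((\<lambda>g x. \<integral>\<^sup>+z. g (x + z) \<partial>M) ^^ n) (indicator {0<..h}) = (\<lambda>x. ennreal ((P ^^ n) (indicator {0<..h}) x))" for n
  proof (induction n)
    case (Suc n)
    have "((\<lambda>g x. \<integral>\<^sup>+z. g (x + z) \<partial>M) ^^ Suc n) (indicator {0<..h}) = (\<lambda>x. \<integral>\<^sup>+z. ennreal ((P ^^ n) (indicator {0<..h}) (x + z)) \<partial>M)"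
      using Suc by simp
    also have "\<dots> = (\<lambda>x. ennreal (P ((P ^^ n) (indicator {0<..h})) x))"
      by (intro ext ennreal_P[symmetric] bounded_borel_P_pow bd nonneg)
    finally show ?case by simp
  qed (auto simp: fun_eq_iff indicator_def)
  then show ?thesis unfolding pot_def using summable_pot[OF dominated_interval] nonneg by (simp add: suminf_ennreal2)
qed

end

section \<open>The renewal theorem for recurrent kernels\<close>

context recurrent_kernel
begin

definition drift_sum :: "(real \<Rightarrow> real) \<Rightarrow> ennreal" where
  "drift_sum \<phi> = (\<Sum>i. \<Sum>k. u i * W i k * v k * (\<integral>\<^sup>+y. ennreal (\<phi> y) \<partial>F i k))"

lemma inverse_weight_pos: "0 < inverse (u s) * inverse (v s)"
proof -
  have "inverse (u s) \<noteq> 0" "inverse (v s) \<noteq> 0" using inverse_u inverse_v by auto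
  then show ?thesis by (simp add: zero_less_iff_neq_zero)
qed

lemma inverse_v_fin: "inverse (v s) < top"
  using v_pos[OF s] by (auto simp: less_top[symmetric] zero_less_iff_neq_zero)

lemma inverse_weight_fin: "inverse (u s) * inverse (v s) < top"
proof -
  have "inverse (u s) < top" using u_pos[OF s] by (auto simp: less_top[symmetric] zero_less_iff_neq_zero)
  then show ?thesis using inverse_v_fin by (simp add: ennreal_mult_less_top)
qed

lemma entrance_law:
  obtains \<kappa> where "real_distribution \<kappa>"
    "\<And>f x. f \<in> borel_measurable borel \<Longrightarrow> (\<integral>\<^sup>+z. f (x + z) \<partial>\<kappa>) = entrance (\<lambda>y. y) s W f s x"
    "\<And>f. f \<in> borel_measurable borel \<Longrightarrow> (\<integral>\<^sup>+z. f z \<partial>\<kappa>) = entrance (\<lambda>y. y) s W f s 0"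
proof -
  obtain \<kappa> where sets: "sets \<kappa> = sets borel"
    and \<kappa>: "\<And>f x. f \<in> borel_measurable borel \<Longrightarrow> (\<integral>\<^sup>+z. f (x + z) \<partial>\<kappa>) = entrance (\<lambda>y. y) s W f s x"
    using entrance_measure[where s=s and W=W and i=s] by metis
  have "emeasure \<kappa> (space \<kappa>) = 1"
    using \<kappa>[of "\<lambda>_. 1" 0] by (simp add: entrance_const hit_s)
  then have "real_distribution \<kappa>"
    using sets by (intro real_distribution.intro prob_spaceI real_distribution_axioms.intro)
  then show thesis using \<kappa> \<kappa>[of _ 0] by (intro that[of \<kappa>]) auto
qed

text \<open>R is the convolution of the renewal function of the return walk with the first entrance
  law \<nu> from i, up to the visit at time 0. The renewal function is bounded and \<nu> is finite,
  so its limits pass through the integral and pick up the mass \<open>hit s W i\<close>.\<close>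

theorem potential_limits:
  fixes h :: real and i :: nat
  defines "Dp \<equiv> drift_sum (\<lambda>y. max y 0)" and "Dn \<equiv> drift_sum (\<lambda>y. max (- y) 0)"
    and "c \<equiv> inverse (u s) * inverse (v s)"
    and "R \<equiv> potential (\<lambda>y. y) W (\<lambda>k z. indicator {s} k * indicator {0<..h} z) i"
  assumes fin: "Dn < top" and less: "Dn < Dp" and h: "0 < h"
    and nonlattice: "\<And>d. 0 < d \<Longrightarrow> entrance (\<lambda>y. y) s W (indicator (- lattice d)) s 0 \<noteq> 0"
  shows "(R \<longlongrightarrow> ennreal (h * (if Dp = top then 0 else 1 / (enn2real (c * Dp) - enn2real (c * Dn))) * enn2real (hit s W i))) at_bot"
    and "(R \<longlongrightarrow> 0) at_top"
proof -
  have c_pos: "0 < c" and c_fin: "c < top"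
    unfolding c_def by (rule inverse_weight_pos inverse_weight_fin)+
  define Ep where "Ep = entrance (\<lambda>y. y) s W (\<lambda>x. ennreal (max x 0)) s 0"
  define En where "En = entrance (\<lambda>y. y) s W (\<lambda>x. ennreal (max (- x) 0)) s 0"
  have Dp_eq: "entrance (\<lambda>y. max y 0) s W ennreal s 0 = c * Dp"
    unfolding c_def Dp_def drift_sum_def by (rule entrance_mean) auto
  have Dn_eq: "entrance (\<lambda>y. max (- y) 0) s W ennreal s 0 = c * Dn"
    unfolding c_def Dn_def drift_sum_def by (rule entrance_mean) auto
  \<comment> \<open>Kept additive because Ep and Dp may both be infinite; it is turned into a
    difference only in the finite case.\<close>
  have wald: "Ep + c * Dn = En + c * Dp" and En_le: "En \<le> c * Dn"
    using entrance_pos_neg unfolding Dp_eq Dn_eq Ep_def En_def by auto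
  have cDn_fin: "c * Dn < top" using c_fin fin by (simp add: ennreal_mult_less_top)
  have En_fin: "En < top" using En_le cDn_fin by (rule le_less_trans)
  have cless: "c * Dn < c * Dp" using less c_pos c_fin by (intro ennreal_mult_strict_left_mono) auto
  have En_less: "En < Ep"
  proof (rule ccontr)
    assume "\<not> En < Ep"
    then have "Ep + c * Dn \<le> En + c * Dn" by (intro add_right_mono) simp
    also have "\<dots> < En + c * Dp" using En_fin cless by (simp add: ennreal_add_left_cancel_less)
    finally show False using wald by simp
  qed
  obtain \<kappa> where dist: "real_distribution \<kappa>"
    and \<kappa>: "\<And>f x. f \<in> borel_measurable borel \<Longrightarrow> (\<integral>\<^sup>+z. f (x + z) \<partial>\<kappa>) = entrance (\<lambda>y. y) s W f s x"
    and \<kappa>0: "\<And>f. f \<in> borel_measurable borel \<Longrightarrow> (\<integral>\<^sup>+z. f z \<partial>\<kappa>) = entrance (\<lambda>y. y) s W f s 0"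
    by (rule entrance_law) metis
  have pos: "(\<integral>\<^sup>+y. ennreal (max y 0) \<partial>\<kappa>) = Ep" unfolding Ep_def by (rule \<kappa>0) simp
  have neg: "(\<integral>\<^sup>+y. ennreal (max (- y) 0) \<partial>\<kappa>) = En" unfolding En_def by (rule \<kappa>0) simp
  interpret K: positive_drift_walk \<kappa>
    using dist En_fin En_less pos neg by (intro positive_drift_walkI) auto
  have mean_inv: "K.mean_inv = (if Dp = top then 0 else 1 / (enn2real (c * Dp) - enn2real (c * Dn)))"
  proof (cases "Dp = top")
    case True
    then have "En + c * Dp = top" using c_pos by (auto simp: ennreal_mult_top)
    then have "Ep = top" using wald cDn_fin by (metis ennreal_add_eq_top less_irrefl)
    then show ?thesis using True unfolding K.mean_inv_def K.mean_pos_def pos by simp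
  next
    case False
    then have cDp_fin: "c * Dp < top" using c_fin by (simp add: ennreal_mult_less_top less_top)
    then have "En + c * Dp < top" using En_fin by simp
    then have Ep_fin: "Ep < top" unfolding wald[symmetric] by simp
    have "enn2real (Ep + c * Dn) = enn2real Ep + enn2real (c * Dn)"
      using Ep_fin cDn_fin by (rule enn2real_plus)
    moreover have "enn2real (En + c * Dp) = enn2real En + enn2real (c * Dp)"
      using En_fin cDp_fin by (rule enn2real_plus)
    ultimately have "enn2real Ep - enn2real En = enn2real (c * Dp) - enn2real (c * Dn)"
      using wald by simp
    then show ?thesis using False less_imp_neq[OF Ep_fin] unfolding K.mean_inv_def K.mean_pos_def K.mean_neg_def pos neg by simp
  qed
  have nl: "K.prob (range (\<lambda>k::int. d * of_int k)) \<noteq> 1" if "0 < d" for d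
  proof
    assume "K.prob (range (\<lambda>k::int. d * of_int k)) = 1"
    then have "AE z in \<kappa>. z \<in> lattice d" unfolding lattice_def by (rule K.AE_prob_1)
    then have "AE z in \<kappa>. indicator (- lattice d) z = (0 :: ennreal)" by eventually_elim simp
    then have "(\<integral>\<^sup>+z. indicator (- lattice d) z \<partial>\<kappa>) = (\<integral>\<^sup>+z. 0 \<partial>\<kappa>)" by (rule nn_integral_cong_AE)
    then show False using \<kappa>0[of "indicator (- lattice d)"] nonlattice[OF that] by simp
  qed
  define f :: "nat \<Rightarrow> real \<Rightarrow> ennreal" where "f k z = indicator {s} k * indicator {0<..h} z" for k z
  have mf: "meas f" unfolding meas_def f_def by simp
  have fs: "f s = indicator {0<..h}" by (simp add: f_def fun_eq_iff)
  have R_eq: "R = potential (\<lambda>y. y) W f i" unfolding R_def f_def ..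
  have Kpow: "((\<lambda>g. entrance (\<lambda>y. y) s W g s) ^^ n) (f s) = ((\<lambda>g x. \<integral>\<^sup>+z. g (x + z) \<partial>\<kappa>) ^^ n) (f s) \<and>
      ((\<lambda>g. entrance (\<lambda>y. y) s W g s) ^^ n) (f s) \<in> borel_measurable borel" for n
  proof (induction n)
    case (Suc n)
    let ?g = "((\<lambda>g. entrance (\<lambda>y. y) s W g s) ^^ n) (f s)"
    have m: "?g \<in> borel_measurable borel" by (rule conjunct2[OF Suc])
    have eq: "entrance (\<lambda>y. y) s W ?g s = (\<lambda>x. \<integral>\<^sup>+z. ?g (x + z) \<partial>\<kappa>)" using \<kappa>[OF m] by (auto simp: fun_eq_iff)
    show ?case
    proof
      show "((\<lambda>g. entrance (\<lambda>y. y) s W g s) ^^ Suc n) (f s) = ((\<lambda>g x. \<integral>\<^sup>+z. g (x + z) \<partial>\<kappa>) ^^ Suc n) (f s)"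
        unfolding funpow.simps o_apply eq using Suc by simp
      show "((\<lambda>g. entrance (\<lambda>y. y) s W g s) ^^ Suc n) (f s) \<in> borel_measurable borel"
        unfolding funpow.simps o_apply by (rule measD[OF meas_entrance[OF m id_borel]])
    qed
  qed (use mf in \<open>simp add: meas_def\<close>)
  have pot_s: "potential (\<lambda>y. y) W f s x = ennreal (K.U h x)" for x
  proof -
    have "potential (\<lambda>y. y) W f s x = (\<Sum>n. ((\<lambda>g. entrance (\<lambda>y. y) s W g s) ^^ n) (f s) x)"
      by (rule potential_eq_entrance_pow) (use mf in \<open>auto simp: f_def\<close>)
    also have "\<dots> = (\<Sum>n. ((\<lambda>g x. \<integral>\<^sup>+z. g (x + z) \<partial>\<kappa>) ^^ n) (indicator {0<..h}) x)"
      using Kpow by (simp add: fs)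
    finally show ?thesis by (simp add: K.ennreal_U)
  qed
  obtain \<nu> where setsi: "sets \<nu> = sets borel"
    and \<nu>: "\<And>f x. f \<in> borel_measurable borel \<Longrightarrow> (\<integral>\<^sup>+z. f (x + z) \<partial>\<nu>) = entrance (\<lambda>y. y) s W f i x"
    using entrance_measure[where s=s and W=W and i=i] by metis
  have spacei: "space \<nu> = UNIV" using sets_eq_imp_space_eq[OF setsi] by simp
  have massi: "emeasure \<nu> UNIV = hit s W i"
    using \<nu>[of "\<lambda>_. 1" 0] by (simp add: entrance_const spacei)
  have hit_fin: "hit s W i < top"
    unfolding hit_eq using v_fin[of i] inverse_v_fin by (simp add: ennreal_mult_less_top)
  interpret I: finite_measure \<nu> by standard (use massi hit_fin in \<open>simp add: spacei\<close>)
  obtain B where B: "0 \<le> B" "\<And>x. \<bar>K.U h x\<bar> \<le> B" using K.bounded_borel_pot[OF K.dominated_interval[of h]] by (metis bounded_borelE)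
  have Um [measurable]: "K.U h \<in> borel_measurable borel" using K.bounded_borel_pot[OF K.dominated_interval[of h]] by (simp add: bounded_borel_def)
  have Um': "(\<lambda>z. K.U h (x + z)) \<in> borel_measurable \<nu>" for x
    unfolding measurable_cong_sets[OF setsi refl] by measurable
  have int: "integrable \<nu> (\<lambda>z. K.U h (x + z))" for x
    using B by (intro I.integrable_const_bound[where B=B] Um') auto
  define r where "r x = (\<integral>z. K.U h (x + z) \<partial>\<nu>)" for x
  have r_nonneg: "0 \<le> r x" for x unfolding r_def using K.pot_nonneg[OF K.dominated_interval] by simp
  \<comment> \<open>f i x accounts for time 0. It is nonzero only for i = s and x in (0, h], and so
    disappears in both limits.\<close>
  have R: "R x = f i x + ennreal (r x)" for x
  proof -
    have "R x = f i x + entrance (\<lambda>y. y) s W (potential (\<lambda>y. y) W f s) i x"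
      unfolding R_eq by (rule potential_first_entrance) (use mf in \<open>auto simp: f_def\<close>)
    also have "potential (\<lambda>y. y) W f s = (\<lambda>x. ennreal (K.U h x))" using pot_s by auto
    also have "entrance (\<lambda>y. y) s W (\<lambda>x. ennreal (K.U h x)) i x = (\<integral>\<^sup>+z. ennreal (K.U h (x + z)) \<partial>\<nu>)"
      by (rule \<nu>[symmetric]) measurable
    also have "\<dots> = ennreal (r x)"
      unfolding r_def using int K.pot_nonneg[OF K.dominated_interval] by (intro nn_integral_eq_integral) auto
    finally show ?thesis .
  qed
  have dct: "(\<lambda>n. r (X n)) \<longlonglongrightarrow> l * enn2real (hit s W i)"
    if X: "\<And>z. (\<lambda>n. K.U h (X n + z)) \<longlonglongrightarrow> l" for X l
  proof -
    have "(\<lambda>n. \<integral>z. K.U h (X n + z) \<partial>\<nu>) \<longlonglongrightarrow> (\<integral>z. l \<partial>\<nu>)"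
      by (rule integral_dominated_convergence[where w="\<lambda>_. B"]) (use B X Um' in auto)
    then show ?thesis by (simp add: r_def measure_def massi spacei mult.commute)
  qed
  have r_bot: "(r \<longlongrightarrow> h * K.mean_inv * enn2real (hit s W i)) at_bot"
  proof (rule tendsto_at_botI_sequentially, rule dct)
    fix X :: "nat \<Rightarrow> real" and z assume "filterlim X at_bot sequentially"
    then show "(\<lambda>n. K.U h (X n + z)) \<longlonglongrightarrow> h * K.mean_inv"
      by (intro filterlim_compose[OF K.blackwell[OF nl h]] filterlim_at_bot_add_const)
  qed
  have r_top: "(r \<longlongrightarrow> 0 * enn2real (hit s W i)) at_top"
  proof (rule tendsto_at_topI_sequentially, rule dct)
    fix X :: "nat \<Rightarrow> real" and z assume "filterlim X at_top sequentially"
    then show "(\<lambda>n. K.U h (X n + z)) \<longlonglongrightarrow> 0"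
      by (intro filterlim_compose[OF tendsto_shift_at_top[OF K.pot_tendsto_at_top[OF K.dominated_interval]]])
  qed
  have f_bot: "(f i \<longlongrightarrow> 0) at_bot"
  proof (rule Lim_transform_eventually[OF tendsto_const])
    show "\<forall>\<^sub>F x in at_bot. 0 = f i x"
      using eventually_le_at_bot[of 0] by eventually_elim (simp add: f_def)
  qed
  have f_top: "(f i \<longlongrightarrow> 0) at_top"
  proof (rule Lim_transform_eventually[OF tendsto_const])
    show "\<forall>\<^sub>F x in at_top. 0 = f i x"
      using eventually_gt_at_top[of h] by eventually_elim (simp add: f_def)
  qed
  have "((\<lambda>x. f i x + ennreal (r x)) \<longlongrightarrow> 0 + ennreal (h * K.mean_inv * enn2real (hit s W i))) at_bot"
    by (intro tendsto_add f_bot tendsto_ennrealI r_bot)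
  then show "(R \<longlongrightarrow> ennreal (h * (if Dp = top then 0 else 1 / (enn2real (c * Dp) - enn2real (c * Dn))) * enn2real (hit s W i))) at_bot"
    unfolding mean_inv[symmetric] R[symmetric, abs_def] by simp
  have "((\<lambda>x. f i x + ennreal (r x)) \<longlongrightarrow> 0 + ennreal (0 * enn2real (hit s W i))) at_top"
    by (intro tendsto_add f_top tendsto_ennrealI r_top)
  then show "(R \<longlongrightarrow> 0) at_top"
    unfolding R[symmetric, abs_def] by simp
qed

end

text \<open>
  Data indexed by \<open>S\<close> are extended by zero, and by point masses at 0, so that sums run over all
  natural numbers and no junk value outside \<open>S\<close> is ever met.
\<close>

definition extend_mat :: "nat set \<Rightarrow> (nat \<Rightarrow> nat \<Rightarrow> real) \<Rightarrow> nat \<Rightarrow> nat \<Rightarrow> ennreal" where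
  "extend_mat S Q i k = (if i \<in> S \<and> k \<in> S then ennreal (Q i k) else 0)"

definition extend_vec :: "nat set \<Rightarrow> (nat \<Rightarrow> real) \<Rightarrow> nat \<Rightarrow> ennreal" where
  "extend_vec S u i = (if i \<in> S then ennreal (u i) else 0)"

definition extend_dist :: "nat set \<Rightarrow> (nat \<Rightarrow> nat \<Rightarrow> real measure) \<Rightarrow> nat \<Rightarrow> nat \<Rightarrow> real measure" where
  "extend_dist S F i k = (if i \<in> S \<and> k \<in> S then F i k else return borel 0)"

lemma infsum_eq_nn_integral_indicator:
  fixes f :: "'a :: countable \<Rightarrow> ennreal"
  shows "infsum f S = (\<integral>\<^sup>+x. f x * indicator S x \<partial>count_space UNIV)"
  unfolding infsum_eq_nn_integral_count_space
  by (rule nn_integral_count_space_indicator) (simp add: NO_MATCH_def)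

lemma infsum_eq_mstep:
  assumes "i \<in> S"
  shows "(\<Sum>\<^sub>\<infinity>k\<in>S. ennreal (Q i k) * g k) = mstep (extend_mat S Q) g i"
  unfolding infsum_eq_nn_integral_indicator mstep_def
  using assms by (intro nn_integral_cong) (auto simp: extend_mat_def)

lemma mat_power_eq:
  "i \<in> S \<Longrightarrow> mat_power S Q n i j = (mstep (extend_mat S Q) ^^ n) (indicator {j}) i"
proof (induction n arbitrary: i)
  case (Suc n)
  have "mat_power S Q (Suc n) i j = (\<Sum>\<^sub>\<infinity>k\<in>S. ennreal (Q i k) * (mstep (extend_mat S Q) ^^ n) (indicator {j}) k)"
    using Suc.IH by (auto intro!: infsum_cong)
  then show ?case by (simp add: infsum_eq_mstep[OF Suc.prems])
qed auto

lemma infsum_ennreal_has_sum: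
  assumes "(f has_sum a) S" "\<And>x. x \<in> S \<Longrightarrow> 0 \<le> f x"
  shows "(\<Sum>\<^sub>\<infinity>x\<in>S. ennreal (f x)) = ennreal a"
proof -
  have "(\<Sum>\<^sub>\<infinity>x\<in>S. ennreal (f x)) = (SUP T\<in>{T. finite T \<and> T \<subseteq> S}. \<Sum>x\<in>T. ennreal (f x))"
    by (rule nonneg_infsum_complete) simp
  also have "\<dots> = (SUP T\<in>{T. finite T \<and> T \<subseteq> S}. ennreal (sum f T))"
    using assms(2) by (intro SUP_cong refl sum_ennreal) auto
  also have "\<dots> = ennreal (infsum f S)"
    using assms by (intro infsum_nonneg_is_SUPREMUM_ennreal[symmetric]) (auto simp: summable_on_def)
  finally show ?thesis using infsumI[OF assms(1)] by simp
qed

lemma additive_kernel_extend_dist: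
  assumes "\<forall>i\<in>S. \<forall>j\<in>S. real_distribution (F i j)" shows "additive_kernel (extend_dist S F)"
proof (rule additive_kernel.intro)
  have "real_distribution (return borel (0::real))"
    by (intro real_distribution.intro prob_space_return real_distribution_axioms.intro) simp_all
  then show "real_distribution (extend_dist S F i j)" for i j
    using assms by (simp add: extend_dist_def)
qed

text \<open>Both recursions peel off the first step: an increment y lowers the remaining level t - x
  by y, which is the same as moving the starting position from x to x + y.\<close>

lemma conv_power_eq:
  assumes F: "\<forall>i\<in>S. \<forall>j\<in>S. real_distribution (F i j)"
  shows "i \<in> S \<Longrightarrow> conv_power S Q F n i j (t - x)
    = (additive_kernel.step (extend_dist S F) (\<lambda>y. y) (extend_mat S Q) ^^ n) (\<lambda>k z. indicator {j} k * indicator {..t} z) i x"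
proof (induction n arbitrary: i x)
  case (Suc n)
  interpret additive_kernel "extend_dist S F" by (rule additive_kernel_extend_dist[OF F])
  let ?f = "(step (\<lambda>y. y) (extend_mat S Q) ^^ n) (\<lambda>k z. indicator {j} k * indicator {..t} z)"
  have "conv_power S Q F (Suc n) i j (t - x) = (\<Sum>\<^sub>\<infinity>k\<in>S. ennreal (Q i k) * (\<integral>\<^sup>+y. ?f k (x + y) \<partial>extend_dist S F i k))"
    unfolding conv_power.simps
  proof (rule infsum_cong)
    fix k assume k: "k \<in> S"
    have "conv_power S Q F n k j (t - x - y) = ?f k (x + y)" for y
      using Suc.IH[OF k, of "x + y"] by (simp add: algebra_simps)
    then show "ennreal (Q i k) * (\<integral>\<^sup>+y. conv_power S Q F n k j (t - x - y) \<partial>F i k)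
      = ennreal (Q i k) * (\<integral>\<^sup>+y. ?f k (x + y) \<partial>extend_dist S F i k)"
      using k Suc.prems by (simp add: extend_dist_def)
  qed
  also have "\<dots> = step (\<lambda>y. y) (extend_mat S Q) ?f i x"
    using infsum_eq_mstep[OF Suc.prems, of Q "\<lambda>k. \<integral>\<^sup>+y. ?f k (x + y) \<partial>extend_dist S F i k"]
    by (simp add: step_def mstep_def)
  finally show ?case by simp
qed (auto simp: indicator_def)

lemma infsum_product_eq:
  "(\<Sum>\<^sub>\<infinity>(i, j)\<in>S \<times> S. ennreal (u i * Q i j * v j) * (\<integral>\<^sup>+x. ennreal (\<phi> x) \<partial>F i j))
    = (\<Sum>i. \<Sum>k. extend_vec S u i * extend_mat S Q i k * extend_vec S v k * (\<integral>\<^sup>+x. ennreal (\<phi> x) \<partial>extend_dist S F i k))"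
  if nonneg: "\<And>i j. i \<in> S \<Longrightarrow> j \<in> S \<Longrightarrow> 0 \<le> Q i j \<and> 0 \<le> u i \<and> 0 \<le> v i"
proof -
  let ?g = "\<lambda>i k. extend_vec S u i * extend_mat S Q i k * extend_vec S v k * (\<integral>\<^sup>+x. ennreal (\<phi> x) \<partial>extend_dist S F i k)"
  have "(\<Sum>\<^sub>\<infinity>(i, j)\<in>S \<times> S. ennreal (u i * Q i j * v j) * (\<integral>\<^sup>+x. ennreal (\<phi> x) \<partial>F i j)) = (\<integral>\<^sup>+p. ?g (fst p) (snd p) \<partial>count_space UNIV)"
    unfolding infsum_eq_nn_integral_indicator
  proof (rule nn_integral_cong)
    fix p :: "nat \<times> nat"
    obtain i k where p: "p = (i, k)" by (cases p)
    show "(case p of (i, j) \<Rightarrow> ennreal (u i * Q i j * v j) * (\<integral>\<^sup>+x. ennreal (\<phi> x) \<partial>F i j)) * indicator (S \<times> S) p = ?g (fst p) (snd p)"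
      using nonneg[of i k] nonneg[of k i]
      by (auto simp: p extend_vec_def extend_mat_def extend_dist_def indicator_def ennreal_mult)
  qed
  also have "\<dots> = (\<integral>\<^sup>+i. \<integral>\<^sup>+k. ?g i k \<partial>count_space UNIV \<partial>count_space UNIV)"
    using nn_integral_fst_count_space[of "\<lambda>p. ?g (fst p) (snd p)"] by simp
  finally show ?thesis by (simp only: nn_integral_count_space_nat)
qed

text \<open>
  An atom \<open>x\<close> of the return law off 0 is a multiple of every lattice span, which bounds the spans and
  forces the largest one to exist.
\<close>

lemma divisors_have_max:
  fixes L :: "real \<Rightarrow> bool"
  assumes ex: "L d" and pos: "\<And>d. L d \<Longrightarrow> 0 < d" and x: "x \<noteq> 0" and mem: "\<And>d. L d \<Longrightarrow> x \<in> lattice d"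
  obtains m where "L m" "\<And>d. L d \<Longrightarrow> d \<le> m"
proof -
  have div: "\<exists>n::nat. 0 < n \<and> d = \<bar>x\<bar> / of_nat n" if d: "L d" for d
  proof -
    obtain k :: int where k: "x = d * of_int k" using mem[OF d] by (auto simp: lattice_def)
    have "k \<noteq> 0" using k x by auto
    moreover have "\<bar>x\<bar> = d * of_nat (nat \<bar>k\<bar>)" using k pos[OF d] by (simp add: abs_mult)
    ultimately show ?thesis by (intro exI[of _ "nat \<bar>k\<bar>"]) (simp add: field_simps)
  qed
  \<comment> \<open>Every span is |x| / n for a positive integer n, so the largest span belongs to
    the least n.\<close>
  define N where "N = (LEAST n::nat. 0 < n \<and> L (\<bar>x\<bar> / of_nat n))"
  have "\<exists>n::nat. 0 < n \<and> L (\<bar>x\<bar> / of_nat n)" using div[OF ex] ex by auto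
  then have N: "0 < N \<and> L (\<bar>x\<bar> / of_nat N)" unfolding N_def by (rule LeastI_ex)
  show thesis
  proof (rule that[of "\<bar>x\<bar> / of_nat N"])
    show "L (\<bar>x\<bar> / of_nat N)" using N by simp
    fix d assume d: "L d"
    obtain n :: nat where n: "0 < n" "d = \<bar>x\<bar> / of_nat n" using div[OF d] by blast
    then have "N \<le> n" unfolding N_def using d by (intro Least_le) auto
    then show "d \<le> \<bar>x\<bar> / of_nat N" unfolding n(2) using N by (intro divide_left_mono) auto
  qed
qed

text \<open>A lattice is countable, so a law on it without atoms off 0 is concentrated at 0.\<close>

lemma ex_nonzero_atom:
  assumes M: "real_distribution M" and lattice: "AE z in M. z \<in> lattice d" and nonzero: "\<not> (AE z in M. z = 0)"
  obtains x where "x \<noteq> 0" "emeasure M {x} \<noteq> 0"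
proof (rule ccontr)
  interpret real_distribution M by (rule M)
  assume "\<not> thesis"
  then have atom: "emeasure M {x} = 0" if "x \<noteq> 0" for x using that \<open>\<And>x. x \<noteq> 0 \<Longrightarrow> emeasure M {x} \<noteq> 0 \<Longrightarrow> thesis\<close> by blast
  have "(\<Union>x\<in>lattice d - {0}. {x}) \<in> null_sets M"
    using atom by (intro null_sets_UN' countable_Diff countable_lattice) (auto simp: null_sets_def)
  then have "AE z in M. z \<notin> (\<Union>x\<in>lattice d - {0}. {x})" by (rule AE_not_in)
  with lattice have "AE z in M. z = 0" by eventually_elim auto
  with nonzero show False by simp
qed

section \<open>From nonarithmetic kernels to nonlattice return laws\<close>

context recurrent_kernel
begin

lemma AE_lattice_of_span:
  assumes \<kappa>: "(\<integral>\<^sup>+z. indicator (- lattice d) z \<partial>\<kappa>) = entrance (\<lambda>y. y) s W (indicator (- lattice d)) s 0"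
    and sets: "sets \<kappa> = sets borel"
    and inc: "\<And>i k. W i k \<noteq> 0 \<Longrightarrow> AE y in F i k. y - (\<gamma> k - \<gamma> i) \<in> lattice d"
  shows "AE z in \<kappa>. z \<in> lattice d"
proof -
  have "(\<lambda>z. indicator (- lattice d) z :: ennreal) \<in> borel_measurable \<kappa>"
    unfolding measurable_cong_sets[OF sets refl] by measurable
  then have "AE z in \<kappa>. indicator (- lattice d) z = (0 :: ennreal)"
    using \<kappa> entrance_vanish_on_lattice[OF inc] by (subst nn_integral_0_iff_AE[symmetric]) auto
  then show ?thesis by eventually_elim (auto simp: indicator_def split: if_splits)
qed

text \<open>A lattice for the return law yields some span of the kernel, but the hypothesis denies
  only a largest one. Every span is also a lattice for the return law, so a nonzero atom divides
  down to all of them and a largest span exists after all.\<close>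

lemma not_lattice:
  assumes maximal: "\<nexists>m. L m \<and> (\<forall>d. L d \<longrightarrow> d \<le> m)"
    and L: "\<And>d. L d \<longleftrightarrow> 0 < d \<and> (\<exists>\<gamma>. (\<forall>i. 0 \<le> \<gamma> i \<and> \<gamma> i < d) \<and>
        (\<forall>i k. W i k \<noteq> 0 \<longrightarrow> (AE y in F i k. y - (\<gamma> k - \<gamma> i) \<in> lattice d)))"
    and drift: "drift_sum (\<lambda>y. max (- y) 0) < top" "drift_sum (\<lambda>y. max (- y) 0) < drift_sum (\<lambda>y. max y 0)"
    and d: "0 < d"
  shows "entrance (\<lambda>y. y) s W (indicator (- lattice d)) s 0 \<noteq> 0"
proof
  assume null: "entrance (\<lambda>y. y) s W (indicator (- lattice d)) s 0 = 0"
  obtain \<gamma> where \<gamma>: "\<And>i. 0 \<le> \<gamma> i" "\<And>i. \<gamma> i < d"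
    "\<And>i k. W i k \<noteq> 0 \<Longrightarrow> AE y in F i k. y - (\<gamma> k - \<gamma> i) \<in> lattice d"
    using lattice_of_entrance[OF d null] by metis
  then have Ld: "L d" unfolding L using d by blast
  obtain \<kappa> where dist: "real_distribution \<kappa>"
    and \<kappa>0: "\<And>f. f \<in> borel_measurable borel \<Longrightarrow> (\<integral>\<^sup>+z. f z \<partial>\<kappa>) = entrance (\<lambda>y. y) s W f s 0"
    by (rule entrance_law) metis
  then interpret K: real_distribution \<kappa> by simp
  have lat: "AE z in \<kappa>. z \<in> lattice d" if Ld': "L d" for d
  proof -
    obtain \<gamma> where "\<And>i k. W i k \<noteq> 0 \<Longrightarrow> AE y in F i k. y - (\<gamma> k - \<gamma> i) \<in> lattice d"
      using Ld' unfolding L by blast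
    then show ?thesis by (intro AE_lattice_of_span[OF \<kappa>0 K.events_eq_borel]) auto
  qed
  \<comment> \<open>A return law concentrated at 0 has mean 0, while Wald's identity and the drift
    condition make its positive part strictly larger in mean.\<close>
  have "\<not> (AE z in \<kappa>. z = 0)"
  proof
    assume ae: "AE z in \<kappa>. z = 0"
    have "(\<integral>\<^sup>+z. ennreal (max z 0) \<partial>\<kappa>) = (\<integral>\<^sup>+z. 0 \<partial>\<kappa>)" "(\<integral>\<^sup>+z. ennreal (max (- z) 0) \<partial>\<kappa>) = (\<integral>\<^sup>+z. 0 \<partial>\<kappa>)"
      by (rule nn_integral_cong_AE, rule eventually_mono[OF ae], simp)+
    then have "entrance (\<lambda>y. y) s W (\<lambda>x. ennreal (max x 0)) s 0 = 0" "entrance (\<lambda>y. y) s W (\<lambda>x. ennreal (max (- x) 0)) s 0 = 0"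
      using \<kappa>0[of "\<lambda>x. ennreal (max x 0)"] \<kappa>0[of "\<lambda>x. ennreal (max (- x) 0)"] by simp_all
    then have "entrance (\<lambda>y. max (- y) 0) s W ennreal s 0 = entrance (\<lambda>y. max y 0) s W ennreal s 0"
      using entrance_pos_neg(1) by simp
    moreover have "entrance (\<lambda>y. max y 0) s W ennreal s 0 = inverse (u s) * inverse (v s) * drift_sum (\<lambda>y. max y 0)"
      "entrance (\<lambda>y. max (- y) 0) s W ennreal s 0 = inverse (u s) * inverse (v s) * drift_sum (\<lambda>y. max (- y) 0)"
      unfolding drift_sum_def by (rule entrance_mean; auto)+
    moreover have "inverse (u s) * inverse (v s) * drift_sum (\<lambda>y. max (- y) 0) < inverse (u s) * inverse (v s) * drift_sum (\<lambda>y. max y 0)"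
      using drift by (intro ennreal_mult_strict_left_mono inverse_weight_pos inverse_weight_fin)
    ultimately show False by simp
  qed
  then obtain x where x: "x \<noteq> 0" "emeasure \<kappa> {x} \<noteq> 0"
    using ex_nonzero_atom[OF dist lat[OF Ld]] by metis
  have "x \<in> lattice d" if "L d" for d
  proof (rule ccontr)
    assume "x \<notin> lattice d"
    with lat[OF that] have "AE z in \<kappa>. z \<noteq> x" by (auto elim!: eventually_mono)
    then have "emeasure \<kappa> {z \<in> space \<kappa>. \<not> z \<noteq> x} = 0" by (subst (asm) AE_iff_measurable[OF _ refl]) auto
    with x show False by simp
  qed
  then obtain m where "L m" "\<And>d. L d \<Longrightarrow> d \<le> m"
    using divisors_have_max[of L d x] Ld x(1) L by metis
  with maximal show False by blast
qed

end

section \<open>The Markov renewal theorem\<close>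

lemma mstep_pow_ge: "y k * (mstep W ^^ n) (indicator {k}) i \<le> (mstep W ^^ n) y i"
proof -
  have "(mstep W ^^ n) (\<lambda>l. y k * indicator {k} l) i \<le> (mstep W ^^ n) y i"
    by (intro mstep_pow_mono) (auto simp: indicator_def)
  then show ?thesis by (simp only: mstep_pow_cmult)
qed

text \<open>Go from j to i in a steps, loop at i for n steps and come back in b steps: the entry (j,
  j) of the power n + a + b is at least a positive constant times the entry (i, i) of the power
  n.\<close>

lemma mstep_recurrent_transfer:
  assumes rec: "(\<Sum>n. (mstep W ^^ n) (indicator {i}) i) = top"
    and a: "0 < (mstep W ^^ a) (indicator {i}) j" and b: "0 < (mstep W ^^ b) (indicator {j}) i"
  shows "(\<Sum>n. (mstep W ^^ n) (indicator {j}) j) = top"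
proof -
  let ?\<alpha> = "(mstep W ^^ a) (indicator {i}) j" and ?\<beta> = "(mstep W ^^ b) (indicator {j}) i"
  let ?r = "\<lambda>n. (mstep W ^^ n) (indicator {j}) j"
  have le: "?\<alpha> * ?\<beta> * (mstep W ^^ n) (indicator {i}) i \<le> ?r (n + (a + b))" for n
  proof -
    have "?\<alpha> * ?\<beta> * (mstep W ^^ n) (indicator {i}) i = (?\<beta> * (mstep W ^^ n) (indicator {i}) i) * ?\<alpha>"
      by (simp only: mult_ac)
    also have "\<dots> \<le> (mstep W ^^ n) ((mstep W ^^ b) (indicator {j})) i * ?\<alpha>"
      by (intro mult_right_mono mstep_pow_ge) simp
    also have "\<dots> \<le> (mstep W ^^ a) ((mstep W ^^ n) ((mstep W ^^ b) (indicator {j}))) j"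
      by (rule mstep_pow_ge)
    also have "\<dots> = ?r (a + (n + b))" by (simp only: funpow_add o_apply)
    also have "a + (n + b) = n + (a + b)" by simp
    finally show ?thesis .
  qed
  have "?\<alpha> * ?\<beta> \<noteq> 0" using a b by auto
  then have "top = ?\<alpha> * ?\<beta> * (\<Sum>n. (mstep W ^^ n) (indicator {i}) i)" by (simp add: rec ennreal_mult_top)
  also have "\<dots> \<le> (\<Sum>n. ?r (n + (a + b)))"
    unfolding ennreal_suminf_cmult[symmetric] by (intro suminf_le summableI le)
  also have "\<dots> \<le> (\<Sum>n. ?r n)"
    by (subst suminf_offset[OF summableI, of ?r "a + b"]) simp
  finally show ?thesis by (simp add: top_unique)
qed

text \<open>Positivity of u and v makes the condition on u_i q_ij v_j one on nonzero entries of the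
  extended matrix. The shifts are set to 0 off S, where no entry is met.\<close>

lemma lattice_span_iff:
  assumes F: "\<forall>i\<in>S. \<forall>j\<in>S. real_distribution (F i j)"
    and Q: "\<And>i j. i \<in> S \<Longrightarrow> j \<in> S \<Longrightarrow> 0 \<le> Q i j" and u: "\<And>i. i \<in> S \<Longrightarrow> 0 < u i" and v: "\<And>i. i \<in> S \<Longrightarrow> 0 < v i"
  shows "lattice_span S Q F u v d \<longleftrightarrow> 0 < d \<and> (\<exists>\<gamma>. (\<forall>i. 0 \<le> \<gamma> i \<and> \<gamma> i < d) \<and>
        (\<forall>i k. extend_mat S Q i k \<noteq> 0 \<longrightarrow> (AE y in extend_dist S F i k. y - (\<gamma> k - \<gamma> i) \<in> lattice d)))"
proof -
  have W: "extend_mat S Q i k \<noteq> 0 \<longleftrightarrow> i \<in> S \<and> k \<in> S \<and> u i * Q i k * v k > 0" for i k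
    using Q[of i k] u[of i] v[of k] by (auto simp: extend_mat_def zero_less_mult_iff ennreal_eq_0_iff not_le)
  have m: "measure (F i k) (range (\<lambda>l::int. \<gamma> k - \<gamma> i + d * of_int l)) = 1 \<longleftrightarrow>
      (AE y in extend_dist S F i k. y - (\<gamma> k - \<gamma> i) \<in> lattice d)" if "i \<in> S" "k \<in> S" for i k and \<gamma> :: "nat \<Rightarrow> real"
  proof -
    interpret real_distribution "F i k" using F that by blast
    have eq: "extend_dist S F i k = F i k" using that by (simp add: extend_dist_def)
    have "{y. y - (\<gamma> k - \<gamma> i) \<in> lattice d} \<in> sets borel" by measurable
    then show ?thesis unfolding lattice_shift_eq eq by (simp add: prob_eq_1)
  qed
  show ?thesis
  proof
    assume L: "lattice_span S Q F u v d"
    then obtain \<gamma> where \<gamma>: "\<forall>i\<in>S. 0 \<le> \<gamma> i \<and> \<gamma> i < d"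
      "\<forall>i\<in>S. \<forall>j\<in>S. u i * Q i j * v j > 0 \<longrightarrow> measure (F i j) (range (\<lambda>k::int. \<gamma> j - \<gamma> i + d * of_int k)) = 1"
      unfolding lattice_span_def by blast
    have "0 < d" using L by (simp add: lattice_span_def)
    moreover have "AE y in extend_dist S F i k. y - ((if k \<in> S then \<gamma> k else 0) - (if i \<in> S then \<gamma> i else 0)) \<in> lattice d"
      if "extend_mat S Q i k \<noteq> 0" for i k
      using \<gamma>(2) that m[of i k \<gamma>] unfolding W by simp
    ultimately show "0 < d \<and> (\<exists>\<gamma>. (\<forall>i. 0 \<le> \<gamma> i \<and> \<gamma> i < d) \<and>
        (\<forall>i k. extend_mat S Q i k \<noteq> 0 \<longrightarrow> (AE y in extend_dist S F i k. y - (\<gamma> k - \<gamma> i) \<in> lattice d)))"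
      using \<gamma>(1) by (intro conjI exI[of _ "\<lambda>i. if i \<in> S then \<gamma> i else 0"]) auto
  next
    assume "0 < d \<and> (\<exists>\<gamma>. (\<forall>i. 0 \<le> \<gamma> i \<and> \<gamma> i < d) \<and>
        (\<forall>i k. extend_mat S Q i k \<noteq> 0 \<longrightarrow> (AE y in extend_dist S F i k. y - (\<gamma> k - \<gamma> i) \<in> lattice d)))"
    then obtain \<gamma> where \<gamma>: "0 < d" "\<forall>i. 0 \<le> \<gamma> i \<and> \<gamma> i < d"
      "\<forall>i k. extend_mat S Q i k \<noteq> 0 \<longrightarrow> (AE y in extend_dist S F i k. y - (\<gamma> k - \<gamma> i) \<in> lattice d)" by blast
    show "lattice_span S Q F u v d"
      unfolding lattice_span_def
    proof (intro conjI exI[of _ \<gamma>] ballI impI)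
      fix i j assume ij: "i \<in> S" "j \<in> S" "0 < u i * Q i j * v j"
      then have "AE y in extend_dist S F i j. y - (\<gamma> j - \<gamma> i) \<in> lattice d" using \<gamma>(3) W by blast
      then show "measure (F i j) (range (\<lambda>k::int. \<gamma> j - \<gamma> i + d * of_int k)) = 1" using m[OF ij(1,2)] by blast
    qed (use \<gamma> in auto)
  qed
qed

text \<open>The difference of two half-line indicators is that of (t, t + h]; finiteness of the
  matrix power makes the subtraction in \<open>ennreal\<close> exact. Translation then moves the
  window to (0, h] and the start from 0 to -t.\<close>

lemma renewal_measure_eq_potential:
  assumes V: "matrix_renewal_measure S Q F V" and F: "\<forall>i\<in>S. \<forall>j\<in>S. real_distribution (F i j)"
    and i: "i \<in> S" and j: "j \<in> S" and h: "0 < h"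
    and fin: "\<And>n. (mstep (extend_mat S Q) ^^ n) (indicator {j}) i < top"
  shows "emeasure (V i j) {t<..t + h}
    = additive_kernel.potential (extend_dist S F) (\<lambda>y. y) (extend_mat S Q) (\<lambda>k z. indicator {j} k * indicator {0<..h} z) i (- t)"
proof -
  interpret additive_kernel "extend_dist S F" by (rule additive_kernel_extend_dist[OF F])
  let ?W = "extend_mat S Q" and ?st = "step (\<lambda>y::real. y) (extend_mat S Q)"
  let ?f = "\<lambda>B k (z :: real). indicator {j} k * indicator B z :: ennreal"
  have mf: "meas (?f B)" if "B \<in> sets borel" for B
    unfolding meas_def using that by (intro allI borel_measurable_times_ennreal borel_measurable_const borel_measurable_indicator)
  have "conv_power S Q F n i j (t + h) - conv_power S Q F n i j t = (?st ^^ n) (?f {0<..h}) i (- t)" for n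
  proof -
    have cp: "conv_power S Q F n i j t' = (?st ^^ n) (?f {..t'}) i 0" for t'
      using conv_power_eq[OF F i, of Q n j t' 0] by simp
    have split: "?f {..t + h} = (\<lambda>k z. ?f {..t} k z + ?f {t<..t + h} k z)"
      using h by (auto simp: fun_eq_iff indicator_def)
    have "(?st ^^ n) (?f {..t + h}) i 0 = (?st ^^ n) (?f {..t}) i 0 + (?st ^^ n) (?f {t<..t + h}) i 0"
      unfolding split by (subst step_pow_add) (auto intro: mf)
    moreover have "(?st ^^ n) (?f {..t}) i 0 \<noteq> top"
    proof -
      have "(?st ^^ n) (?f {..t}) i 0 \<le> (?st ^^ n) (\<lambda>k z. indicator {j} k) i 0"
        by (intro step_pow_mono) (auto simp: indicator_def)
      also have "\<dots> < top" unfolding step_pow_const by (rule fin)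
      finally show ?thesis by simp
    qed
    moreover have "(?st ^^ n) (?f {t<..t + h}) i 0 = (?st ^^ n) (?f {0<..h}) i (- t)"
    proof -
      have eq: "?f {t<..t + h} = (\<lambda>k z. ?f {0<..h} k (z + (- t)))"
        by (auto simp: fun_eq_iff indicator_def)
      have tr: "(?st ^^ n) (\<lambda>k z. ?f {0<..h} k (z + (- t))) = (\<lambda>i x. (?st ^^ n) (?f {0<..h}) i (x + (- t)))"
        by (rule step_pow_translate)
      show ?thesis unfolding eq tr by simp
    qed
    ultimately show ?thesis unfolding cp by simp
  qed
  then show ?thesis
    using V i j h unfolding matrix_renewal_measure_def potential_def by simp
qed

theorem theorem1p1:
  fixes S :: "nat set"
    and Q :: "nat \<Rightarrow> nat \<Rightarrow> real"
    and F V :: "nat \<Rightarrow> nat \<Rightarrow> real measure"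
    and u v :: "nat \<Rightarrow> real"
    and \<mu> :: ereal
  assumes "index_set S"
    and "quasi_stochastic S Q"
    and "pos_left_eigenvector S Q u"
    and "pos_right_eigenvector S Q v"
    and "\<forall>i\<in>S. \<forall>j\<in>S. real_distribution (F i j)"
    and "\<exists>i\<in>S. (\<Sum>n. mat_power S Q (Suc n) i i) = \<infinity>"
    and "drift_well_defined S Q F u v"
    and "\<mu> = drift S Q F u v"
    and "\<mu> > 0"
    and "nonarithmetic S Q F u v"
    and "matrix_renewal_measure S Q F V"
  shows "\<forall>h>0. \<forall>i\<in>S. \<forall>j\<in>S.
           ((\<lambda>t. enn2ereal (emeasure (V i j) {t<..t + h})) \<longlongrightarrow> ereal (v i * u j * h) / \<mu>) at_top \<and>
           ((\<lambda>t. enn2ereal (emeasure (V i j) {t<..t + h})) \<longlongrightarrow> 0) at_bot"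
proof (intro allI impI ballI)
  fix h :: real and i j assume h: "0 < h" and i: "i \<in> S" and j: "j \<in> S"
  note F = assms(5)
  have Q: "\<And>i j. i \<in> S \<Longrightarrow> j \<in> S \<Longrightarrow> 0 \<le> Q i j" and irr: "irreducible_mat S Q"
    using assms(2) by (auto simp: quasi_stochastic_def)
  have u: "\<And>i. i \<in> S \<Longrightarrow> 0 < u i" and usum: "\<And>j. j \<in> S \<Longrightarrow> ((\<lambda>i. u i * Q i j) has_sum u j) S"
    using assms(3) by (auto simp: pos_left_eigenvector_def)
  have v: "\<And>i. i \<in> S \<Longrightarrow> 0 < v i" and vsum: "\<And>i. i \<in> S \<Longrightarrow> ((\<lambda>j. Q i j * v j) has_sum v i) S"
    using assms(4) by (auto simp: pos_right_eigenvector_def)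
  let ?F = "extend_dist S F" and ?W = "extend_mat S Q" and ?u = "extend_vec S u" and ?v = "extend_vec S v"
  have v_inv: "mstep ?W ?v k = ?v k" for k
  proof (cases "k \<in> S")
    case True
    have "mstep ?W ?v k = (\<Sum>\<^sub>\<infinity>l\<in>S. ennreal (Q k l) * ?v l)" by (rule infsum_eq_mstep[OF True, symmetric])
    also have "\<dots> = (\<Sum>\<^sub>\<infinity>l\<in>S. ennreal (Q k l * v l))"
      using Q[OF True] v by (intro infsum_cong) (auto simp: extend_vec_def ennreal_mult less_imp_le)
    also have "\<dots> = ennreal (v k)"
      using vsum[OF True] Q[OF True] v by (intro infsum_ennreal_has_sum) (auto simp: less_imp_le)
    finally show ?thesis using True by (simp add: extend_vec_def)
  qed (simp add: mstep_def extend_mat_def extend_vec_def)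
  have u_inv: "(\<Sum>i. ?u i * ?W i k) = ?u k" for k
  proof (cases "k \<in> S")
    case True
    have "(\<Sum>i. ?u i * ?W i k) = (\<Sum>\<^sub>\<infinity>i\<in>S. ennreal (u i * Q i k))"
      unfolding infsum_eq_nn_integral_indicator nn_integral_count_space_nat
      using True Q u by (intro arg_cong[where f=suminf] ext) (auto simp: extend_vec_def extend_mat_def ennreal_mult less_imp_le indicator_def)
    also have "\<dots> = ennreal (u k)"
      using usum[OF True] Q[OF _ True] u by (intro infsum_ennreal_has_sum) (auto simp: less_imp_le)
    finally show ?thesis using True by (simp add: extend_vec_def)
  qed (simp add: extend_mat_def extend_vec_def)
  have reach: "\<exists>n. 0 < (mstep ?W ^^ n) (indicator {l}) k" if "k \<in> S" "l \<in> S" for k l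
    using irr that mat_power_eq[of k S Q _ l] unfolding irreducible_mat_def by metis
  obtain i0 where i0: "i0 \<in> S" "(\<Sum>n. mat_power S Q (Suc n) i0 i0) = \<infinity>" using assms(6) by blast
  have "(\<Sum>n. (mstep ?W ^^ n) (indicator {i0}) i0) = top"
    using i0 by (subst suminf_Suc_ennreal) (simp only: mat_power_eq infinity_ennreal_def, simp)
  \<comment> \<open>The target column j becomes the reference state, so recurrence is carried over
    from the state i0 at which it is given; the missing term n = 0 was added above.\<close>
  then have rec: "(\<Sum>n. (mstep ?W ^^ n) (indicator {j}) j) = top"
    using reach[OF j i0(1)] reach[OF i0(1) j] mstep_recurrent_transfer by blast
  have vj: "?v j = ennreal (v j)" and vi: "?v i = ennreal (v i)" and uj: "?u j = ennreal (u j)"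
    using i j by (auto simp: extend_vec_def)
  interpret R: recurrent_kernel ?F S ?W ?u ?v j
  proof (intro recurrent_kernel.intro recurrent_kernel_axioms.intro)
    show "additive_kernel ?F" by (rule additive_kernel_extend_dist[OF F])
  qed (use j v_inv u_inv reach rec u v in \<open>auto simp: extend_mat_def extend_vec_def\<close>)
  have Dp: "R.drift_sum (\<lambda>y. max y 0) = drift_pos S Q F u v"
    unfolding R.drift_sum_def drift_pos_def using Q u v by (intro infsum_product_eq[symmetric]) (auto simp: less_imp_le)
  have Dn: "R.drift_sum (\<lambda>y. max (- y) 0) = drift_neg S Q F u v"
    unfolding R.drift_sum_def drift_neg_def using Q u v by (intro infsum_product_eq[symmetric]) (auto simp: less_imp_le)
  let ?p = "drift_pos S Q F u v" and ?n = "drift_neg S Q F u v"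
  have \<mu>: "\<mu> = enn2ereal ?p - enn2ereal ?n" "0 < enn2ereal ?p - enn2ereal ?n"
    using assms(8,9) by (auto simp: drift_def)
  \<comment> \<open>\<open>ereal\<close> evaluates infinity - infinity as infinity, so \<mu> > 0
    alone does not bound the negative part; \<open>drift_well_defined\<close> rules that case
    out.\<close>
  have n_fin: "?n < top"
  proof (rule ccontr)
    assume "\<not> ?n < top"
    then have n: "?n = top" using less_top by blast
    then have "?p < top" using assms(7) by (simp add: drift_well_defined_def)
    then obtain a where "?p = ennreal a" "0 \<le> a" by (cases ?p) auto
    with \<mu>(2) n show False by simp
  qed
  then obtain b where b: "?n = ennreal b" "0 \<le> b" by (cases ?n) auto
  have p_gt: "?n < ?p"
  proof (cases ?p)
    case (real a)
    then show ?thesis using \<mu>(2) b by (simp add: ennreal_less_iff)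
  qed (use n_fin in simp)
  have nonlat: "R.entrance (\<lambda>y. y) j ?W (indicator (- lattice d)) j 0 \<noteq> 0" if "0 < d" for d
  proof (rule R.not_lattice[where L="lattice_span S Q F u v"])
    show "\<nexists>m. lattice_span S Q F u v m \<and> (\<forall>d. lattice_span S Q F u v d \<longrightarrow> d \<le> m)"
      using assms(10) by (simp add: nonarithmetic_def arithmetic_def)
  qed (use lattice_span_iff[OF F Q u v] n_fin p_gt that in \<open>auto simp: Dp Dn\<close>)
  let ?R = "R.potential (\<lambda>y. y) ?W (\<lambda>k z. indicator {j} k * indicator {0<..h} z) i"
  let ?c = "inverse (?u j) * inverse (?v j)"
  let ?L = "h * (if ?p = top then 0 else 1 / (enn2real (?c * ?p) - enn2real (?c * ?n))) * enn2real (hit j ?W i)"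
  have lims: "(?R \<longlongrightarrow> ennreal ?L) at_bot" "(?R \<longlongrightarrow> 0) at_top"
    using R.potential_limits[OF _ _ h nonlat, of i] n_fin p_gt unfolding Dp Dn by blast+
  \<comment> \<open>An infinite entry (i, j) of the n-th power would make v_i infinite, because v is
    fixed by that power and v_j > 0.\<close>
  have fin: "(mstep ?W ^^ n) (indicator {j}) i < top" for n
  proof (rule ccontr)
    assume "\<not> (mstep ?W ^^ n) (indicator {j}) i < top"
    then have top: "(mstep ?W ^^ n) (indicator {j}) i = top" using less_top by blast
    have "?v j * top \<le> (mstep ?W ^^ n) ?v i" using mstep_pow_ge[where y = ?v and k = j and W = ?W and n = n and i = i] by (simp only: top)
    also have "\<dots> = ?v i" using mstep_pow_fixed[of ?W ?v n] v_inv by simp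
    finally show False using v[OF j] by (simp add: vi vj ennreal_mult_top top_unique split: if_splits)
  qed
  have VR: "emeasure (V i j) {t<..t + h} = ?R (- t)" for t
    by (rule renewal_measure_eq_potential[OF assms(11) F i j h fin])
  have L: "ereal (v i * u j * h) / \<mu> = enn2ereal (ennreal ?L)"
  proof (cases ?p)
    case top
    then have "\<mu> = \<infinity>" using b by (simp add: \<mu>(1))
    then show ?thesis using top by (simp add: zero_ennreal.rep_eq)
  next
    case (real a)
    have ab: "b < a" using p_gt b real by (simp add: ennreal_less_iff)
    have c: "?c = ennreal (1 / (u j * v j))"
      using u[OF j] v[OF j] by (simp add: uj vj inverse_ennreal ennreal_mult[symmetric] divide_inverse)
    have "?c * ?p = ennreal (a / (u j * v j))" "?c * ?n = ennreal (b / (u j * v j))"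
      using u[OF j] v[OF j] b real by (simp_all add: c ennreal_mult[symmetric])
    then have cp: "enn2real (?c * ?p) = a / (u j * v j)" "enn2real (?c * ?n) = b / (u j * v j)"
      using u[OF j] v[OF j] b real by simp_all
    have "hit j ?W i = ennreal (v i / v j)"
      unfolding R.hit_eq using v[OF i] v[OF j] by (simp add: vi vj inverse_ennreal ennreal_mult[symmetric] divide_inverse mult.commute)
    then have hit: "enn2real (hit j ?W i) = v i / v j" using v[OF i] v[OF j] by simp
    \<comment> \<open>The return walk has mean (a - b) / (u_j v_j); its inverse times the entrance
      mass v_i / v_j leaves v_i u_j / (a - b).\<close>
    have "?L = v i * u j * h / (a - b)"
      unfolding cp hit using real u[OF j] v[OF j] ab by (simp add: diff_divide_distrib[symmetric])
    moreover have "0 \<le> v i * u j * h / (a - b)" using ab u[OF j] v[OF i] h by simp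
    moreover have "\<mu> = ereal (a - b)" using real b by (simp add: \<mu>(1))
    ultimately show ?thesis using ab by simp
  qed
  \<comment> \<open>The substitution x = -t exchanges the two ends of the line.\<close>
  have 1: "((\<lambda>t. ?R (- t)) \<longlongrightarrow> ennreal ?L) at_top"
    by (rule filterlim_compose[OF lims(1) filterlim_uminus_at_bot_at_top])
  have 2: "((\<lambda>t. ?R (- t)) \<longlongrightarrow> 0) at_bot"
    by (rule filterlim_compose[OF lims(2) filterlim_uminus_at_top_at_bot])
  have "((\<lambda>t. enn2ereal (?R (- t))) \<longlongrightarrow> enn2ereal (ennreal ?L)) at_top" using 1 by (rule tendsto_enn2erealI)
  moreover have "((\<lambda>t. enn2ereal (?R (- t))) \<longlongrightarrow> enn2ereal 0) at_bot" using 2 by (rule tendsto_enn2erealI)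
  ultimately show "((\<lambda>t. enn2ereal (emeasure (V i j) {t<..t + h})) \<longlongrightarrow> ereal (v i * u j * h) / \<mu>) at_top \<and>
           ((\<lambda>t. enn2ereal (emeasure (V i j) {t<..t + h})) \<longlongrightarrow> 0) at_bot"
    unfolding VR L by (simp only: zero_ennreal.rep_eq)
qed

end
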